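(* Let $V$ be a vertex operator algebra and let $g$ be an automorphism of $V$ of finite order $T$. For any $n,m\in(1/T)\mathbb{N}$, we have $$O_{g,n,m}(V)=O^{\prime}_{g,n,m}(V).$$
   Context: Let $\mathbb{N}=\{0,1,2,\dots\}$ and work over $\mathbb{C}$. $(V,Y,\mathbf{1},\omega)$ is a vertex operator algebra, $V=\bigoplus_{n\in\mathbb{Z}}V_n$; write $L(n)=\omega_{n+1}$, and $\operatorname{wt}u=n$ for $u\in V_n$ (such $u$ are called homogeneous). Whenever $\operatorname{wt}u$ appears, $u$ is assumed homogeneous; operations defined for homogeneous $u$ are extended linearly. An automorphism of $V$ is a linear isomorphism $g$ of $V$ with $g(\mathbf{1})=\mathbf{1}$, $g(\omega)=\omega$ and $g(Y(u,z)v)=Y(g(u),z)g(v)$ for all $u,v\in V$. Since $g$ has order $T$, $V=\bigoplus_{r=0}^{T-1}V^r$ with $V^r=\{v\in V\mid gv=\zeta^r v\}$, $\zeta=e^{-2\pi\sqrt{-1}/T}$. For $n\in(1/T)\mathbb{N}$ write $n=\lfloor n\rfloor+\bar n/T$ with $\bar n\in\{0,1,\dots,T-1\}$. For $0\le i\le T-1$ and $0\le r\le T-1$ put $\delta_i(r)=1$ if $i\ge r$ and $\delta_i(r)=0$ if $i<r$; put $\delta_i(T)=0$. For $\alpha\in\mathbb{R}$, $(1+x)^\alpha=\sum_{i\in\mathbb{N}}\binom{\alpha}{i}x^i$, with $\binom{\alpha}{i}=\frac{\alpha(\alpha-1)\cdots(\alpha-i+1)}{i!}$ for $i>0$ and $\binom{\alpha}{0}=1$.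 $\operatorname{Res}_x$ denotes the coefficient of $x^{-1}$. For $m,n,p\in(1/T)\mathbb{N}$, the bilinear product $*_{g,m,p}^{n}$ on $V$ is defined for $u\in V^r$, $v\in V$ by $$u*_{g,m,p}^{n}v=\sum_{i=0}^{\lfloor p\rfloor}(-1)^i\binom{\lfloor m\rfloor+\lfloor n\rfloor-\lfloor p\rfloor-1+\delta_{\bar m}(r)+\delta_{\bar n}(T-r)+i}{i}\operatorname{Res}_x\frac{(1+x)^{\operatorname{wt}u+\lfloor m\rfloor+\delta_{\bar m}(r)+r/T-1}}{x^{\lfloor m\rfloor+\lfloor n\rfloor-\lfloor p\rfloor+\delta_{\bar m}(r)+\delta_{\bar n}(T-r)+i}}Y(u,x)v$$ if $\bar p-\bar n\equiv r \bmod T$, and $u*_{g,m,p}^{n}v=0$ otherwise. For $u\in V^r$, $v\in V$ define (and extend bilinearly) $$u\circ_{g,m}^{n}v=\operatorname{Res}_x\frac{(1+x)^{\operatorname{wt}u+\delta_{\bar m}(r)+\lfloor m\rfloor+r/T-1}}{x^{\lfloor m\rfloor+\lfloor n\rfloor+\delta_{\bar m}(r)+\delta_{\bar n}(T-r)+1}}Y(u,x)v,$$ and set $L_{n,m}(V)=\operatorname{span}\{(L(-1)+L(0)+m-n)u\mid u\in V\}$ and $$O'_{g,n,m}(V)=\operatorname{span}\{u\circ_{g,m}^{n}v\mid u,v\in V\}+L_{n,m}(V).$$ Let $O''_{g,n,m}(V)$ be the linear span of all elements $$u*_{g,m,p_3}^{n}\big((a*_{g,p_1,p_2}^{p_3}b)*_{g,m,p_1}^{p_3}c-a*_{g,m,p_2}^{p_3}(b*_{g,m,p_1}^{p_2}c)\big)$$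 with $a,b,c,u\in V$ and $p_1,p_2,p_3\in(1/T)\mathbb{N}$. Let $$O'''_{g,n,m}(V)=\sum_{p_1,p_2\in(1/T)\mathbb{N}}\big(V*_{g,p_1,p_2}^{n}O'_{g,p_2,p_1}(V)\big)*_{g,m,p_1}^{n}V,$$ where products of subspaces denote linear spans of the products of elements. Finally $$O_{g,n,m}(V)=O'_{g,n,m}(V)+O''_{g,n,m}(V)+O'''_{g,n,m}(V).$$ *)

theory Defs
  imports
    "HOL-Library.Groups_Big_Fun"
    "HOL-Analysis.Complex_Transcendental"
    "HOL-Computational_Algebra.Formal_Laurent_Series"
begin

text \<open>
  Sums over an unrestricted index are \<^const>\<open>Sum_any\<close>, i.e. sums of finitely
  supported families.
\<close>

definition decomposition_of :: "('i \<Rightarrow> 'v set) \<Rightarrow> 'v::ab_group_add \<Rightarrow> ('i \<Rightarrow> 'v) \<Rightarrow> bool" where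
  "decomposition_of W v f \<longleftrightarrow>
     (\<forall>i. f i \<in> W i) \<and> finite {i. f i \<noteq> 0} \<and> v = Sum_any f"

definition is_direct_sum :: "('i \<Rightarrow> 'v::ab_group_add set) \<Rightarrow> bool" where
  "is_direct_sum W \<longleftrightarrow> (\<forall>v. \<exists>!f. decomposition_of W v f)"

definition component :: "('i \<Rightarrow> 'v::ab_group_add set) \<Rightarrow> 'i \<Rightarrow> 'v \<Rightarrow> 'v" where
  "component W i v = (THE f. decomposition_of W v f) i"


text \<open>
  The underlying space is the whole type \<^typ>\<open>'v\<close>, with complex scalar multiplication
  \<open>scale\<close>.  \<open>Y u n\<close> is the mode \<open>u_n\<close> in \<open>Y(u,z) = \<Sum>_n u_n z^(-n-1)\<close>, \<open>V n\<close> is the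
  homogeneous subspace \<open>V_n\<close>, and \<open>Y \<omega> (n + 1)\<close> is \<open>L(n)\<close>.

  The assumption \<open>jacobi\<close> is the coefficientwise form of
  \<open>z0^(-1) \<delta>((z1-z2)/z0) Y(u,z1) Y(v,z2) - z0^(-1) \<delta>((z2-z1)/(-z0)) Y(v,z2) Y(u,z1)
    = z2^(-1) \<delta>((z1-z0)/z2) Y(Y(u,z0)v,z2)\<close>
  applied to \<open>w\<close>: it is the coefficient of \<open>z0^(-l-1) z1^(-m-1) z2^(-n-1)\<close>.
\<close>

locale vertex_operator_algebra = vector_space scale
  for scale :: "complex \<Rightarrow> 'v::ab_group_add \<Rightarrow> 'v" (infixr \<open>*s\<close> 75) +
  fixes V :: "int \<Rightarrow> 'v set"
    and Y :: "'v \<Rightarrow> int \<Rightarrow> 'v \<Rightarrow> 'v"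
    and vac :: 'v
    and \<omega> :: 'v
  assumes grading_subspace: "subspace (V n)"
    and grading_direct_sum: "is_direct_sum V"
    and grading_finite_dim: "\<exists>B. finite B \<and> span B = V n"
    and grading_bounded_below: "\<exists>N. \<forall>n<N. V n = {0}"
    and vac_degree: "vac \<in> V 0"
    and omega_degree: "\<omega> \<in> V 2"
    and Y_linear_left: "Vector_Spaces.linear (*s) (*s) (\<lambda>u. Y u n v)"
    and Y_linear_right: "Vector_Spaces.linear (*s) (*s) (\<lambda>v. Y u n v)"
    and truncation: "\<exists>N. \<forall>n\<ge>N. Y u n v = 0"
    and vacuum: "Y vac n v = (if n = -1 then v else 0)"
    and creation: "n \<ge> 0 \<Longrightarrow> Y u n vac = 0" "Y u (-1) vac = u"
    and jacobi:
      "Sum_any (\<lambda>i::nat. (of_int m gchoose i) *s Y (Y u (l + int i) v) (m + n - int i) w) =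
       Sum_any (\<lambda>i::nat. ((-1) ^ i * (of_int l gchoose i)) *s
          (Y u (m + l - int i) (Y v (n + int i) w)
           - ((-1) powi l) *s Y v (n + l - int i) (Y u (m + int i) w)))"
    and virasoro:
      "\<exists>c. \<forall>m n v.
         Y \<omega> (m + 1) (Y \<omega> (n + 1) v) - Y \<omega> (n + 1) (Y \<omega> (m + 1) v) =
         of_int (m - n) *s Y \<omega> (m + n + 1) v
         + (if m + n = 0 then (of_int (m ^ 3 - m) / 12 * c) *s v else 0)"
    and L0_grading: "v \<in> V n \<Longrightarrow> Y \<omega> 1 v = of_int n *s v"
    and L_minus1_derivative: "Y (Y \<omega> 0 u) n v = - (of_int n *s Y u (n - 1) v)"


definition has_order :: "('v \<Rightarrow> 'v) \<Rightarrow> nat \<Rightarrow> bool" where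
  "has_order g T \<longleftrightarrow> T > 0 \<and> g ^^ T = id \<and> (\<forall>k. 0 < k \<and> k < T \<longrightarrow> g ^^ k \<noteq> id)"

definition fracN :: "nat \<Rightarrow> real set" where
  "fracN T = {real k / real T | k. True}"

text \<open>For \<open>n \<in> fracN T\<close> the inner floor is applied to an integer, so that
  \<open>n = \<lfloor>n\<rfloor> + fbar T n / T\<close> with \<open>fbar T n < T\<close>.\<close>

definition fbar :: "nat \<Rightarrow> real \<Rightarrow> nat" where
  "fbar T n = nat \<lfloor>real T * frac n\<rfloor>"

text \<open>The convention \<open>\<delta>_i(T) = 0\<close> holds automatically, since only \<open>i < T\<close> occurs.\<close>

definition delta :: "nat \<Rightarrow> nat \<Rightarrow> int" where
  "delta i r = (if i \<ge> r then 1 else 0)"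


context vertex_operator_algebra
begin

definition L :: "int \<Rightarrow> 'v \<Rightarrow> 'v" where
  "L n v = Y \<omega> (n + 1) v"

definition automorphism :: "('v \<Rightarrow> 'v) \<Rightarrow> bool" where
  "automorphism g \<longleftrightarrow> Vector_Spaces.linear (*s) (*s) g \<and> bij g \<and> g vac = vac \<and> g \<omega> = \<omega> \<and>
     (\<forall>u n v. g (Y u n v) = Y (g u) n (g v))"

definition eigenspace :: "('v \<Rightarrow> 'v) \<Rightarrow> nat \<Rightarrow> nat \<Rightarrow> 'v set" where
  "eigenspace g T r = {v. g v = (exp (- 2 * of_real pi * \<i> / of_nat T) ^ r) *s v}"

definition bigrading :: "('v \<Rightarrow> 'v) \<Rightarrow> nat \<Rightarrow> int \<times> nat \<Rightarrow> 'v set" where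
  "bigrading g T = (\<lambda>(k, r). if r < T then V k \<inter> eigenspace g T r else {0})"

text \<open>The linear extension in \<open>u\<close> of an expression \<open>F k r u\<close> given for
  \<open>u \<in> V_k \<inter> V^r\<close>, \<open>0 \<le> r < T\<close>.\<close>

definition linear_ext :: "('v \<Rightarrow> 'v) \<Rightarrow> nat \<Rightarrow> (int \<Rightarrow> nat \<Rightarrow> 'v \<Rightarrow> 'v) \<Rightarrow> 'v \<Rightarrow> 'v" where
  "linear_ext g T F u = Sum_any (\<lambda>(k, r). F k r (component (bigrading g T) (k, r) u))"

text \<open>\<open>Res_x f(x) Y(u,x) v\<close>: the coefficient of \<open>x^e\<close> in \<open>f\<close> meets the coefficient of
  \<open>x^(-e-1)\<close> in \<open>Y(u,x) v\<close>, which is \<open>u_e v\<close>.\<close>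

definition res_Y :: "complex fls \<Rightarrow> 'v \<Rightarrow> 'v \<Rightarrow> 'v" where
  "res_Y f u v = Sum_any (\<lambda>e. fls_nth f e *s Y u e v)"

text \<open>\<open>binom_quot \<alpha> k\<close> is \<open>(1 + x)^\<alpha> / x^k\<close>.\<close>

definition binom_quot :: "complex \<Rightarrow> int \<Rightarrow> complex fls" where
  "binom_quot \<alpha> k = fps_to_fls (fps_binomial \<alpha>) * fls_X_intpow (- k)"

definition star_hom ::
  "nat \<Rightarrow> real \<Rightarrow> real \<Rightarrow> real \<Rightarrow> int \<Rightarrow> nat \<Rightarrow> 'v \<Rightarrow> 'v \<Rightarrow> 'v" where
  "star_hom T n m p wt r u v =
     (let d1 = delta (fbar T m) r; d2 = delta (fbar T n) (T - r) in
      if (int (fbar T p) - int (fbar T n)) mod int T = int r mod int T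
      then (\<Sum>i\<le>nat \<lfloor>p\<rfloor>.
        ((-1) ^ i * (of_int (\<lfloor>m\<rfloor> + \<lfloor>n\<rfloor> - \<lfloor>p\<rfloor> - 1 + d1 + d2 + int i) gchoose i)) *s
        res_Y (binom_quot (of_int (wt + \<lfloor>m\<rfloor> + d1 - 1) + of_nat r / of_nat T)
                          (\<lfloor>m\<rfloor> + \<lfloor>n\<rfloor> - \<lfloor>p\<rfloor> + d1 + d2 + int i)) u v)
      else 0)"

text \<open>\<open>star g T n m p u v\<close> is the product of \<open>u\<close> and \<open>v\<close> with upper index \<open>n\<close> and lower
  indices \<open>g, m, p\<close>; \<open>circ g T n m u v\<close> has upper index \<open>n\<close> and lower indices \<open>g, m\<close>.\<close>

definition star ::
  "('v \<Rightarrow> 'v) \<Rightarrow> nat \<Rightarrow> real \<Rightarrow> real \<Rightarrow> real \<Rightarrow> 'v \<Rightarrow> 'v \<Rightarrow> 'v" where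
  "star g T n m p u v = linear_ext g T (\<lambda>wt r u'. star_hom T n m p wt r u' v) u"

definition circ_hom ::
  "nat \<Rightarrow> real \<Rightarrow> real \<Rightarrow> int \<Rightarrow> nat \<Rightarrow> 'v \<Rightarrow> 'v \<Rightarrow> 'v" where
  "circ_hom T n m wt r u v =
     (let d1 = delta (fbar T m) r; d2 = delta (fbar T n) (T - r) in
      res_Y (binom_quot (of_int (wt + d1 + \<lfloor>m\<rfloor> - 1) + of_nat r / of_nat T)
                        (\<lfloor>m\<rfloor> + \<lfloor>n\<rfloor> + d1 + d2 + 1)) u v)"

definition circ ::
  "('v \<Rightarrow> 'v) \<Rightarrow> nat \<Rightarrow> real \<Rightarrow> real \<Rightarrow> 'v \<Rightarrow> 'v \<Rightarrow> 'v" where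
  "circ g T n m u v = linear_ext g T (\<lambda>wt r u'. circ_hom T n m wt r u' v) u"

definition Lspace :: "real \<Rightarrow> real \<Rightarrow> 'v set" where
  "Lspace n m = span {L (-1) u + L 0 u + of_real (m - n) *s u | u. True}"

definition Oprime :: "('v \<Rightarrow> 'v) \<Rightarrow> nat \<Rightarrow> real \<Rightarrow> real \<Rightarrow> 'v set" where
  "Oprime g T n m =
     {x + y | x y. x \<in> span {circ g T n m u v | u v. True} \<and> y \<in> Lspace n m}"

definition Odprime :: "('v \<Rightarrow> 'v) \<Rightarrow> nat \<Rightarrow> real \<Rightarrow> real \<Rightarrow> 'v set" where
  "Odprime g T n m = span
     {star g T n m p3 u
        (star g T p3 m p1 (star g T p3 p1 p2 a b) c
         - star g T p3 m p2 a (star g T p2 m p1 b c))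
      | a b c u p1 p2 p3. p1 \<in> fracN T \<and> p2 \<in> fracN T \<and> p3 \<in> fracN T}"

definition star_span ::
  "('v \<Rightarrow> 'v) \<Rightarrow> nat \<Rightarrow> real \<Rightarrow> real \<Rightarrow> real \<Rightarrow> 'v set \<Rightarrow> 'v set \<Rightarrow> 'v set" where
  "star_span g T n m p A B = span {star g T n m p a b | a b. a \<in> A \<and> b \<in> B}"

definition Otprime :: "('v \<Rightarrow> 'v) \<Rightarrow> nat \<Rightarrow> real \<Rightarrow> real \<Rightarrow> 'v set" where
  "Otprime g T n m = span (\<Union>p1\<in>fracN T. \<Union>p2\<in>fracN T.
     star_span g T n m p1 (star_span g T n p1 p2 UNIV (Oprime g T p2 p1)) UNIV)"

definition Ofull :: "('v \<Rightarrow> 'v) \<Rightarrow> nat \<Rightarrow> real \<Rightarrow> real \<Rightarrow> 'v set" where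
  "Ofull g T n m = {x + y + z | x y z.
     x \<in> Oprime g T n m \<and> y \<in> Odprime g T n m \<and> z \<in> Otprime g T n m}"

end

end

(*
  Let phi be a linear functional vanishing on O'_{g,n,m}(V), and write z = 1 + x.  Vanishing on the
  circle products means that (1 + x)^alpha phi(Y(u,x)v), with the exponent alpha of the definition
  of the products, is a Laurent polynomial in x whose degree is bounded independently of v, and the
  star product with parameters m, p, n picks the coefficient of one power of z in its expansion at
  z = infinity.  By locality a three-point function
  (1 + x1)^alpha (1 + x2)^beta phi(Y(a,x1)Y(b,x2)c) is h(x1,x2) / (x1 - x2)^N with a Laurent
  polynomial h, so its expansions in the regions |z1| > |z2| and |z2| > |z1 - z2| can be compared
  monomial by monomial.  This gives (a * b) * c = a * (b * c) modulo O', as well as V * O' in O' and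
  O' * V in O', for all admissible parameters; hence O'' and O''' lie in O'.
*)

theory Submission
  imports Defs
begin

section \<open>Expansions of \<open>(z - 1)^k\<close> at infinity\<close>

text \<open>The functional completes the truncated sums: once it kills \<open>O'\<close>, the terms
  omitted from a star product vanish, so the product becomes a full coefficient at infinity. Three
  facts keep the comparison of regions finite. As \<open>x1 - x2 = z1 - z2\<close>, the denominator
  survives the change of variable, and only monomials \<open>x1^i x2^j\<close> are re-expanded. In a
  fixed total degree the exponents of \<open>z1\<close> and \<open>z2\<close> are both bounded
  above, which leaves finitely many terms. Finally, for \<open>w \<ge> 0\<close> the expansion of
  \<open>z1^w (z1 - z2)^(-N)\<close> in powers of \<open>z1 - z2\<close> terminates, so it may be
  re-expanded in |z1| > |z2|. The obstacle is the condition \<open>w \<ge> 0\<close>. Here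
  \<open>w = \<mu> + k\<close>, where \<open>z1^k\<close> occurs in the numerator and
  \<open>\<mu> = lam p1 r - lam m r\<close> is the discrepancy between the exponents of
  \<open>1 + x\<close> belonging to the lower indices \<open>p1\<close> and \<open>m\<close>. The
  functions \<open>\<delta>\<close> in the definition of the products make this discrepancy large
  enough (\<open>lam_mu_ge\<close>). They record carries in the addition of eigenspace labels modulo
  \<open>T\<close>.\<close>

definition gbinom_int :: "complex \<Rightarrow> int \<Rightarrow> complex" where
  "gbinom_int a k = (if k < 0 then 0 else a gchoose nat k)"

text \<open>The coefficient of \<open>z^e\<close> in the expansion of \<open>(z - 1)^k\<close> at \<open>z = \<infinity>\<close>.\<close>

definition binom_inf :: "int \<Rightarrow> int \<Rightarrow> complex" where
  "binom_inf k e = (-1) powi (k - e) * gbinom_int (of_int k) (k - e)"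

lemma gbinom_int_neg [simp]: "k < 0 \<Longrightarrow> gbinom_int a k = 0"
  by (simp add: gbinom_int_def)

lemma gbinom_int_of_nat [simp]: "gbinom_int a (int k) = a gchoose k"
  by (simp add: gbinom_int_def)

lemma gbinom_int_0_right [simp]: "gbinom_int a 0 = 1"
  by (simp add: gbinom_int_def)

lemma gbinom_int_0_left: "gbinom_int 0 k = (if k = 0 then 1 else 0)"
  by (cases "nat k") (auto simp: gbinom_int_def)

lemma gbinom_int_eq_0: "0 \<le> w \<Longrightarrow> w < k \<Longrightarrow> gbinom_int (of_int w) k = 0"
proof -
  assume "0 \<le> w" "w < k"
  then have "gbinom_int (of_int w) k = of_nat (nat w) gchoose nat k" by (simp add: gbinom_int_def)
  also have "\<dots> = of_nat (nat w choose nat k)" by (simp add: binomial_gbinomial)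
  finally show ?thesis using \<open>0 \<le> w\<close> \<open>w < k\<close> by (simp add: binomial_eq_0)
qed

lemma gbinom_int_pascal: "gbinom_int (a + 1) k = gbinom_int a k + gbinom_int a (k - 1)"
proof (cases "k \<le> 0")
  case True
  then show ?thesis by (cases "k = 0") auto
next
  case False
  then have "k = int (Suc (nat (k - 1)))" by simp
  then obtain j where "k = int (Suc j)" ..
  then show ?thesis using gbinomial_Suc_Suc[of a j] by (simp add: gbinom_int_def nat_add_distrib)
qed

lemma gbinom_int_Vandermonde:
  assumes "finite A" "{0..n} \<subseteq> A"
  shows "(\<Sum>k\<in>A. gbinom_int a k * gbinom_int b (n - k)) = gbinom_int (a + b) n"
proof -
  have "(\<Sum>k\<in>A. gbinom_int a k * gbinom_int b (n - k)) = (\<Sum>k\<in>{0..n}. gbinom_int a k * gbinom_int b (n - k))"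
    using assms by (intro sum.mono_neutral_right) (auto simp: gbinom_int_def)
  also have "\<dots> = gbinom_int (a + b) n"
  proof (cases "n < 0")
    case True
    then show ?thesis by simp
  next
    case False
    then obtain N where N: "n = int N" by (metis nonneg_int_cases not_less)
    have "(\<Sum>k\<in>{0..n}. gbinom_int a k * gbinom_int b (n - k)) = (\<Sum>k\<le>N. (a gchoose k) * (b gchoose (N - k)))"
      by (rule sum.reindex_bij_witness[of _ int nat]) (auto simp: N gbinom_int_def nat_diff_distrib)
    then show ?thesis using gbinomial_Vandermonde[of a b N] by (simp add: N atMost_atLeast0)
  qed
  finally show ?thesis .
qed

lemma gbinom_int_revision:
  assumes "0 \<le> m" "0 \<le> s"
  shows "gbinom_int a m * gbinom_int (a - of_int m) s = gbinom_int a (m + s) * gbinom_int (of_int (m + s)) m"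
proof -
  obtain M S where [simp]: "m = int M" "s = int S" using assms nonneg_int_cases by metis
  have "(a gchoose (M + S)) * (of_nat (M + S) gchoose M) = (a gchoose M) * (a - of_nat M gchoose S)"
    using gbinomial_trinomial_revision[of M "M + S" a] by simp
  then show ?thesis by (simp add: gbinom_int_def nat_add_distrib)
qed

lemma gbinom_int_of_int_symmetric:
  assumes "0 \<le> m" "0 \<le> s"
  shows "gbinom_int (of_int (m + s)) m = gbinom_int (of_int (m + s)) s"
proof -
  obtain M S where [simp]: "m = int M" "s = int S" using assms nonneg_int_cases by metis
  show ?thesis using gbinomial_of_nat_symmetric[of M "M + S"] by simp
qed

lemma gbinom_int_swap: "gbinom_int (of_int i) m * gbinom_int (of_int (i - m)) s = gbinom_int (of_int i) s * gbinom_int (of_int (i - s)) m"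
proof (cases "m < 0 \<or> s < 0")
  case False
  then show ?thesis
    using gbinom_int_revision[of m s "of_int i"] gbinom_int_revision[of s m "of_int i"] gbinom_int_of_int_symmetric[of m s]
    by (simp add: add.commute)
qed auto

lemma minus_one_powi_cancel: "(-1) powi k * ((-1) powi k * x) = (x::complex)"
  by (simp add: mult.assoc[symmetric] power_int_mult_distrib[symmetric])

lemma gbinom_int_negate: "0 \<le> k \<Longrightarrow> gbinom_int a k = (-1) powi k * gbinom_int (of_int k - a - 1) k"
  using gbinomial_negated_upper[of a "nat k"]
  by (simp add: gbinom_int_def power_int_def)

lemma binom_inf_eq_0: "k < e \<Longrightarrow> binom_inf k e = 0"
  by (simp add: binom_inf_def)

lemma binom_inf_refl [simp]: "binom_inf k k = 1"
  by (simp add: binom_inf_def)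

lemma binom_inf_0: "binom_inf 0 e = (if e = 0 then 1 else 0)"
  by (simp add: binom_inf_def gbinom_int_0_left)

lemma binom_inf_int: "binom_inf (e + int q) e = (-1) ^ q * (of_int (e + int q) gchoose q)"
  by (simp add: binom_inf_def)

text \<open>From \<open>(z - 1)^(k + 1) + (z - 1)^k = z (z - 1)^k\<close>.\<close>

lemma binom_inf_pascal: "binom_inf (k + 1) e + binom_inf k e = binom_inf k (e - 1)"
proof -
  have "gbinom_int (of_int (k + 1)) (k + 1 - e) = gbinom_int (of_int k) (k - e + 1) + gbinom_int (of_int k) (k - e)"
    using gbinom_int_pascal[of "of_int k" "k - e + 1"] by (simp add: algebra_simps)
  moreover have "(-1::complex) powi (k + 1 - e) = - ((-1) powi (k - e))"
    using power_int_add[of "-1::complex" "k - e" 1] by (simp add: algebra_simps)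
  moreover have "k - (e - 1) = k + 1 - e" by simp
  ultimately show ?thesis by (simp add: binom_inf_def algebra_simps)
qed

lemma sum_reflect_int:
  fixes f :: "int \<Rightarrow> 'a::comm_monoid_add"
  shows "(\<Sum>k\<in>A. f k) = (\<Sum>s\<in>(\<lambda>k. c - k) ` A. f (c - s))"
  by (subst sum.reindex) (auto intro: inj_onI)

text \<open>Coefficients of \<open>(z - 1)^i (z - 1)^j = (z - 1)^(i + j)\<close>. Terms outside
  \<open>{d - j..i}\<close> vanish, and the reflection \<open>k \<mapsto> i - k\<close> leads to the
  Vandermonde sum.\<close>

lemma binom_inf_conv:
  assumes "finite A" "{d - j..i} \<subseteq> A"
  shows "(\<Sum>k\<in>A. binom_inf i k * binom_inf j (d - k)) = binom_inf (i + j) d"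
proof -
  have "(\<Sum>k\<in>A. binom_inf i k * binom_inf j (d - k)) =
      (\<Sum>s\<in>(\<lambda>k. i - k) ` A. (-1) powi (i + j - d) * (gbinom_int (of_int i) s * gbinom_int (of_int j) (i + j - d - s)))"
    unfolding sum_reflect_int[of _ A i]
  proof (rule sum.cong)
    fix s
    have "(-1::complex) powi (i + j - d) = (-1) powi s * (-1) powi (i + j - d - s)"
      by (subst power_int_add[symmetric]) (auto simp: algebra_simps)
    then show "binom_inf i (i - s) * binom_inf j (d - (i - s)) =
        (-1) powi (i + j - d) * (gbinom_int (of_int i) s * gbinom_int (of_int j) (i + j - d - s))"
      by (simp add: binom_inf_def algebra_simps)
  qed simp
  also have "\<dots> = (-1) powi (i + j - d) * gbinom_int (of_int i + of_int j) (i + j - d)"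
  proof -
    have "{0..i + j - d} \<subseteq> (\<lambda>k. i - k) ` A"
    proof
      fix s assume "s \<in> {0..i + j - d}"
      then have "i - s \<in> A" using assms(2) by auto
      then show "s \<in> (\<lambda>k. i - k) ` A" by (intro image_eqI[of _ _ "i - s"]) auto
    qed
    then show ?thesis
      using assms(1) by (simp add: sum_distrib_left[symmetric] gbinom_int_Vandermonde)
  qed
  finally show ?thesis by (simp add: binom_inf_def)
qed

text \<open>For \<open>m \<ge> 0\<close> this differentiates \<open>(z - 1)^i\<close>
  \<open>m\<close> times and divides by \<open>m!\<close>, once before and once after the
  expansion.\<close>

lemma binom_inf_gbinom_int: "gbinom_int (of_int i) m * binom_inf (i - m) (k - m) = gbinom_int (of_int k) m * binom_inf i k"
  using gbinom_int_swap[of i m "i - k"] by (simp add: binom_inf_def algebra_simps)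

lemma binom_inf_conv_gbinom_int:
  assumes "finite A" "{d - j..i} \<subseteq> A"
  shows "(\<Sum>k\<in>A. gbinom_int (of_int k) m * binom_inf i k * binom_inf j (d - k)) = gbinom_int (of_int i) m * binom_inf (i + j - m) (d - m)"
proof -
  have "(\<Sum>k\<in>A. gbinom_int (of_int k) m * binom_inf i k * binom_inf j (d - k)) =
      gbinom_int (of_int i) m * (\<Sum>k\<in>A. binom_inf (i - m) (k - m) * binom_inf j (d - k))"
    by (simp add: sum_distrib_left binom_inf_gbinom_int[symmetric] mult.assoc)
  also have "(\<Sum>k\<in>A. binom_inf (i - m) (k - m) * binom_inf j (d - k)) =
      (\<Sum>k\<in>(\<lambda>k. k - m) ` A. binom_inf (i - m) k * binom_inf j (d - m - k))"
    by (subst sum.reindex) (auto intro: inj_onI)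
  also have "\<dots> = binom_inf (i - m + j) (d - m)"
  proof (rule binom_inf_conv)
    show "{d - m - j..i - m} \<subseteq> (\<lambda>k. k - m) ` A"
    proof
      fix s assume "s \<in> {d - m - j..i - m}"
      then have "s + m \<in> A" using assms(2) by auto
      then show "s \<in> (\<lambda>k. k - m) ` A" by (intro image_eqI[of _ _ "s + m"]) auto
    qed
  qed (use assms in auto)
  finally show ?thesis by (simp add: algebra_simps)
qed

text \<open>The residue at \<open>x = 0\<close> is the difference of the two expansions of \<open>(x1 - x2)^(-M-1)\<close>.\<close>

lemma binom_inf_delta:
  assumes "0 \<le> M"
  shows "binom_inf (-M-1) (-1-i) - (-1) powi (M + 1) * binom_inf (-M-1) (i - M) = gbinom_int (of_int i) M"
proof (cases "i \<ge> 0")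
  case True
  have "binom_inf (-M-1) (i - M) = 0" using True by (simp add: binom_inf_eq_0)
  moreover have "binom_inf (-M-1) (-1-i) = gbinom_int (of_int i) M"
  proof (cases "i < M")
    case True
    then show ?thesis using \<open>i \<ge> 0\<close> by (simp add: binom_inf_eq_0 gbinom_int_eq_0)
  next
    case False
    then have "gbinom_int (of_int (-M-1)) (i - M) = (-1) powi (i - M) * gbinom_int (of_int i) (i - M)"
      using gbinom_int_negate[of "i - M" "of_int (-M-1)"] by simp
    moreover have "gbinom_int (of_int i) (i - M) = gbinom_int (of_int i) M"
      using gbinom_int_of_int_symmetric[of M "i - M"] False assms by simp
    ultimately show ?thesis
      by (simp add: binom_inf_def minus_one_powi_cancel)
  qed
  ultimately show ?thesis by simp
next
  case False
  have "binom_inf (-M-1) (-1-i) = 0" using False assms by (simp add: binom_inf_eq_0)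
  moreover have "(-1) powi (M + 1) * binom_inf (-M-1) (i - M) = - gbinom_int (of_int i) M"
  proof -
    have "gbinom_int (of_int (-M-1)) (-1-i) = (-1) powi (-1-i) * gbinom_int (of_int (M - i - 1)) (-1-i)"
      using gbinom_int_negate[of "-1-i" "of_int (-M-1)"] False by (simp add: algebra_simps)
    also have "gbinom_int (of_int (M - i - 1)) (-1-i) = gbinom_int (of_int (M - i - 1)) M"
      using gbinom_int_of_int_symmetric[of M "-1-i"] False assms by (simp add: algebra_simps)
    finally have "binom_inf (-M-1) (i - M) = gbinom_int (of_int (M - i - 1)) M"
      by (simp add: binom_inf_def minus_one_powi_cancel)
    moreover have "gbinom_int (of_int i) M = (-1) powi M * gbinom_int (of_int (M - i - 1)) M"
      using gbinom_int_negate[OF assms, of "of_int i"] by simp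
    ultimately show ?thesis using power_int_add[of "-1::complex" M 1] by simp
  qed
  ultimately show ?thesis by simp
qed

lemma binom_inf_of_nat_neg: "e < 0 \<Longrightarrow> binom_inf (int N) e = 0"
  using gbinom_int_eq_0[of "int N" "int N - e"] by (simp add: binom_inf_def)

lemma sum_shift_int:
  fixes f :: "int \<Rightarrow> 'a::comm_monoid_add"
  shows "(\<Sum>k\<in>{a..b}. f (k - 1)) = (\<Sum>k\<in>{a-1..b-1}. f k)"
  by (rule sum.reindex_bij_witness[of _ "\<lambda>k. k + 1" "\<lambda>k. k - 1"]) auto

text \<open>Both sides are the coefficient of \<open>z1^e1 z2^e2\<close> in
  \<open>x1^i x2^j / (x1 - x2)^N\<close> with \<open>x = z - 1\<close>. On the left the quotient is
  expanded in |x1| > |x2| and the resulting monomials at infinity; on the right \<open>x1^i\<close>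
  and \<open>x2^j\<close> are expanded at infinity first, and \<open>(z1 - z2)^(-N)\<close> in |z1|
  > |z2|. The induction rests on \<open>x1 - x2 = z1 - z2\<close>: the difference of the cases
  \<open>(i + 1, j)\<close> and \<open>(i, j + 1)\<close> for \<open>N + 1\<close> is the case
  \<open>(i, j)\<close> for \<open>N\<close>.\<close>

lemma expansion_change:
  fixes N :: nat and i :: int
  assumes "A \<ge> i - int N"
  shows "(\<Sum>a\<in>{e1..A}. binom_inf a e1 * binom_inf (- int N) (a - i) * binom_inf (i + j - int N - a) e2) =
    (\<Sum>k\<in>{e1 + int N..i}. binom_inf i k * binom_inf j (e1 + e2 + int N - k) * binom_inf (- int N) (e1 - k))"
  using assms
proof (induction N arbitrary: i j A)
  case 0
  have "(\<Sum>a\<in>{e1..A}. binom_inf a e1 * binom_inf (- int 0) (a - i) * binom_inf (i + j - int 0 - a) e2) =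
      (\<Sum>a\<in>{e1..A}. if a = i then binom_inf i e1 * binom_inf j e2 else 0)"
    by (rule sum.cong) (auto simp: binom_inf_0)
  also have "\<dots> = binom_inf i e1 * binom_inf j e2"
    using 0 by (auto simp: binom_inf_eq_0)
  also have "\<dots> = (\<Sum>k\<in>{e1..i}. if k = e1 then binom_inf i e1 * binom_inf j e2 else 0)"
    by (auto simp: binom_inf_eq_0)
  also have "\<dots> = (\<Sum>k\<in>{e1 + int 0..i}. binom_inf i k * binom_inf j (e1 + e2 + int 0 - k) * binom_inf (- int 0) (e1 - k))"
    by (rule sum.cong) (auto simp: binom_inf_0)
  finally show ?case .
next
  case (Suc N)
  note IH = Suc.IH
  define f where "f i j = (\<lambda>a. binom_inf a e1 * binom_inf (- int (Suc N)) (a - i) * binom_inf (i + j - int (Suc N) - a) e2)" for i j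
  define g where "g i j = (\<lambda>k. binom_inf i k * binom_inf j (e1 + e2 + int (Suc N) - k) * binom_inf (- int (Suc N)) (e1 - k))" for i j
  define F where "F i j = (\<Sum>a\<in>{e1..i - int (Suc N)}. f i j a)" for i j
  define G where "G i j = (\<Sum>k\<in>{e1 + int (Suc N)..i}. g i j k)" for i j
  have Fsup: "(\<Sum>a\<in>{e1..A}. f i j a) = F i j" if "A \<ge> i - int (Suc N)" for A i j
    unfolding F_def using that by (intro sum.mono_neutral_right) (auto simp: f_def binom_inf_eq_0)
  have Gsup: "(\<Sum>k\<in>B. g i j k) = G i j" if "finite B" "{e1 + int (Suc N)..i} \<subseteq> B" for B i j
    unfolding G_def using that by (intro sum.mono_neutral_right) (auto simp: g_def binom_inf_eq_0 not_le)
  have neg: "binom_inf (- int N) e = binom_inf (- int (Suc N)) (e - 1) - binom_inf (- int (Suc N)) e" for e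
    using binom_inf_pascal[of "- int (Suc N)" e] by (simp add: algebra_simps)
  have stepF: "F (i + 1) j = F i (j + 1) +
      (\<Sum>a\<in>{e1..i}. binom_inf a e1 * binom_inf (- int N) (a - i) * binom_inf (i + j - int N - a) e2)" for i j
  proof -
    have "F (i + 1) j = (\<Sum>a\<in>{e1..i}. f (i + 1) j a)" by (rule Fsup[symmetric]) simp
    also have "\<dots> = (\<Sum>a\<in>{e1..i}. f i (j + 1) a +
        binom_inf a e1 * binom_inf (- int N) (a - i) * binom_inf (i + j - int N - a) e2)"
      unfolding f_def neg by (rule sum.cong) (auto simp: algebra_simps)
    also have "\<dots> = (\<Sum>a\<in>{e1..i}. f i (j + 1) a) +
        (\<Sum>a\<in>{e1..i}. binom_inf a e1 * binom_inf (- int N) (a - i) * binom_inf (i + j - int N - a) e2)"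
      by (rule sum.distrib)
    also have "(\<Sum>a\<in>{e1..i}. f i (j + 1) a) = F i (j + 1)" by (rule Fsup) simp
    finally show ?thesis .
  qed
  have stepG: "G (i + 1) j = G i (j + 1) +
      (\<Sum>k\<in>{e1 + int N..i}. binom_inf i k * binom_inf j (e1 + e2 + int N - k) * binom_inf (- int N) (e1 - k))" for i j
  proof -
    define c where "c k = binom_inf i k * binom_inf j (e1 + e2 + int N - k)" for k
    define b where "b k = binom_inf (- int (Suc N)) (e1 - k)" for k
    have p1: "binom_inf (i + 1) k = binom_inf i (k - 1) - binom_inf i k" for k
      using binom_inf_pascal[of i k] by (simp add: algebra_simps)
    have p2: "binom_inf (j + 1) k = binom_inf j (k - 1) - binom_inf j k" for k
      using binom_inf_pascal[of j k] by (simp add: algebra_simps)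
    let ?B = "{e1 + int N..i + 1}"
    have "G (i + 1) j - G i (j + 1) = (\<Sum>k\<in>?B. g (i + 1) j k) - (\<Sum>k\<in>?B. g i (j + 1) k)"
      by (subst (1 2) Gsup) auto
    also have "\<dots> = (\<Sum>k\<in>?B. c (k - 1) * b k - c k * b k)"
      unfolding sum_subtractf[symmetric] g_def c_def b_def p1 p2
      by (rule sum.cong) (auto simp: algebra_simps)
    also have "\<dots> = (\<Sum>k\<in>?B. c (k - 1) * b ((k - 1) + 1)) - (\<Sum>k\<in>?B. c k * b k)"
      by (simp add: sum_subtractf)
    also have "(\<Sum>k\<in>?B. c (k - 1) * b ((k - 1) + 1)) = (\<Sum>k\<in>{e1 + int N - 1..i}. c k * b (k + 1))"
      using sum_shift_int[of "\<lambda>k. c k * b (k + 1)" "e1 + int N" "i + 1"] by simp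
    also have "\<dots> = (\<Sum>k\<in>{e1 + int N..i}. c k * b (k + 1))"
      by (intro sum.mono_neutral_right) (auto simp: b_def binom_inf_eq_0)
    also have "(\<Sum>k\<in>?B. c k * b k) = (\<Sum>k\<in>{e1 + int N..i}. c k * b k)"
      by (intro sum.mono_neutral_right) (auto simp: c_def binom_inf_eq_0)
    also have "(\<Sum>k\<in>{e1 + int N..i}. c k * b (k + 1)) - (\<Sum>k\<in>{e1 + int N..i}. c k * b k) =
        (\<Sum>k\<in>{e1 + int N..i}. c k * binom_inf (- int N) (e1 - k))"
      unfolding sum_subtractf[symmetric] neg b_def by (rule sum.cong) (auto simp: algebra_simps)
    finally show ?thesis by (simp add: c_def algebra_simps)
  qed
  \<comment> \<open>Below this \<open>i\<close> both ranges are empty, which starts an induction on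
    \<open>i\<close>. There \<open>j\<close> stays arbitrary, because each step trades a power of
    \<open>x1\<close> for one of \<open>x2\<close>.\<close>
  have zero: "F i j = 0" "G i j = 0" if "i < e1 + int (Suc N)" for i j
    using that by (auto simp: F_def G_def)
  have "F (e1 + int n) j = G (e1 + int n) j" for n j
  proof (induction n arbitrary: j)
    case 0
    then show ?case by (simp add: zero)
  next
    case (Suc n)
    have "F (e1 + int n + 1) j = G (e1 + int n + 1) j"
      unfolding stepF stepG Suc.IH by (simp add: IH)
    then show ?case by (simp add: algebra_simps)
  qed
  then have "F i j = G i j"
  proof (cases "i < e1 + int (Suc N)")
    case False
    then have "i = e1 + int (nat (i - e1))" by simp
    then show ?thesis using \<open>\<And>n j. F (e1 + int n) j = G (e1 + int n) j\<close> by metis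
  qed (simp add: zero)
  with Fsup[OF Suc.prems, of j] show ?case by (simp add: f_def G_def g_def)
qed


section \<open>Expansion at infinity of series in \<open>x\<close> with bounded degree\<close>

definition eventually_0 :: "(int \<Rightarrow> complex) \<Rightarrow> bool" where
  "eventually_0 F \<longleftrightarrow> (\<exists>J. \<forall>n>J. F n = 0)"

text \<open>The coefficient of \<open>z^e\<close> in the expansion of \<open>\<Sum>n. F n * (z - 1)^n\<close> at \<open>z = \<infinity>\<close>; a junk
  value unless \<open>F\<close> satisfies \<open>eventually_0\<close>.\<close>

definition coeff_inf :: "(int \<Rightarrow> complex) \<Rightarrow> int \<Rightarrow> complex" where
  "coeff_inf F e = (\<Sum>n\<in>{n. e \<le> n \<and> F n \<noteq> 0}. binom_inf n e * F n)"

lemma coeff_inf_superset: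
  assumes "finite A" "\<And>n. e \<le> n \<Longrightarrow> F n \<noteq> 0 \<Longrightarrow> n \<in> A"
  shows "coeff_inf F e = (\<Sum>n\<in>A. binom_inf n e * F n)"
  proof -
  have "e \<le> n" if "binom_inf n e \<noteq> 0" for n
    using that binom_inf_eq_0[of n e] by (rule contrapos_np) simp
  then show ?thesis
    unfolding coeff_inf_def using assms by (intro sum.mono_neutral_left) auto
qed

lemma coeff_inf_atMost:
  assumes "\<And>n. n > J \<Longrightarrow> F n = 0"
  shows "coeff_inf F e = (\<Sum>n\<in>{e..J}. binom_inf n e * F n)"
  by (rule coeff_inf_superset) (use assms in force)+

lemma coeff_inf_eq_sum_nat:
  assumes "\<And>n. n > e + int Q \<Longrightarrow> F n = 0"
  shows "coeff_inf F e = (\<Sum>q\<le>Q. binom_inf (e + int q) e * F (e + int q))"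
proof -
  have "coeff_inf F e = (\<Sum>n\<in>{e..e + int Q}. binom_inf n e * F n)" by (rule coeff_inf_atMost) (rule assms)
  also have "\<dots> = (\<Sum>q\<le>Q. binom_inf (e + int q) e * F (e + int q))"
    by (rule sum.reindex_bij_witness[of _ "\<lambda>q. e + int q" "\<lambda>n. nat (n - e)"]) auto
  finally show ?thesis .
qed

lemma coeff_inf_lincomb:
  assumes "finite A" "\<And>a. a \<in> A \<Longrightarrow> eventually_0 (F a)"
  shows "coeff_inf (\<lambda>n. \<Sum>a\<in>A. c a * F a n) e = (\<Sum>a\<in>A. c a * coeff_inf (F a) e)"
proof -
  obtain J where J: "\<And>a n. a \<in> A \<Longrightarrow> n > J a \<Longrightarrow> F a n = 0"
    using assms(2) unfolding eventually_0_def by metis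
  have J': "F a n = 0" if "a \<in> A" "n > Max (J ` A)" for a n
  proof (rule J[OF that(1)])
    have "J a \<le> Max (J ` A)" using assms(1) that(1) by simp
    with that(2) show "J a < n" by simp
  qed
  have "coeff_inf (\<lambda>n. \<Sum>a\<in>A. c a * F a n) e = (\<Sum>n\<in>{e..Max (J ` A)}. binom_inf n e * (\<Sum>a\<in>A. c a * F a n))"
    by (rule coeff_inf_atMost) (auto intro!: sum.neutral simp: J')
  also have "\<dots> = (\<Sum>a\<in>A. c a * (\<Sum>n\<in>{e..Max (J ` A)}. binom_inf n e * F a n))"
    unfolding sum_distrib_left by (subst sum.swap) (simp add: mult_ac)
  also have "\<dots> = (\<Sum>a\<in>A. c a * coeff_inf (F a) e)"
  proof (intro sum.cong refl)
    fix a assume "a \<in> A"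
    then show "c a * (\<Sum>n\<in>{e..Max (J ` A)}. binom_inf n e * F a n) = c a * coeff_inf (F a) e"
      using coeff_inf_atMost[of "Max (J ` A)" "F a" e] J' by simp
  qed
  finally show ?thesis .
qed

lemma coeff_inf_0: "(\<And>n. n \<ge> e \<Longrightarrow> F n = 0) \<Longrightarrow> coeff_inf F e = 0"
  using coeff_inf_superset[of "{}" e F] by force

text \<open>Multiplication by \<open>z = 1 + x\<close> shifts the coefficients of the expansion at infinity.\<close>

lemma coeff_inf_times_z:
  assumes "eventually_0 F"
  shows "coeff_inf (\<lambda>n. F n + F (n - 1)) (e + 1) = coeff_inf F e"
proof -
  obtain J where J: "\<And>n. n > J \<Longrightarrow> F n = 0" using assms by (auto simp: eventually_0_def)
  have "coeff_inf (\<lambda>n. F n + F (n - 1)) (e + 1) = (\<Sum>n\<in>{e+1..J+1}. binom_inf n (e+1) * (F n + F (n - 1)))"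
    by (rule coeff_inf_atMost) (simp add: J)
  also have "\<dots> = (\<Sum>n\<in>{e+1..J+1}. binom_inf n (e+1) * F n) + (\<Sum>n\<in>{e+1..J+1}. binom_inf ((n - 1) + 1) (e+1) * F (n - 1))"
    by (simp add: algebra_simps sum.distrib)
  also have "(\<Sum>n\<in>{e+1..J+1}. binom_inf ((n - 1) + 1) (e+1) * F (n - 1)) = (\<Sum>n\<in>{e..J}. binom_inf (n + 1) (e+1) * F n)"
    using sum_shift_int[of "\<lambda>n. binom_inf (n + 1) (e+1) * F n" "e + 1" "J + 1"] by simp
  also have "(\<Sum>n\<in>{e+1..J+1}. binom_inf n (e+1) * F n) = (\<Sum>n\<in>{e..J}. binom_inf n (e+1) * F n)"
    by (rule sum.mono_neutral_cong) (auto simp: J binom_inf_eq_0)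
  also have "(\<Sum>n\<in>{e..J}. binom_inf n (e+1) * F n) + (\<Sum>n\<in>{e..J}. binom_inf (n + 1) (e+1) * F n) =
      (\<Sum>n\<in>{e..J}. (binom_inf (n + 1) (e + 1) + binom_inf n (e + 1)) * F n)"
    by (simp add: sum.distrib algebra_simps)
  also have "\<dots> = (\<Sum>n\<in>{e..J}. binom_inf n e * F n)"
    by (simp add: binom_inf_pascal)
  also have "\<dots> = coeff_inf F e" by (rule coeff_inf_atMost[symmetric]) (rule J)
  finally show ?thesis .
qed

lemma eventually_0_times_z:
  assumes "eventually_0 F"
  shows "eventually_0 (\<lambda>n. F n + F (n - 1))"
proof -
  obtain J where J: "\<And>n. n > J \<Longrightarrow> F n = 0" using assms by (auto simp: eventually_0_def)
  then have "\<forall>n>J+1. F n + F (n - 1) = 0" by simp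
  then show ?thesis unfolding eventually_0_def by blast
qed

text \<open>The change from powers of \<open>z - 1\<close> to powers of \<open>z\<close> is
  unitriangular, so the values of \<open>F\<close> can be read off one at a time, downwards from the
  bound in \<open>eventually_0\<close>.\<close>

lemma coeff_inf_all_0_imp:
  assumes "eventually_0 F" and zero: "\<And>e. e \<ge> k \<Longrightarrow> coeff_inf F e = 0" and "n \<ge> k"
  shows "F n = 0"
proof -
  obtain J where J: "\<And>n. n > J \<Longrightarrow> F n = 0" using assms by (auto simp: eventually_0_def)
  have "\<forall>n\<ge>k. n > J - int t \<longrightarrow> F n = 0" for t
  proof (induction t)
    case 0
    then show ?case by (simp add: J)
  next
    case (Suc t)
    show ?case
    proof (intro allI impI)
      fix n assume n: "n \<ge> k" "n > J - int (Suc t)"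
      have above: "F m = 0" if "m > n" for m
        using Suc.IH that n by auto
      have "coeff_inf F n = (\<Sum>m\<in>{n..n}. binom_inf m n * F m)" by (rule coeff_inf_atMost) (rule above)
      then show "F n = 0" using zero[OF n(1)] by simp
    qed
  qed
  from this[of "nat (J - n + 1)"] show ?thesis using assms(3) by auto
qed

text \<open>The expansion of \<open>(1 + y)^w y^(-N)\<close> at infinity.\<close>

lemma coeff_inf_gbinom_int:
  assumes "0 \<le> w"
  shows "coeff_inf (\<lambda>n. gbinom_int (of_int w) (n + N)) e = binom_inf (- N) (e - w)"
proof -
  obtain W where [simp]: "w = int W" using assms nonneg_int_cases by metis
  have "coeff_inf (\<lambda>n. gbinom_int (of_nat W) (n + N)) e = binom_inf (- N) (e - int W) \<and>
      eventually_0 (\<lambda>n. gbinom_int (of_nat W) (n + N))"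
  proof (induction W arbitrary: e)
    case 0
    have "coeff_inf (\<lambda>n. gbinom_int (of_nat 0) (n + N)) e = (\<Sum>n\<in>{-N}. binom_inf n e * gbinom_int (of_nat 0) (n + N))"
      by (rule coeff_inf_superset) (auto simp: gbinom_int_0_left split: if_splits)
    moreover have "\<forall>n>-N. gbinom_int (of_nat 0) (n + N) = 0" by (simp add: gbinom_int_0_left)
    ultimately have "eventually_0 (\<lambda>n. gbinom_int (of_nat 0) (n + N))"
      unfolding eventually_0_def by blast
    with \<open>coeff_inf _ e = _\<close> show ?case by (simp add: gbinom_int_0_left)
  next
    case (Suc W)
    have "gbinom_int (of_nat (Suc W)) (n + N) = gbinom_int (of_nat W) (n + N) + gbinom_int (of_nat W) (n - 1 + N)" for n
      using gbinom_int_pascal[of "of_nat W" "n + N"] by (simp add: algebra_simps)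
    then show ?case
      using Suc.IH[of "e - 1"] coeff_inf_times_z[of "\<lambda>n. gbinom_int (of_nat W) (n + N)" "e - 1"]
        eventually_0_times_z[of "\<lambda>n. gbinom_int (of_nat W) (n + N)"] by (simp add: algebra_simps)
  qed
  then show ?thesis by simp
qed


section \<open>Multiplication and division of coefficient arrays by
  \<open>(x1 - x2)^N\<close>\<close>

lemma binom_inf_nat_diff: "t \<le> N \<Longrightarrow> binom_inf (int N) (int N - int t) = (-1) ^ t * (of_nat N gchoose t)"
  using binom_inf_int[of "int N - int t" t] by simp

lemma binom_inf_diff: "binom_inf l (l - int t) = (-1) ^ t * (of_int l gchoose t)"
  using binom_inf_int[of "l - int t" t] by simp

definition times_diff_power :: "nat \<Rightarrow> (int \<Rightarrow> int \<Rightarrow> complex) \<Rightarrow> int \<Rightarrow> int \<Rightarrow> complex" where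
  "times_diff_power N p i j =
     (\<Sum>t\<le>N. (-1) ^ t * (of_nat N gchoose t) * p (i - int N + int t) (j - int t))"

text \<open>\<open>binom_inf (- int N)\<close> lists the coefficients of
  \<open>(x1 - x2)^(-N)\<close> in |x1| > |x2|; in a fixed total degree the claim reduces to
  \<open>(z - 1)^N (z - 1)^(-N) = 1\<close>. The bound \<open>top\<close> makes the division
  legitimate: it excludes the formal delta function, which \<open>x1 - x2\<close>
  annihilates.\<close>

lemma divide_diff_power:
  assumes top: "\<And>i j. i > d \<Longrightarrow> p i j = 0"
    and A: "finite A" "{a + int N..d + int N} \<subseteq> A"
  shows "p a b = (\<Sum>i\<in>A. times_diff_power N p i (a + b + int N - i) * binom_inf (- int N) (a - i))"
proof -
  have h: "times_diff_power N p i (a + b + int N - i) = (\<Sum>s\<in>{a..d}. binom_inf (int N) (i - s) * p s (a + b - s))"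
    if "i \<ge> a + int N" for i
  proof -
    have "times_diff_power N p i (a + b + int N - i) =
        (\<Sum>t\<le>N. binom_inf (int N) (int N - int t) * p (i - int N + int t) (a + b + int N - i - int t))"
      unfolding times_diff_power_def by (intro sum.cong refl) (simp add: binom_inf_nat_diff)
    also have "\<dots> = (\<Sum>s\<in>{i - int N..i}. binom_inf (int N) (i - s) * p s (a + b - s))"
      by (rule sum.reindex_bij_witness[of _ "\<lambda>s. nat (s - i + int N)" "\<lambda>t. i - int N + int t"])
        (auto simp: algebra_simps)
    also have "\<dots> = (\<Sum>s\<in>{a..d} \<union> {i - int N..i}. binom_inf (int N) (i - s) * p s (a + b - s))"
      by (rule sum.mono_neutral_left) (auto simp: binom_inf_eq_0 not_le binom_inf_of_nat_neg)
    also have "\<dots> = (\<Sum>s\<in>{a..d}. binom_inf (int N) (i - s) * p s (a + b - s))"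
      using that by (intro sum.mono_neutral_right) (auto simp: top)
    finally show ?thesis .
  qed
  have "(\<Sum>i\<in>A. times_diff_power N p i (a + b + int N - i) * binom_inf (- int N) (a - i)) =
      (\<Sum>i\<in>{a + int N..d + int N}. times_diff_power N p i (a + b + int N - i) * binom_inf (- int N) (a - i))"
    using A by (intro sum.mono_neutral_right)
      (auto simp: not_le binom_inf_eq_0 times_diff_power_def top intro!: sum.neutral)
  also have "\<dots> = (\<Sum>i\<in>{a + int N..d + int N}. (\<Sum>s\<in>{a..d}. binom_inf (int N) (i - s) * p s (a + b - s)) * binom_inf (- int N) (a - i))"
    by (intro sum.cong refl) (simp add: h)
  also have "\<dots> = (\<Sum>s\<in>{a..d}. p s (a + b - s) * (\<Sum>i\<in>{a + int N..d + int N}. binom_inf (int N) (i - s) * binom_inf (- int N) (a - i)))"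
    unfolding sum_distrib_left sum_distrib_right by (subst sum.swap) (simp add: mult_ac)
  also have "\<dots> = (\<Sum>s\<in>{a..d}. if s = a then p a b else 0)"
  proof (intro sum.cong refl)
    fix s assume s: "s \<in> {a..d}"
    have "(\<Sum>i\<in>{a + int N..d + int N}. binom_inf (int N) (i - s) * binom_inf (- int N) (a - i)) =
        (\<Sum>k\<in>{a + int N - s..d + int N - s}. binom_inf (int N) k * binom_inf (- int N) (a - s - k))"
      by (rule sum.reindex_bij_witness[of _ "\<lambda>k. k + s" "\<lambda>i. i - s"]) auto
    also have "\<dots> = binom_inf (int N + - int N) (a - s)"
      using s by (intro binom_inf_conv) auto
    finally show "p s (a + b - s) * (\<Sum>i\<in>{a + int N..d + int N}. binom_inf (int N) (i - s) * binom_inf (- int N) (a - i)) =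
        (if s = a then p a b else 0)"
      by (simp add: binom_inf_0)
  qed
  also have "\<dots> = p a b" by (auto simp: top not_le)
  finally show ?thesis ..
qed

section \<open>Three-point functions and their residue at \<open>x1 = x2\<close>\<close>

text \<open>Here \<open>p\<close> and \<open>q\<close> are the coefficient arrays of the expansions of one function
  \<open>h(x1,x2) / (x1 - x2)^N\<close> in \<open>|x1| > |x2|\<close> and in \<open>|x2| > |x1|\<close>; the bounds make the
  numerator \<open>h\<close> a Laurent polynomial.\<close>

locale three_point =
  fixes p q :: "int \<Rightarrow> int \<Rightarrow> complex" and N :: nat and d1 d2 lo :: int
  assumes p_top: "i > d1 \<Longrightarrow> p i j = 0" and q_top: "j > d2 \<Longrightarrow> q i j = 0"
    and p_bot: "j < lo \<Longrightarrow> p i j = 0" and q_bot: "i < lo \<Longrightarrow> q i j = 0"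
    and locality: "times_diff_power N p i j = (-1) ^ N * times_diff_power N (\<lambda>j i. q i j) j i"
begin

definition "h = times_diff_power N p"

abbreviation "I \<equiv> {lo..d1 + int N}"
abbreviation "J \<equiv> {lo..d2 + int N}"

text \<open>Each order of the operators bounds two sides of the support: \<open>p\<close> from above
  in \<open>x1\<close> and from below in \<open>x2\<close>, \<open>q\<close> the other two.\<close>

lemma h_zero: "i \<notin> I \<or> j \<notin> J \<Longrightarrow> h i j = 0"
proof -
  have "h i j = 0" if "i > d1 + int N \<or> j < lo"
    using that unfolding h_def times_diff_power_def by (auto intro!: sum.neutral simp: p_top p_bot)
  moreover have "h i j = 0" if "j > d2 + int N \<or> i < lo"
    using that unfolding h_def locality unfolding times_diff_power_def
    by (auto intro!: sum.neutral simp: q_top q_bot)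
  ultimately show "i \<notin> I \<or> j \<notin> J \<Longrightarrow> h i j = 0" by fastforce
qed

lemma p_eq: "p a b = (\<Sum>i\<in>I. h i (a + b + int N - i) * binom_inf (- int N) (a - i))"
proof -
  have "p a b = (\<Sum>i\<in>{a + int N..d1 + int N} \<union> I. h i (a + b + int N - i) * binom_inf (- int N) (a - i))"
    unfolding h_def by (rule divide_diff_power) (auto simp: p_top)
  also have "\<dots> = (\<Sum>i\<in>I. h i (a + b + int N - i) * binom_inf (- int N) (a - i))"
    by (rule sum.mono_neutral_right) (auto simp: h_zero)
  finally show ?thesis .
qed

lemma q_eq: "q a b = (-1) ^ N * (\<Sum>j\<in>J. h (a + b + int N - j) j * binom_inf (- int N) (b - j))"
proof -
  have h': "times_diff_power N (\<lambda>j i. q i j) j i = (-1) ^ N * h i j" for i j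
    using locality[of i j] by (simp add: h_def)
  have "q a b = (\<Sum>j\<in>{b + int N..d2 + int N} \<union> J.
      times_diff_power N (\<lambda>j i. q i j) j (b + a + int N - j) * binom_inf (- int N) (b - j))"
    by (rule divide_diff_power) (auto simp: q_top)
  also have "\<dots> = (\<Sum>j\<in>J. (-1) ^ N * h (b + a + int N - j) j * binom_inf (- int N) (b - j))"
    unfolding h' by (rule sum.mono_neutral_right) (auto simp: h_zero)
  finally show ?thesis by (simp add: sum_distrib_left mult_ac add_ac)
qed

text \<open>The coefficient of \<open>x0^(-l-1) x2^n\<close> in
  \<open>h(x2 + x0, x2) / x0^N\<close>, expanded in |x2| > |x0|.\<close>

definition iterate_coeff :: "int \<Rightarrow> int \<Rightarrow> complex" where
  "iterate_coeff l n = (\<Sum>i\<in>I. h i (n + (int N - 1 - l) - i) * gbinom_int (of_int i) (int N - 1 - l))"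

lemma sum_antidiagonal: "(\<Sum>j\<in>J. h (c - j) j * f j) = (\<Sum>i\<in>I. h i (c - i) * f (c - i))"
proof -
  have "(\<Sum>j\<in>J. h (c - j) j * f j) = (\<Sum>j\<in>J \<union> (\<lambda>i. c - i) ` I. h (c - j) j * f j)"
    by (rule sum.mono_neutral_left) (auto simp: h_zero)
  also have "\<dots> = (\<Sum>i\<in>(\<lambda>j. c - j) ` J \<union> I. h i (c - i) * f (c - i))"
    by (rule sum.reindex_bij_witness[of _ "\<lambda>i. c - i" "\<lambda>j. c - j"]) auto
  also have "\<dots> = (\<Sum>i\<in>I. h i (c - i) * f (c - i))"
    by (rule sum.mono_neutral_right) (auto simp: h_zero)
  finally show ?thesis .
qed

text \<open>Contour deformation in \<open>x1\<close>: the residues of \<open>(x1 - x2)^l\<close>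
  times the function, taken in |x1| > |x2| and in |x2| > |x1|, differ by the residue at
  \<open>x1 = x2\<close>. Multiplying the numerator by \<open>(x1 - x2)^(l - N)\<close> leaves the
  two expansions of one negative power, whose difference is \<open>binom_inf_delta\<close>.\<close>

lemma residue_eq_iterate_coeff:
  assumes "l < int N"
  shows "\<exists>K0. \<forall>K\<ge>K0. (\<Sum>t<K. (-1) ^ t * (of_int l gchoose t) *
    (p (-1 - l + int t) (n - int t) - (-1) powi l * q (-1 - int t) (n - l + int t))) = iterate_coeff l n"
proof (intro exI allI impI)
  \<comment> \<open>The two bounds let \<open>conv\<close> below apply with
    \<open>d = -1 - i\<close> for every \<open>i\<close> in \<open>I\<close>, and with
    \<open>d = n - j\<close> for every \<open>j\<close> in \<open>J\<close>.\<close>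
  fix K assume K: "K \<ge> nat (max (l + 2 + d1) (l + 1 + d2 - n))"
  define M where "M = int N - 1 - l"
  have M: "M \<ge> 0" "l - int N = - M - 1" using assms by (auto simp: M_def)
  have conv: "(\<Sum>t<K. binom_inf l (l - int t) * binom_inf (- int N) (d - (l - int t))) = binom_inf (l - int N) d"
    if "d + int N > l - int K" for d
  proof -
    have "(\<Sum>t<K. binom_inf l (l - int t) * binom_inf (- int N) (d - (l - int t))) =
        (\<Sum>k\<in>{l - int K<..l}. binom_inf l k * binom_inf (- int N) (d - k))"
      by (rule sum.reindex_bij_witness[of _ "\<lambda>k. nat (l - k)" "\<lambda>t. l - int t"]) auto
    also have "\<dots> = binom_inf (l + - int N) d" using that by (intro binom_inf_conv) auto
    finally show ?thesis by simp
  qed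
  have P: "(\<Sum>t<K. binom_inf l (l - int t) * p (-1 - l + int t) (n - int t)) =
      (\<Sum>i\<in>I. h i (n + M - i) * binom_inf (- M - 1) (-1 - i))"
  proof -
    have "(\<Sum>t<K. binom_inf l (l - int t) * p (-1 - l + int t) (n - int t)) =
        (\<Sum>t<K. binom_inf l (l - int t) * (\<Sum>i\<in>I. h i (n + M - i) * binom_inf (- int N) ((-1 - i) - (l - int t))))"
    proof (intro sum.cong refl arg_cong2[of _ _ _ _ "(*)"])
      fix t
      show "p (-1 - l + int t) (n - int t) =
          (\<Sum>i\<in>I. h i (n + M - i) * binom_inf (- int N) ((-1 - i) - (l - int t)))"
        by (subst p_eq) (intro sum.cong refl, simp add: M_def algebra_simps)
    qed
    also have "\<dots> = (\<Sum>i\<in>I. h i (n + M - i) * (\<Sum>t<K. binom_inf l (l - int t) * binom_inf (- int N) ((-1 - i) - (l - int t))))"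
      unfolding sum_distrib_left by (subst sum.swap) (simp add: mult_ac)
    also have "\<dots> = (\<Sum>i\<in>I. h i (n + M - i) * binom_inf (- M - 1) (-1 - i))"
      unfolding M(2)[symmetric] by (intro sum.cong refl arg_cong2[of _ _ _ _ "(*)"] conv) (use K in auto)
    finally show ?thesis .
  qed
  have Q: "(\<Sum>t<K. binom_inf l (l - int t) * q (-1 - int t) (n - l + int t)) =
      (-1) ^ N * (\<Sum>i\<in>I. h i (n + M - i) * binom_inf (- M - 1) (i - M))"
  proof -
    have "(\<Sum>t<K. binom_inf l (l - int t) * q (-1 - int t) (n - l + int t)) =
        (\<Sum>t<K. binom_inf l (l - int t) * ((-1) ^ N * (\<Sum>j\<in>J. h (n + M - j) j * binom_inf (- int N) ((n - j) - (l - int t)))))"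
    proof (intro sum.cong refl arg_cong2[of _ _ _ _ "(*)"])
      fix t
      show "q (-1 - int t) (n - l + int t) =
          (-1) ^ N * (\<Sum>j\<in>J. h (n + M - j) j * binom_inf (- int N) ((n - j) - (l - int t)))"
        by (subst q_eq) (intro arg_cong2[of _ _ _ _ "(*)"] sum.cong refl, auto simp: M_def algebra_simps)
    qed
    also have "\<dots> = (-1) ^ N * (\<Sum>j\<in>J. h (n + M - j) j * (\<Sum>t<K. binom_inf l (l - int t) * binom_inf (- int N) ((n - j) - (l - int t))))"
      unfolding sum_distrib_left by (subst sum.swap) (simp add: mult_ac)
    also have "\<dots> = (-1) ^ N * (\<Sum>j\<in>J. h (n + M - j) j * binom_inf (- M - 1) (n - j))"
      unfolding M(2)[symmetric] by (intro sum.cong refl arg_cong2[of _ _ _ _ "(*)"] conv) (use K in auto)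
    also have "(\<Sum>j\<in>J. h (n + M - j) j * binom_inf (- M - 1) (n - j)) = (\<Sum>i\<in>I. h i (n + M - i) * binom_inf (- M - 1) (i - M))"
      unfolding sum_antidiagonal by (simp add: algebra_simps)
    finally show ?thesis .
  qed
  have sign: "(-1) powi l * (-1) ^ N = ((-1) powi (M + 1) :: complex)"
  proof -
    have "(-1) powi (M + 1) * ((-1) powi l :: complex) = (-1) ^ N"
      by (subst power_int_add[symmetric]) (auto simp: M_def)
    then show ?thesis by (metis minus_one_powi_cancel mult.commute)
  qed
  have "(\<Sum>t<K. (-1) ^ t * (of_int l gchoose t) *
      (p (-1 - l + int t) (n - int t) - (-1) powi l * q (-1 - int t) (n - l + int t))) =
    (\<Sum>t<K. binom_inf l (l - int t) * p (-1 - l + int t) (n - int t)) -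
      (-1) powi l * (\<Sum>t<K. binom_inf l (l - int t) * q (-1 - int t) (n - l + int t))"
    by (simp add: binom_inf_diff sum_subtractf sum_distrib_left algebra_simps)
  also have "\<dots> = (\<Sum>i\<in>I. h i (n + M - i) * (binom_inf (- M - 1) (-1 - i) - (-1) powi (M + 1) * binom_inf (- M - 1) (i - M)))"
    unfolding P Q sign[symmetric] by (simp add: sum_subtractf sum_distrib_left algebra_simps)
  also have "\<dots> = iterate_coeff l n"
    unfolding iterate_coeff_def binom_inf_delta[OF M(1)] by (simp add: M_def)
  finally show "(\<Sum>t<K. (-1) ^ t * (of_int l gchoose t) *
      (p (-1 - l + int t) (n - int t) - (-1) powi l * q (-1 - int t) (n - l + int t))) = iterate_coeff l n" .
qed


section \<open>The three-point function and its iterate expanded at infinity\<close>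

text \<open>The coefficient of \<open>z1^k1 z2^k2\<close> in the numerator expanded at infinity in
  both variables. A negative power of \<open>x\<close> yields infinitely many powers of
  \<open>z\<close>, so the support is bounded only above.\<close>

definition hinf :: "int \<Rightarrow> int \<Rightarrow> complex" where
  "hinf k1 k2 = (\<Sum>i\<in>I. \<Sum>j\<in>J. h i j * binom_inf i k1 * binom_inf j k2)"

text \<open>The exponents of \<open>z1\<close> possible in total degree \<open>d\<close>, as
  \<open>hinf\<close> vanishes unless \<open>k1 \<le> d1 + int N\<close> and
  \<open>k2 \<le> d2 + int N\<close>.\<close>

abbreviation "K1 d \<equiv> {d - d2 - int N..d1 + int N}"

text \<open>Transfers an identity for the single monomial \<open>x1^i x2^j\<close> to the whole
  numerator. The range \<open>A i j\<close> may depend on the monomial, provided nothing is lost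
  outside it.\<close>

lemma hinf_sum:
  assumes "\<And>i j. i \<in> I \<Longrightarrow> j \<in> J \<Longrightarrow> F i j = (\<Sum>k\<in>A i j. binom_inf i k * binom_inf j (d - k) * f k)"
    and "\<And>i j. i \<in> I \<Longrightarrow> j \<in> J \<Longrightarrow> finite (A i j)"
    and "\<And>i j k. i \<in> I \<Longrightarrow> j \<in> J \<Longrightarrow> d - j \<le> k \<Longrightarrow> k \<le> i \<Longrightarrow> k \<notin> A i j \<Longrightarrow> f k = 0"
  shows "(\<Sum>i\<in>I. \<Sum>j\<in>J. h i j * F i j) = (\<Sum>k\<in>K1 d. hinf k (d - k) * f k)"
proof -
  have "(\<Sum>i\<in>I. \<Sum>j\<in>J. h i j * F i j) =
      (\<Sum>i\<in>I. \<Sum>j\<in>J. h i j * (\<Sum>k\<in>K1 d. binom_inf i k * binom_inf j (d - k) * f k))"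
  proof (intro sum.cong refl arg_cong2[of _ _ _ _ "(*)"])
    fix i j assume ij: "i \<in> I" "j \<in> J"
    have *: "binom_inf i k * binom_inf j (d - k) = 0" if "k < d - j \<or> k > i" for k
      using that by (auto simp: binom_inf_eq_0)
    have "F i j = (\<Sum>k\<in>A i j \<union> K1 d. binom_inf i k * binom_inf j (d - k) * f k)"
      unfolding assms(1)[OF ij]
    proof (rule sum.mono_neutral_left)
      show "\<forall>k\<in>A i j \<union> K1 d - A i j. binom_inf i k * binom_inf j (d - k) * f k = 0"
        using assms(3)[OF ij] * by (metis DiffD2 linorder_not_less mult_eq_0_iff)
    qed (use assms(2)[OF ij] in auto)
    also have "\<dots> = (\<Sum>k\<in>K1 d. binom_inf i k * binom_inf j (d - k) * f k)"
    proof (rule sum.mono_neutral_right)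
      show "\<forall>k\<in>A i j \<union> K1 d - K1 d. binom_inf i k * binom_inf j (d - k) * f k = 0"
        using ij by (auto simp: binom_inf_eq_0)
    qed (use assms(2)[OF ij] in auto)
    finally show "F i j = \<dots>" .
  qed
  also have "\<dots> = (\<Sum>i\<in>I. \<Sum>k\<in>K1 d. \<Sum>j\<in>J. h i j * binom_inf i k * binom_inf j (d - k) * f k)"
    unfolding sum_distrib_left by (subst (2) sum.swap) (simp add: mult_ac)
  also have "\<dots> = (\<Sum>k\<in>K1 d. hinf k (d - k) * f k)"
    unfolding hinf_def sum_distrib_right by (rule sum.swap)
  finally show ?thesis .
qed

lemma coeff_inf_h: "coeff_inf (\<lambda>n. h i (n + c)) e = (\<Sum>j\<in>J. h i j * binom_inf (j - c) e)"
proof -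
  have "coeff_inf (\<lambda>n. h i (n + c)) e = (\<Sum>n\<in>{lo - c..d2 + int N - c}. binom_inf n e * h i (n + c))"
    by (rule coeff_inf_superset) (use h_zero[of i] in force)+
  also have "\<dots> = (\<Sum>j\<in>J. h i j * binom_inf (j - c) e)"
    by (rule sum.reindex_bij_witness[of _ "\<lambda>j. j - c" "\<lambda>n. n + c"]) auto
  finally show ?thesis .
qed

lemma eventually_0_h: "eventually_0 (\<lambda>n. h i (n + c))"
proof -
  have "\<forall>n>d2 + int N - c. h i (n + c) = 0" using h_zero by auto
  then show ?thesis unfolding eventually_0_def by blast
qed

lemma coeff_inf_p: "coeff_inf (\<lambda>a. p a b) e = (\<Sum>a\<in>{e..d1}. binom_inf a e * p a b)"
  by (rule coeff_inf_atMost) (rule p_top)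

text \<open>The total degree \<open>a + b\<close> in \<open>p\<close> is at most
  \<open>d1 + d2 + int N\<close>, because \<open>h\<close> is a Laurent polynomial; a lower bound on
  \<open>a\<close> therefore bounds \<open>b\<close> from above.\<close>

lemma eventually_0_coeff_inf_p: "eventually_0 (\<lambda>b. coeff_inf (\<lambda>a. p a b) e)"
proof -
  have "\<forall>b>d1 + d2 + int N - e. p a b = 0" if "a \<ge> e" for a
  proof (intro allI impI)
    fix b assume "b > d1 + d2 + int N - e"
    then show "p a b = 0"
      unfolding p_eq[of a b] using that by (intro sum.neutral ballI) (auto simp: h_zero)
  qed
  then have "\<forall>b>d1 + d2 + int N - e. coeff_inf (\<lambda>a. p a b) e = 0" by (auto intro: coeff_inf_0)
  then show ?thesis unfolding eventually_0_def by blast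
qed

text \<open>By \<open>expansion_change\<close> on each monomial of the numerator, the successive
  expansions of \<open>p\<close> at infinity give the numerator at infinity times
  \<open>(z1 - z2)^(-N)\<close> in |z1| > |z2|.\<close>

lemma coeff_inf_coeff_inf_p:
  "coeff_inf (\<lambda>b. coeff_inf (\<lambda>a. p a b) e1) e2 =
    (\<Sum>k\<in>K1 (e1 + e2 + int N). hinf k (e1 + e2 + int N - k) * binom_inf (- int N) (e1 - k))"
proof -
  have "coeff_inf (\<lambda>b. coeff_inf (\<lambda>a. p a b) e1) e2 =
      coeff_inf (\<lambda>b. \<Sum>(a, i)\<in>{e1..d1} \<times> I. (binom_inf a e1 * binom_inf (- int N) (a - i)) * h i (b + (a + int N - i))) e2"
    unfolding coeff_inf_p sum.cartesian_product[symmetric]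
  proof (intro arg_cong[of _ _ "\<lambda>F. coeff_inf F e2"] ext sum.cong refl)
    fix a b
    show "binom_inf a e1 * p a b = (\<Sum>i\<in>I. (binom_inf a e1 * binom_inf (- int N) (a - i)) * h i (b + (a + int N - i)))"
      by (subst p_eq) (simp add: sum_distrib_left algebra_simps)
  qed
  also have "\<dots> = (\<Sum>x\<in>{e1..d1} \<times> I. (case x of (a, i) \<Rightarrow> binom_inf a e1 * binom_inf (- int N) (a - i)) *
      coeff_inf (case x of (a, i) \<Rightarrow> \<lambda>b. h i (b + (a + int N - i))) e2)"
    by (subst coeff_inf_lincomb[symmetric]) (auto simp: eventually_0_h case_prod_unfold)
  also have "\<dots> = (\<Sum>a\<in>{e1..d1}. \<Sum>i\<in>I. \<Sum>j\<in>J. h i j * (binom_inf a e1 * binom_inf (- int N) (a - i) * binom_inf (i + j - int N - a) e2))"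
    by (subst sum.cartesian_product[of _ I], intro sum.cong refl)
      (simp only: split_paired_all prod.case coeff_inf_h sum_distrib_left, intro sum.cong refl,
        simp add: algebra_simps)
  also have "\<dots> = (\<Sum>i\<in>I. \<Sum>j\<in>J. h i j * (\<Sum>a\<in>{e1..d1}. binom_inf a e1 * binom_inf (- int N) (a - i) * binom_inf (i + j - int N - a) e2))"
    unfolding sum_distrib_left by (rule trans[OF sum.swap], rule sum.cong[OF refl], rule sum.swap)
  also have "\<dots> = (\<Sum>k\<in>K1 (e1 + e2 + int N). hinf k (e1 + e2 + int N - k) * binom_inf (- int N) (e1 - k))"
  proof (rule hinf_sum)
    fix i j assume "i \<in> I" "j \<in> J"
    then show "(\<Sum>a\<in>{e1..d1}. binom_inf a e1 * binom_inf (- int N) (a - i) * binom_inf (i + j - int N - a) e2) =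
        (\<Sum>k\<in>{e1 + int N..i}. binom_inf i k * binom_inf j (e1 + e2 + int N - k) * binom_inf (- int N) (e1 - k))"
      by (intro expansion_change) auto
  qed (auto simp: binom_inf_eq_0)
  finally show ?thesis .
qed

text \<open>The shift \<open>x1 = x2 + x0\<close> is also \<open>z1 = z2 + x0\<close>. So
  \<open>z1^k\<close> contributes the binomial coefficient of \<open>k\<close> over
  \<open>int N - 1 - l\<close>, whether the expansion at infinity precedes or follows the
  shift.\<close>

lemma coeff_inf_iterate_coeff:
  "coeff_inf (iterate_coeff l) (d - (int N - 1 - l)) = (\<Sum>k\<in>K1 d. hinf k (d - k) * gbinom_int (of_int k) (int N - 1 - l))"
proof -
  define M where "M = int N - 1 - l"
  have "coeff_inf (iterate_coeff l) (d - M) = coeff_inf (\<lambda>n. \<Sum>i\<in>I. gbinom_int (of_int i) M * h i (n + (M - i))) (d - M)"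
    by (intro arg_cong[of _ _ "\<lambda>F. coeff_inf F (d - M)"] ext) (simp add: iterate_coeff_def M_def algebra_simps)
  also have "\<dots> = (\<Sum>i\<in>I. gbinom_int (of_int i) M * coeff_inf (\<lambda>n. h i (n + (M - i))) (d - M))"
    by (rule coeff_inf_lincomb) (auto simp: eventually_0_h)
  also have "\<dots> = (\<Sum>i\<in>I. \<Sum>j\<in>J. h i j * (gbinom_int (of_int i) M * binom_inf (i + j - M) (d - M)))"
    unfolding coeff_inf_h sum_distrib_left by (intro sum.cong refl) (simp add: algebra_simps)
  also have "\<dots> = (\<Sum>k\<in>K1 d. hinf k (d - k) * gbinom_int (of_int k) M)"
  proof (rule hinf_sum)
    fix i j
    show "gbinom_int (of_int i) M * binom_inf (i + j - M) (d - M) =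
        (\<Sum>k\<in>{d - j..i}. binom_inf i k * binom_inf j (d - k) * gbinom_int (of_int k) M)"
      by (subst binom_inf_conv_gbinom_int[symmetric, of "{d - j..i}"]) (auto simp: mult_ac)
  qed auto
  finally show ?thesis by (simp add: M_def)
qed

lemma eventually_0_iterate_coeff: "eventually_0 (iterate_coeff l)"
proof -
  have "\<forall>n>d1 + int N + d2 + int N - (int N - 1 - l). iterate_coeff l n = 0"
    unfolding iterate_coeff_def by (auto intro!: sum.neutral simp: h_zero)
  then show ?thesis unfolding eventually_0_def by blast
qed

end

section \<open>Iterates of vertex operators and associativity of expansions\<close>

text \<open>\<open>rr \<gamma> E n\<close> is the coefficient of \<open>x2^n\<close> in \<open>(1 + x2)^\<gamma>\<close> times the coefficient of
  \<open>x0^(-E-1)\<close> in the iterate \<open>Y(Y(a,x0)b,x2)c\<close>.\<close>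

locale three_point_iterate = three_point +
  fixes rr :: "complex \<Rightarrow> int \<Rightarrow> int \<Rightarrow> complex" and \<alpha> \<beta> :: complex
  assumes rr_succ: "rr (\<gamma> + 1) E n = rr \<gamma> E n + rr \<gamma> E (n - 1)"
    and rr_top: "E \<ge> int N \<Longrightarrow> rr \<gamma> E n = 0"
    and iterate: "\<exists>K0. \<forall>K\<ge>K0.
      (\<Sum>k<K. (\<alpha> gchoose k) * rr (\<alpha> + \<beta> - of_nat k) (l + int k) n) =
      (\<Sum>t<K. (-1) ^ t * (of_int l gchoose t) *
        (p (-1 - l + int t) (n - int t) - (-1) powi l * q (-1 - int t) (n - l + int t)))"
begin

text \<open>The left side is the coefficient of \<open>x0^(-l-1) x2^n\<close> in the iterate times
  \<open>(1 + x2 + x0)^\<alpha> (1 + x2)^\<beta>\<close>, by Taylor expansion in \<open>x0\<close>.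
  Since modes with \<open>E \<ge> int N\<close> vanish, the unspecified threshold in
  \<open>iterate\<close> improves to \<open>int N - l\<close>.\<close>

lemma iterate_eq_iterate_coeff:
  assumes "l < int N" "K \<ge> nat (int N - l)"
  shows "(\<Sum>k<K. (\<alpha> gchoose k) * rr (\<alpha> + \<beta> - of_nat k) (l + int k) n) = iterate_coeff l n"
proof -
  obtain K0 where K0: "\<And>K. K \<ge> K0 \<Longrightarrow>
      (\<Sum>k<K. (\<alpha> gchoose k) * rr (\<alpha> + \<beta> - of_nat k) (l + int k) n) =
      (\<Sum>t<K. (-1) ^ t * (of_int l gchoose t) *
        (p (-1 - l + int t) (n - int t) - (-1) powi l * q (-1 - int t) (n - l + int t)))"
    using iterate[of l n] by blast
  obtain K1 where K1: "\<And>K. K \<ge> K1 \<Longrightarrow> (\<Sum>t<K. (-1) ^ t * (of_int l gchoose t) *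
        (p (-1 - l + int t) (n - int t) - (-1) powi l * q (-1 - int t) (n - l + int t))) = iterate_coeff l n"
    using residue_eq_iterate_coeff[OF assms(1), of n] by blast
  have "(\<Sum>k<K. (\<alpha> gchoose k) * rr (\<alpha> + \<beta> - of_nat k) (l + int k) n) =
      (\<Sum>k<max K (max K0 K1). (\<alpha> gchoose k) * rr (\<alpha> + \<beta> - of_nat k) (l + int k) n)"
    using assms by (intro sum.mono_neutral_left) (auto simp: rr_top)
  then show ?thesis using K0[of "max K (max K0 K1)"] K1[of "max K (max K0 K1)"] by simp
qed

text \<open>Multiplication by \<open>z2^s\<close>. It serves to give the mode
  \<open>E = l + k\<close> an exponent of \<open>1 + x2\<close> that depends on \<open>E\<close>
  alone: choosing \<open>s = \<nu> - l\<close> turns \<open>s - k\<close> into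
  \<open>\<nu> - E\<close>.\<close>

lemma coeff_inf_iterate:
  assumes "l < int N" "K \<ge> nat (int N - l)"
  shows "coeff_inf (\<lambda>n. \<Sum>k<K. (\<alpha> gchoose k) * rr (\<alpha> + \<beta> + of_nat s - of_nat k) (l + int k) n) (e + int s) = coeff_inf (iterate_coeff l) e"
proof -
  define F where "F s n = (\<Sum>k<K. (\<alpha> gchoose k) * rr (\<alpha> + \<beta> + of_nat s - of_nat k) (l + int k) n)" for s n
  have F0: "F 0 = iterate_coeff l" using iterate_eq_iterate_coeff[OF assms] by (auto simp: F_def)
  have FSuc: "F (Suc s) = (\<lambda>n. F s n + F s (n - 1))" for s
  proof
    fix n
    have "rr (\<alpha> + \<beta> + of_nat (Suc s) - of_nat k) (l + int k) n =
        rr (\<alpha> + \<beta> + of_nat s - of_nat k) (l + int k) n + rr (\<alpha> + \<beta> + of_nat s - of_nat k) (l + int k) (n - 1)" for k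
      using rr_succ[of "\<alpha> + \<beta> + of_nat s - of_nat k"] by (simp add: algebra_simps)
    then show "F (Suc s) n = F s n + F s (n - 1)"
      by (simp add: F_def sum.distrib algebra_simps)
  qed
  have "eventually_0 (F s) \<and> coeff_inf (F s) (e + int s) = coeff_inf (iterate_coeff l) e"
  proof (induction s)
    case 0
    then show ?case by (simp add: F0 eventually_0_iterate_coeff)
  next
    case (Suc s)
    then show ?case
      using coeff_inf_times_z[of "F s" "e + int s"] eventually_0_times_z[of "F s"] by (simp add: FSuc algebra_simps)
  qed
  then show ?thesis unfolding F_def by blast
qed

text \<open>Replacing \<open>\<alpha>\<close> by \<open>\<alpha> + \<mu>\<close> multiplies by
  \<open>z1^\<mu>\<close>, that is, moves \<open>z1^k\<close> to \<open>z1^(\<mu> + k)\<close>, also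
  for negative \<open>\<mu>\<close>. One Vandermonde sum splits off \<open>\<mu>\<close> and a
  second one absorbs it into \<open>k\<close>. The condition \<open>\<nu> \<ge> int N\<close> keeps
  the shifts \<open>\<nu> - l\<close> natural.\<close>

lemma iterate_modes:
  assumes \<nu>: "\<nu> \<ge> int N" and ev: "\<And>E. E < int N \<Longrightarrow> eventually_0 (rr (\<alpha> + \<beta> + of_int (\<nu> - E)) E)"
  shows "(\<Sum>E\<in>{-K..int N - 1}. gbinom_int (\<alpha> + of_int \<mu>) (E + K) * coeff_inf (rr (\<alpha> + \<beta> + of_int (\<nu> - E)) E) e) =
    (\<Sum>k\<in>K1 (e - \<nu> + int N - 1). hinf k (e - \<nu> + int N - 1 - k) * gbinom_int (of_int (\<mu> + k)) (int N - 1 + K))"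
proof -
  define t where "t E = coeff_inf (rr (\<alpha> + \<beta> + of_int (\<nu> - E)) E) e" for E
  define d where "d = e - \<nu> + int N - 1"
  have inner: "(\<Sum>E\<in>{-K..int N - 1}. gbinom_int \<alpha> (E - l) * t E) = (\<Sum>k\<in>K1 d. hinf k (d - k) * gbinom_int (of_int k) (int N - 1 - l))"
    if "l \<ge> -K" "l \<le> int N - 1" for l
  proof -
    have "(\<Sum>E\<in>{-K..int N - 1}. gbinom_int \<alpha> (E - l) * t E) = (\<Sum>E\<in>{l..int N - 1}. gbinom_int \<alpha> (E - l) * t E)"
      using that by (intro sum.mono_neutral_right) auto
    also have "\<dots> = (\<Sum>k<nat (int N - l). (\<alpha> gchoose k) * t (l + int k))"
      by (rule sum.reindex_bij_witness[of _ "\<lambda>k. l + int k" "\<lambda>E. nat (E - l)"]) (auto simp: gbinom_int_def)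
    also have "\<dots> = coeff_inf (\<lambda>n. \<Sum>k<nat (int N - l). (\<alpha> gchoose k) * rr (\<alpha> + \<beta> + of_int (\<nu> - (l + int k))) (l + int k) n) e"
      unfolding t_def by (rule coeff_inf_lincomb[symmetric]) (auto intro!: ev simp del: of_int_diff of_int_add)
    also have "\<dots> = coeff_inf (\<lambda>n. \<Sum>k<nat (int N - l). (\<alpha> gchoose k) * rr (\<alpha> + \<beta> + of_nat (nat (\<nu> - l)) - of_nat k) (l + int k) n)
        (d - (int N - 1 - l) + int (nat (\<nu> - l)))"
      using that \<nu> by (simp add: d_def algebra_simps)
    also have "\<dots> = coeff_inf (iterate_coeff l) (d - (int N - 1 - l))"
      using that by (intro coeff_inf_iterate) auto
    finally show ?thesis by (simp add: coeff_inf_iterate_coeff)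
  qed
  have "(\<Sum>E\<in>{-K..int N - 1}. gbinom_int (\<alpha> + of_int \<mu>) (E + K) * t E) =
      (\<Sum>E\<in>{-K..int N - 1}. (\<Sum>\<kappa>\<in>{0..int N - 1 + K}. gbinom_int (of_int \<mu>) \<kappa> * gbinom_int \<alpha> (E + K - \<kappa>)) * t E)"
    by (intro sum.cong refl, subst gbinom_int_Vandermonde) (auto simp: add.commute)
  also have "\<dots> = (\<Sum>\<kappa>\<in>{0..int N - 1 + K}. gbinom_int (of_int \<mu>) \<kappa> * (\<Sum>E\<in>{-K..int N - 1}. gbinom_int \<alpha> (E - (\<kappa> - K)) * t E))"
    unfolding sum_distrib_left sum_distrib_right by (subst sum.swap) (simp add: algebra_simps)
  also have "\<dots> = (\<Sum>\<kappa>\<in>{0..int N - 1 + K}. gbinom_int (of_int \<mu>) \<kappa> * (\<Sum>k\<in>K1 d. hinf k (d - k) * gbinom_int (of_int k) (int N - 1 - (\<kappa> - K))))"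
    by (intro sum.cong refl arg_cong2[of _ _ _ _ "(*)"] inner) auto
  also have "\<dots> = (\<Sum>k\<in>K1 d. hinf k (d - k) * (\<Sum>\<kappa>\<in>{0..int N - 1 + K}. gbinom_int (of_int \<mu>) \<kappa> * gbinom_int (of_int k) (int N - 1 + K - \<kappa>)))"
    unfolding sum_distrib_left by (subst sum.swap) (simp add: algebra_simps)
  also have "\<dots> = (\<Sum>k\<in>K1 d. hinf k (d - k) * gbinom_int (of_int (\<mu> + k)) (int N - 1 + K))"
    by (subst gbinom_int_Vandermonde) auto
  finally show ?thesis by (simp add: t_def d_def)
qed

text \<open>The bound on \<open>\<mu>\<close> makes every power \<open>z1^(\<mu> + k)\<close> a
  polynomial in \<open>x0\<close>; the bound on \<open>K\<close> asks for a coefficient beyond its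
  degree.\<close>

lemma iterate_modes_eq_0:
  assumes "\<nu> \<ge> int N" "\<And>E. E < int N \<Longrightarrow> eventually_0 (rr (\<alpha> + \<beta> + of_int (\<nu> - E)) E)"
    and "\<mu> \<ge> d2 - e + \<nu> + 1" "K > d1 + \<mu> + 1"
  shows "(\<Sum>E\<in>{-K..int N - 1}. gbinom_int (\<alpha> + of_int \<mu>) (E + K) * coeff_inf (rr (\<alpha> + \<beta> + of_int (\<nu> - E)) E) e) = 0"
proof -
  have "gbinom_int (of_int (\<mu> + k)) (int N - 1 + K) = 0" if "k \<in> K1 (e - \<nu> + int N - 1)" for k
    using that assms(3,4) by (intro gbinom_int_eq_0) auto
  then show ?thesis by (subst iterate_modes) (use assms(1,2) in auto)
qed

text \<open>With \<open>x0 = z1 - z2\<close>, the term \<open>z1^k x0^(-N)\<close> has to pass from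
  |x0| < |z2| to |z1| > |z2|. After multiplication by \<open>z1^\<mu>\<close> the expansion in
  \<open>x0\<close> terminates if \<open>\<mu> + k \<ge> 0\<close>, and
  \<open>coeff_inf_gbinom_int\<close> applies with \<open>y = x0 / z2\<close>. The bound on
  \<open>\<mu>\<close> covers the smallest \<open>k\<close> in \<open>K1\<close>, the bound on
  \<open>Q\<close> the largest.\<close>

theorem associativity:
  assumes "\<nu> \<ge> int N" "\<And>E. E < int N \<Longrightarrow> eventually_0 (rr (\<alpha> + \<beta> + of_int (\<nu> - E)) E)"
    and \<mu>: "\<mu> \<ge> d2 - e1 - e2" and Q: "int Q \<ge> d1 - e1"
  shows "coeff_inf (\<lambda>b. coeff_inf (\<lambda>a. p a b) e1) e2 =
    (\<Sum>r\<le>Q. binom_inf (e1 + \<mu> + int r) (e1 + \<mu>) *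
      (\<Sum>E\<in>{-(e1 + \<mu> + int r + 1)..int N - 1}. gbinom_int (\<alpha> + of_int \<mu>) (E + (e1 + \<mu> + int r + 1)) *
        coeff_inf (rr (\<alpha> + \<beta> + of_int (\<nu> - E)) E) (e1 + e2 + \<nu> + 1)))"
proof -
  define d where "d = e1 + e2 + int N"
  have "coeff_inf (\<lambda>b. coeff_inf (\<lambda>a. p a b) e1) e2 = (\<Sum>k\<in>K1 d. hinf k (d - k) * binom_inf (- int N) (e1 - k))"
    by (simp add: coeff_inf_coeff_inf_p d_def)
  also have "\<dots> = (\<Sum>k\<in>K1 d. hinf k (d - k) *
      (\<Sum>r\<le>Q. binom_inf (e1 + \<mu> + int r) (e1 + \<mu>) * gbinom_int (of_int (\<mu> + k)) (e1 + \<mu> + int r + int N)))"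
  proof (intro sum.cong refl arg_cong2[of _ _ _ _ "(*)"])
    fix k assume k: "k \<in> K1 d"
    have w: "0 \<le> \<mu> + k" using k \<mu> by (simp add: d_def)
    have "binom_inf (- int N) (e1 - k) = coeff_inf (\<lambda>n. gbinom_int (of_int (\<mu> + k)) (n + int N)) (e1 + \<mu>)"
      using coeff_inf_gbinom_int[OF w, of "int N" "e1 + \<mu>"] by simp
    also have "\<dots> = (\<Sum>r\<le>Q. binom_inf (e1 + \<mu> + int r) (e1 + \<mu>) * gbinom_int (of_int (\<mu> + k)) (e1 + \<mu> + int r + int N))"
      using k Q w by (intro coeff_inf_eq_sum_nat gbinom_int_eq_0) auto
    finally show "binom_inf (- int N) (e1 - k) = \<dots>" .
  qed
  also have "\<dots> = (\<Sum>r\<le>Q. binom_inf (e1 + \<mu> + int r) (e1 + \<mu>) *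
      (\<Sum>k\<in>K1 d. hinf k (d - k) * gbinom_int (of_int (\<mu> + k)) (e1 + \<mu> + int r + int N)))"
    unfolding sum_distrib_left by (subst sum.swap) (simp add: mult_ac)
  also have "\<dots> = (\<Sum>r\<le>Q. binom_inf (e1 + \<mu> + int r) (e1 + \<mu>) *
      (\<Sum>k\<in>K1 (e1 + e2 + \<nu> + 1 - \<nu> + int N - 1). hinf k (e1 + e2 + \<nu> + 1 - \<nu> + int N - 1 - k) *
         gbinom_int (of_int (\<mu> + k)) (int N - 1 + (e1 + \<mu> + int r + 1))))"
    by (simp add: d_def algebra_simps)
  also have "\<dots> = (\<Sum>r\<le>Q. binom_inf (e1 + \<mu> + int r) (e1 + \<mu>) *
      (\<Sum>E\<in>{-(e1 + \<mu> + int r + 1)..int N - 1}. gbinom_int (\<alpha> + of_int \<mu>) (E + (e1 + \<mu> + int r + 1)) *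
        coeff_inf (rr (\<alpha> + \<beta> + of_int (\<nu> - E)) E) (e1 + e2 + \<nu> + 1)))"
    by (intro sum.cong refl arg_cong2[of _ _ _ _ "(*)"] iterate_modes[symmetric] assms(1,2))
  finally show ?thesis .
qed

end

section \<open>Residues of vertex operators\<close>

text \<open>Vandermonde for a product of two binomial series; the square of indices may be cut to
  the triangle \<open>s + t < U\<close>, outside which \<open>F\<close> vanishes.\<close>

lemma sum_gbinomial_product:
  fixes F :: "nat \<Rightarrow> complex"
  assumes "\<And>u. u \<ge> U \<Longrightarrow> F u = 0" "K \<ge> U" "K' \<ge> U"
  shows "(\<Sum>s<K. \<Sum>t<K'. (x gchoose s) * (y gchoose t) * F (s + t)) = (\<Sum>u<U. (x + y gchoose u) * F u)"
proof -
  have nz: "u < U" if "F u \<noteq> 0" for u using that assms(1)[of u] by (rule contrapos_np) simp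
  have "(\<Sum>s<K. \<Sum>t<K'. (x gchoose s) * (y gchoose t) * F (s + t)) =
      (\<Sum>(s,t)\<in>{..<K} \<times> {..<K'}. (x gchoose s) * (y gchoose t) * F (s + t))"
    by (rule sum.cartesian_product)
  also have "\<dots> = (\<Sum>(s,t)\<in>{(s,t). s + t < U}. (x gchoose s) * (y gchoose t) * F (s + t))"
  proof (rule sum.mono_neutral_right)
    show "\<forall>i\<in>{..<K} \<times> {..<K'} - {(s, t). s + t < U}. (case i of (s, t) \<Rightarrow> (x gchoose s) * (y gchoose t) * F (s + t)) = 0"
      using nz by auto
  qed (use assms in auto)
  also have "\<dots> = (\<Sum>u<U. \<Sum>s\<le>u. (x gchoose s) * (y gchoose (u - s)) * F (s + (u - s)))"
    by (rule sum.triangle_reindex)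
  also have "\<dots> = (\<Sum>u<U. (\<Sum>s\<in>{0..u}. (x gchoose s) * (y gchoose (u - s))) * F u)"
    by (simp add: atMost_atLeast0 sum_distrib_right)
  finally show ?thesis by (simp add: gbinomial_Vandermonde)
qed

lemma gchoose_eq_0: "s < i \<Longrightarrow> (of_int (int s) :: complex) gchoose i = 0"
  using gbinom_int_eq_0[of "int s" "int i"] by simp

context vertex_operator_algebra
begin

abbreviation "functional \<phi> \<equiv> Vector_Spaces.linear scale ((*) :: complex \<Rightarrow> complex \<Rightarrow> complex) \<phi>"

lemma functional_separates:
  assumes "subspace S" "v \<notin> S"
  obtains \<phi> where "functional \<phi>" "\<And>x. x \<in> S \<Longrightarrow> \<phi> x = 0" "\<phi> v \<noteq> 0"
proof -
  interpret vp: vector_space_pair "scale" "(*) :: complex \<Rightarrow> complex \<Rightarrow> complex"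
    by unfold_locales (auto simp: algebra_simps)
  obtain B where B: "B \<subseteq> S" "independent B" "S \<subseteq> span B"
    by (rule maximal_independent_subset[of S])
  have "span B \<subseteq> S" by (rule span_minimal[OF B(1) assms(1)])
  then have vB: "v \<notin> span B" using assms(2) by blast
  then have ins: "independent (insert v B)" using B(2) by (rule independent_insertI)
  have "v \<notin> B" using vB by (meson span_base)
  define \<phi> where "\<phi> = vp.construct (insert v B) (\<lambda>x. if x = v then 1 else 0)"
  have lin: "functional \<phi>" unfolding \<phi>_def by (rule vp.linear_construct[OF ins])
  interpret \<phi>: Vector_Spaces.linear "scale" "(*) :: complex \<Rightarrow> complex \<Rightarrow> complex" \<phi> by (rule lin)
  show ?thesis
  proof
    show "functional \<phi>" by (rule lin)
    show "\<phi> v \<noteq> 0" unfolding \<phi>_def by (subst vp.construct_basis[OF ins]) auto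
    fix x assume "x \<in> S"
    then have "x \<in> span B" using B(3) by blast
    then show "\<phi> x = 0"
    proof (rule \<phi>.eq_0_on_span[rotated])
      fix b assume "b \<in> B"
      then show "\<phi> b = 0" unfolding \<phi>_def
        by (subst vp.construct_basis[OF ins]) (use \<open>v \<notin> B\<close> in auto)
    qed
  qed
qed


lemmas module_hom_of_linear = Vector_Spaces.linear.axioms(3)

lemmas Y_add_left = module_hom.add[OF module_hom_of_linear[OF Y_linear_left]]
  and Y_scale_left = module_hom.scale[OF module_hom_of_linear[OF Y_linear_left]]
  and Y_zero_left [simp] = module_hom.zero[OF module_hom_of_linear[OF Y_linear_left]]
  and Y_add_right = module_hom.add[OF module_hom_of_linear[OF Y_linear_right]]
  and Y_scale_right = module_hom.scale[OF module_hom_of_linear[OF Y_linear_right]]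
  and Y_zero_right [simp] = module_hom.zero[OF module_hom_of_linear[OF Y_linear_right]]
  and Y_sum_right = module_hom.sum[OF module_hom_of_linear[OF Y_linear_right]]

lemma res_Y_superset:
  assumes "finite A" "\<And>e. e \<notin> A \<Longrightarrow> fls_nth f e = 0 \<or> Y u e v = 0"
  shows "res_Y f u v = (\<Sum>e\<in>A. scale (fls_nth f e) (Y u e v))"
  unfolding res_Y_def using assms by (intro Sum_any.expand_superset) auto

lemma res_Y_support:
  "\<exists>A. finite A \<and> (\<forall>e. e \<notin> A \<longrightarrow> fls_nth f e = 0 \<or> Y u e v = 0)"
proof -
  obtain K where "\<forall>e\<ge>K. Y u e v = 0" using truncation by blast
  moreover have "fls_nth f e = 0" if "e < fls_subdegree f" for e
    using that by (rule fls_eq0_below_subdegree)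
  ultimately show ?thesis by (intro exI[of _ "{fls_subdegree f..K}"]) (auto simp: not_less intro: leI ccontr)
qed

lemma res_Y_add_right: "res_Y f u (v + w) = res_Y f u v + res_Y f u w"
proof -
  obtain A where A: "finite A" "\<And>e. e \<notin> A \<Longrightarrow> fls_nth f e = 0 \<or> Y u e v = 0" using res_Y_support by blast
  obtain B where B: "finite B" "\<And>e. e \<notin> B \<Longrightarrow> fls_nth f e = 0 \<or> Y u e w = 0" using res_Y_support by blast
  have "res_Y f u x = (\<Sum>e\<in>A \<union> B. scale (fls_nth f e) (Y u e x))" if "x \<in> {v, w, v + w}" for x
    using that A(1) B(1) by (intro res_Y_superset) (auto dest!: A(2) B(2) simp: Y_add_right)
  then show ?thesis by (simp add: Y_add_right scale_right_distrib sum.distrib)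
qed

lemma res_Y_add_left: "res_Y f (u + w) v = res_Y f u v + res_Y f w v"
proof -
  obtain A where A: "finite A" "\<And>e. e \<notin> A \<Longrightarrow> fls_nth f e = 0 \<or> Y u e v = 0" using res_Y_support by blast
  obtain B where B: "finite B" "\<And>e. e \<notin> B \<Longrightarrow> fls_nth f e = 0 \<or> Y w e v = 0" using res_Y_support by blast
  have "res_Y f x v = (\<Sum>e\<in>A \<union> B. scale (fls_nth f e) (Y x e v))" if "x \<in> {u, w, u + w}" for x
    using that A(1) B(1) by (intro res_Y_superset) (auto dest!: A(2) B(2) simp: Y_add_left)
  then show ?thesis by (simp add: Y_add_left scale_right_distrib sum.distrib)
qed

lemma res_Y_scale_right: "res_Y f u (scale c v) = scale c (res_Y f u v)"
proof -
  obtain A where A: "finite A" "\<And>e. e \<notin> A \<Longrightarrow> fls_nth f e = 0 \<or> Y u e v = 0" using res_Y_support by blast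
  have "res_Y f u x = (\<Sum>e\<in>A. scale (fls_nth f e) (Y u e x))" if "x \<in> {v, scale c v}" for x
    using that A(1) by (intro res_Y_superset) (auto dest!: A(2) simp: Y_scale_right)
  then show ?thesis by (simp add: Y_scale_right scale_sum_right mult.commute)
qed

lemma res_Y_scale_left: "res_Y f (scale c u) v = scale c (res_Y f u v)"
proof -
  obtain A where A: "finite A" "\<And>e. e \<notin> A \<Longrightarrow> fls_nth f e = 0 \<or> Y u e v = 0" using res_Y_support by blast
  have "res_Y f x v = (\<Sum>e\<in>A. scale (fls_nth f e) (Y x e v))" if "x \<in> {u, scale c u}" for x
    using that A(1) by (intro res_Y_superset) (auto dest!: A(2) simp: Y_scale_left)
  then show ?thesis by (simp add: Y_scale_left scale_sum_right mult.commute)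
qed

lemma res_Y_linear_right: "Vector_Spaces.linear scale scale (res_Y f u)"
  by unfold_locales (simp_all add: res_Y_add_right res_Y_scale_right)

lemma res_Y_linear_left: "Vector_Spaces.linear scale scale (\<lambda>u. res_Y f u v)"
  by unfold_locales (simp_all add: res_Y_add_left res_Y_scale_left)

lemmas res_Y_zero_right [simp] = module_hom.zero[OF module_hom_of_linear[OF res_Y_linear_right]]
  and res_Y_sum_right = module_hom.sum[OF module_hom_of_linear[OF res_Y_linear_right]]
  and res_Y_zero_left [simp] = module_hom.zero[OF module_hom_of_linear[OF res_Y_linear_left]]

lemma res_Y_fls_add: "res_Y (f + g) u v = res_Y f u v + res_Y g u v"
proof -
  obtain A where A: "finite A" "\<And>e. e \<notin> A \<Longrightarrow> fls_nth f e = 0 \<or> Y u e v = 0" using res_Y_support by blast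
  obtain B where B: "finite B" "\<And>e. e \<notin> B \<Longrightarrow> fls_nth g e = 0 \<or> Y u e v = 0" using res_Y_support by blast
  have "res_Y x u v = (\<Sum>e\<in>A \<union> B. scale (fls_nth x e) (Y u e v))" if "x \<in> {f, g, f + g}" for x
    using that A(1) B(1) by (intro res_Y_superset) (auto dest!: A(2) B(2))
  then show ?thesis by (simp add: scale_left_distrib sum.distrib)
qed

lemma binom_quot_nth: "fls_nth (binom_quot \<gamma> k) e = gbinom_int \<gamma> (e + k)"
  by (simp only: binom_quot_def fls_X_intpow_times_conv_shift) (simp add: gbinom_int_def)

lemma binom_quot_pascal: "binom_quot (\<gamma> + 1) k = binom_quot \<gamma> k + binom_quot \<gamma> (k - 1)"
  by (rule fls_eqI) (simp add: binom_quot_nth gbinom_int_pascal add_diff_eq)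

lemma res_Y_pascal:
  "res_Y (binom_quot (\<gamma> + 1) k) u v = res_Y (binom_quot \<gamma> k) u v + res_Y (binom_quot \<gamma> (k - 1)) u v"
  by (simp add: binom_quot_pascal res_Y_fls_add)

lemma res_Y_range:
  assumes "\<And>E. E \<ge> N \<Longrightarrow> Y u E v = 0"
  shows "res_Y (binom_quot \<gamma> k) u v = (\<Sum>E\<in>{-k..N - 1}. scale (gbinom_int \<gamma> (E + k)) (Y u E v))"
proof -
  have "E < N" if "Y u E v \<noteq> 0" for E using that assms[of E] by (rule contrapos_np) simp
  moreover have "- k \<le> E" if "gbinom_int \<gamma> (E + k) \<noteq> 0" for E using that by (auto simp: gbinom_int_def split: if_splits)
  ultimately show ?thesis
    by (subst res_Y_superset[of "{-k..N - 1}"]) (auto simp: binom_quot_nth zle_diff1_eq)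
qed

lemma res_Y_nat:
  assumes "\<And>E. E \<ge> int S - k \<Longrightarrow> Y u E v = 0"
  shows "res_Y (binom_quot \<gamma> k) u v = (\<Sum>s<S. scale (\<gamma> gchoose s) (Y u (int s - k) v))"
proof -
  have "res_Y (binom_quot \<gamma> k) u v = (\<Sum>E\<in>{-k..int S - k - 1}. scale (gbinom_int \<gamma> (E + k)) (Y u E v))"
    by (rule res_Y_range) (rule assms)
  also have "\<dots> = (\<Sum>s<S. scale (\<gamma> gchoose s) (Y u (int s - k) v))"
    by (rule sum.reindex_bij_witness[of _ "\<lambda>s. int s - k" "\<lambda>E. nat (E + k)"]) (auto simp: gbinom_int_def)
  finally show ?thesis .
qed

lemma res_Y_eq_0: "(\<And>E. E \<ge> - k \<Longrightarrow> Y u E v = 0) \<Longrightarrow> res_Y (binom_quot \<gamma> k) u v = 0"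
  using res_Y_nat[of 0 k u v \<gamma>] by simp

text \<open>Stated for all large \<open>S\<close>, so that finitely many double residues can be
  written over one common square of indices.\<close>

lemma res_Y_res_Y_nat:
  "\<exists>S0. \<forall>S\<ge>S0. res_Y (binom_quot \<gamma> k) a (res_Y (binom_quot \<gamma>' k') b c) =
    (\<Sum>s<S. \<Sum>t<S. scale ((\<gamma> gchoose s) * (\<gamma>' gchoose t)) (Y a (int s - k) (Y b (int t - k') c)))"
proof -
  obtain B where B: "\<And>E. E \<ge> B \<Longrightarrow> Y b E c = 0" using truncation by blast
  define T where "T = nat (B + k')"
  have "\<exists>A. \<forall>E\<ge>A. Y a E (Y b (int t - k') c) = 0" for t using truncation by blast
  then obtain A where A: "\<And>t E. E \<ge> A t \<Longrightarrow> Y a E (Y b (int t - k') c) = 0" by metis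
  show ?thesis
  proof (intro exI allI impI)
    fix S assume S: "S \<ge> max T (Max (insert 0 ((\<lambda>t. nat (A t + k)) ` {..<T})))"
    have ST: "S \<ge> T" using S by simp
    have b: "Y b (int t - k') c = 0" if "t \<ge> T" for t using that by (intro B) (simp add: T_def)
    have a: "Y a E (Y b (int t - k') c) = 0" if "E \<ge> int S - k" for t E
    proof (cases "t < T")
      case True
      then have "nat (A t + k) \<le> Max (insert 0 ((\<lambda>t. nat (A t + k)) ` {..<T}))" by (intro Max_ge) auto
      then have "nat (A t + k) \<le> S" using S by linarith
      then show ?thesis using that by (intro A) simp
    qed (simp add: b)
    have "res_Y (binom_quot \<gamma>' k') b c = (\<Sum>t<S. scale (\<gamma>' gchoose t) (Y b (int t - k') c))"
      by (rule res_Y_nat) (use ST in \<open>auto simp: T_def intro!: B\<close>)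
    then have "res_Y (binom_quot \<gamma> k) a (res_Y (binom_quot \<gamma>' k') b c) =
        (\<Sum>t<S. scale (\<gamma>' gchoose t) (res_Y (binom_quot \<gamma> k) a (Y b (int t - k') c)))"
      by (simp add: res_Y_sum_right res_Y_scale_right)
    also have "\<dots> = (\<Sum>t<S. scale (\<gamma>' gchoose t) (\<Sum>s<S. scale (\<gamma> gchoose s) (Y a (int s - k) (Y b (int t - k') c))))"
      by (intro sum.cong refl arg_cong[of _ _ "scale _"] res_Y_nat a)
    also have "\<dots> = (\<Sum>s<S. \<Sum>t<S. scale ((\<gamma> gchoose s) * (\<gamma>' gchoose t)) (Y a (int s - k) (Y b (int t - k') c)))"
      unfolding scale_sum_right by (subst sum.swap) (simp add: mult.commute)
    finally show "res_Y (binom_quot \<gamma> k) a (res_Y (binom_quot \<gamma>' k') b c) = \<dots>" .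
  qed
qed


section \<open>Locality and iterates from the Jacobi identity\<close>

text \<open>The Jacobi identity at \<open>l = int N\<close>: its iterate side only involves the
  vanishing modes \<open>Y a (int N + int i) b\<close>, and on the other side the binomial
  coefficients stop at \<open>N\<close>.\<close>

lemma jacobi_locality:
  assumes N: "\<And>E. E \<ge> int N \<Longrightarrow> Y a E b = 0"
  shows "(\<Sum>t\<le>N. scale ((-1) ^ t * (of_nat N gchoose t)) (Y a (m + int N - int t) (Y b (n + int t) c))) =
    (\<Sum>t\<le>N. scale ((-1) ^ N * ((-1) ^ t * (of_nat N gchoose t))) (Y b (n + int N - int t) (Y a (m + int t) c)))"
proof -
  let ?F = "\<lambda>i::nat. scale ((-1) ^ i * (of_int (int N) gchoose i))
      (Y a (m + int N - int i) (Y b (n + int i) c) - scale ((-1) powi int N) (Y b (n + int N - int i) (Y a (m + int i) c)))"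
  have "Sum_any ?F = Sum_any (\<lambda>i::nat. scale (of_int m gchoose i) (Y (Y a (int N + int i) b) (m + n - int i) c))"
    by (rule jacobi[symmetric])
  also have "\<dots> = 0" by (simp add: N)
  finally have "Sum_any ?F = 0" .
  moreover have "Sum_any ?F = sum ?F {..N}"
  proof (rule Sum_any.expand_superset)
    have "?F i = 0" if "i \<notin> {..N}" for i using that gchoose_eq_0[of N i] by simp
    then show "{i. ?F i \<noteq> 0} \<subseteq> {..N}" by blast
  qed simp
  ultimately show ?thesis
    by (simp add: scale_right_diff_distrib sum_subtractf mult.commute)
qed

lemma jacobi_nat:
  assumes K: "\<And>E. E \<ge> l + int K \<Longrightarrow> Y a E b = 0"
    and A: "\<And>E. E \<ge> m + int S \<Longrightarrow> Y a E c = 0" and B: "\<And>E. E \<ge> n + int S \<Longrightarrow> Y b E c = 0"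
  shows "(\<Sum>i<K. scale (of_int m gchoose i) (Y (Y a (l + int i) b) (m + n - int i) c)) =
    (\<Sum>i<S. scale ((-1) ^ i * (of_int l gchoose i))
      (Y a (m + l - int i) (Y b (n + int i) c) - scale ((-1) powi l) (Y b (n + l - int i) (Y a (m + int i) c))))"
proof -
  have K': "i < K" if "Y a (l + int i) b \<noteq> 0" for i using that K[of "l + int i"] by (rule contrapos_np) simp
  have A': "i < S" if "Y a (m + int i) c \<noteq> 0" for i using that A[of "m + int i"] by (rule contrapos_np) simp
  have B': "i < S" if "Y b (n + int i) c \<noteq> 0" for i using that B[of "n + int i"] by (rule contrapos_np) simp
  have "(\<Sum>i<K. scale (of_int m gchoose i) (Y (Y a (l + int i) b) (m + n - int i) c)) =
      Sum_any (\<lambda>i::nat. scale (of_int m gchoose i) (Y (Y a (l + int i) b) (m + n - int i) c))"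
  proof (rule Sum_any.expand_superset[symmetric])
    show "{i. scale (of_int m gchoose i) (Y (Y a (l + int i) b) (m + n - int i) c) \<noteq> 0} \<subseteq> {..<K}"
    proof
      fix i assume "i \<in> {i. scale (of_int m gchoose i) (Y (Y a (l + int i) b) (m + n - int i) c) \<noteq> 0}"
      then have "Y a (l + int i) b \<noteq> 0" by auto
      then show "i \<in> {..<K}" using K' by simp
    qed
  qed simp
  also have "\<dots> = Sum_any (\<lambda>i::nat. scale ((-1) ^ i * (of_int l gchoose i))
      (Y a (m + l - int i) (Y b (n + int i) c) - scale ((-1) powi l) (Y b (n + l - int i) (Y a (m + int i) c))))"
    by (rule jacobi)
  also have "\<dots> = (\<Sum>i<S. scale ((-1) ^ i * (of_int l gchoose i))
      (Y a (m + l - int i) (Y b (n + int i) c) - scale ((-1) powi l) (Y b (n + l - int i) (Y a (m + int i) c))))"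
  proof (rule Sum_any.expand_superset)
    show "{i. scale ((-1) ^ i * (of_int l gchoose i)) (Y a (m + l - int i) (Y b (n + int i) c) -
        scale ((-1) powi l) (Y b (n + l - int i) (Y a (m + int i) c))) \<noteq> 0} \<subseteq> {..<S}"
    proof
      fix i assume "i \<in> {i. scale ((-1) ^ i * (of_int l gchoose i)) (Y a (m + l - int i) (Y b (n + int i) c) -
        scale ((-1) powi l) (Y b (n + l - int i) (Y a (m + int i) c))) \<noteq> 0}"
      then have "Y b (n + int i) c \<noteq> 0 \<or> Y a (m + int i) c \<noteq> 0" by auto
      then show "i \<in> {..<S}" using A' B' by auto
    qed
  qed simp
  finally show ?thesis .
qed

text \<open>The weights from \<open>(1 + x1)^\<alpha> (1 + x2)^\<beta>\<close> do not involve the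
  index of \<open>(x1 - x2)^N\<close>; after interchanging sums, \<open>jacobi_locality\<close>
  applies to each pair \<open>s\<close>, \<open>s'\<close>.\<close>

lemma three_point_locality:
  assumes \<phi>: "functional \<phi>" and N: "\<And>E. E \<ge> int N \<Longrightarrow> Y a E b = 0"
  shows "times_diff_power N (\<lambda>i j. \<phi> (res_Y (binom_quot \<alpha> (i + 1)) a (res_Y (binom_quot \<beta> (j + 1)) b c))) i j =
    (-1) ^ N * times_diff_power N (\<lambda>j i. \<phi> (res_Y (binom_quot \<beta> (j + 1)) b (res_Y (binom_quot \<alpha> (i + 1)) a c))) j i"
    (is "times_diff_power N ?p i j = (-1) ^ N * times_diff_power N ?q j i")
proof -
  interpret \<phi>: Vector_Spaces.linear scale "(*) :: complex \<Rightarrow> complex \<Rightarrow> complex" \<phi> by (rule \<phi>)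
  have "\<forall>t. \<exists>S0. \<forall>S\<ge>S0. res_Y (binom_quot \<alpha> (i - int N + int t + 1)) a (res_Y (binom_quot \<beta> (j - int t + 1)) b c) =
      (\<Sum>s<S. \<Sum>s'<S. scale ((\<alpha> gchoose s) * (\<beta> gchoose s'))
        (Y a (int s - (i - int N + int t + 1)) (Y b (int s' - (j - int t + 1)) c)))"
    using res_Y_res_Y_nat by blast
  from choice[OF this] obtain P where P: "\<forall>t. \<forall>S\<ge>P t.
      res_Y (binom_quot \<alpha> (i - int N + int t + 1)) a (res_Y (binom_quot \<beta> (j - int t + 1)) b c) =
      (\<Sum>s<S. \<Sum>s'<S. scale ((\<alpha> gchoose s) * (\<beta> gchoose s'))
        (Y a (int s - (i - int N + int t + 1)) (Y b (int s' - (j - int t + 1)) c)))"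
    ..
  have "\<forall>t. \<exists>S0. \<forall>S\<ge>S0. res_Y (binom_quot \<beta> (j - int N + int t + 1)) b (res_Y (binom_quot \<alpha> (i - int t + 1)) a c) =
      (\<Sum>s'<S. \<Sum>s<S. scale ((\<beta> gchoose s') * (\<alpha> gchoose s))
        (Y b (int s' - (j - int N + int t + 1)) (Y a (int s - (i - int t + 1)) c)))"
    using res_Y_res_Y_nat by blast
  from choice[OF this] obtain Q where Q: "\<forall>t. \<forall>S\<ge>Q t.
      res_Y (binom_quot \<beta> (j - int N + int t + 1)) b (res_Y (binom_quot \<alpha> (i - int t + 1)) a c) =
      (\<Sum>s'<S. \<Sum>s<S. scale ((\<beta> gchoose s') * (\<alpha> gchoose s))
        (Y b (int s' - (j - int N + int t + 1)) (Y a (int s - (i - int t + 1)) c)))"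
    ..
  define S where "S = max (Max (P ` {..N})) (Max (Q ` {..N}))"
  have S: "S \<ge> P t" "S \<ge> Q t" if "t \<le> N" for t
  proof -
    have "P t \<le> Max (P ` {..N})" "Q t \<le> Max (Q ` {..N})" using that by auto
    then show "S \<ge> P t" "S \<ge> Q t" unfolding S_def by linarith+
  qed
  let ?w = "\<lambda>s s'. (\<alpha> gchoose s) * (\<beta> gchoose s')"
  let ?c = "\<lambda>t. (-1) ^ t * (of_nat N gchoose t) :: complex"
  let ?u = "\<lambda>s s' t. Y a ((int s - i - 1) + int N - int t) (Y b ((int s' - j - 1) + int t) c)"
  let ?v = "\<lambda>s s' t. Y b ((int s' - j - 1) + int N - int t) (Y a ((int s - i - 1) + int t) c)"
  have "times_diff_power N ?p i j = (\<Sum>t\<le>N. ?c t * \<phi> (\<Sum>s<S. \<Sum>s'<S. scale (?w s s') (?u s s' t)))"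
    unfolding times_diff_power_def
    by (intro sum.cong refl, subst P[rule_format, of _ S]) (auto simp: S algebra_simps)
  also have "\<dots> = (\<Sum>s<S. \<Sum>s'<S. ?w s s' * \<phi> (\<Sum>t\<le>N. scale (?c t) (?u s s' t)))"
    unfolding \<phi>.sum \<phi>.scale sum_distrib_left
    by (rule trans[OF sum.swap], rule sum.cong[OF refl], rule trans[OF sum.swap]) (simp add: mult_ac)
  also have "\<dots> = (\<Sum>s<S. \<Sum>s'<S. ?w s s' * \<phi> (\<Sum>t\<le>N. scale ((-1) ^ N * ?c t) (?v s s' t)))"
    by (simp only: jacobi_locality[OF N])
  also have "\<dots> = (-1) ^ N * (\<Sum>t\<le>N. ?c t * \<phi> (\<Sum>s<S. \<Sum>s'<S. scale (?w s s') (?v s s' t)))"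
    unfolding \<phi>.sum \<phi>.scale sum_distrib_left
    by (rule trans[OF _ sum.swap], rule sum.cong[OF refl], rule trans[OF _ sum.swap]) (simp add: mult_ac)
  also have "(\<Sum>t\<le>N. ?c t * \<phi> (\<Sum>s<S. \<Sum>s'<S. scale (?w s s') (?v s s' t))) = times_diff_power N ?q j i"
    unfolding times_diff_power_def
  proof (intro sum.cong refl)
    fix t assume "t \<in> {..N}"
    then have "res_Y (binom_quot \<beta> (j - int N + int t + 1)) b (res_Y (binom_quot \<alpha> (i - int t + 1)) a c) =
        (\<Sum>s<S. \<Sum>s'<S. scale (?w s s') (?v s s' t))"
      by (subst Q[rule_format, of _ S]) (auto simp: S algebra_simps intro: sum.swap)
    then show "?c t * \<phi> (\<Sum>s<S. \<Sum>s'<S. scale (?w s s') (?v s s' t)) =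
        (-1) ^ t * (of_nat N gchoose t) * ?q (j - int N + int t) (i - int t)"
      by simp
  qed
  finally show ?thesis .
qed


text \<open>A weighted sum over \<open>s\<close>, \<open>s'\<close> of Jacobi identities with upper
  arguments \<open>s\<close> and \<open>s' - n - 1\<close>. On the iterate side, trinomial revision
  turns the weights into the Taylor expansion of \<open>(1 + x2 + x0)^\<alpha>\<close> in
  \<open>x0\<close>, and Vandermonde merges the powers of \<open>1 + x2\<close>.\<close>

lemma three_point_iterate_sum:
  assumes \<phi>: "functional \<phi>"
    and K: "\<And>E. E \<ge> l + int K \<Longrightarrow> Y a E b = 0"
    and A: "\<And>E. E \<ge> int T \<Longrightarrow> Y a E c = 0" and B: "\<And>E. E \<ge> int T - n - 1 \<Longrightarrow> Y b E c = 0"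
  shows "(\<Sum>k<K. (\<alpha> gchoose k) * \<phi> (res_Y (binom_quot (\<alpha> + \<beta> - of_nat k) (n + 1)) (Y a (l + int k) b) c)) =
    (\<Sum>t<T. (-1) ^ t * (of_int l gchoose t) *
      (\<phi> (res_Y (binom_quot \<alpha> ((-1 - l + int t) + 1)) a (res_Y (binom_quot \<beta> ((n - int t) + 1)) b c)) -
       (-1) powi l * \<phi> (res_Y (binom_quot \<beta> ((n - l + int t) + 1)) b (res_Y (binom_quot \<alpha> ((-1 - int t) + 1)) a c))))"
proof -
  interpret \<phi>: Vector_Spaces.linear scale "(*) :: complex \<Rightarrow> complex \<Rightarrow> complex" \<phi> by (rule \<phi>)
  have "\<forall>t. \<exists>S0. \<forall>S\<ge>S0. res_Y (binom_quot \<alpha> ((-1 - l + int t) + 1)) a (res_Y (binom_quot \<beta> ((n - int t) + 1)) b c) =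
      (\<Sum>s<S. \<Sum>s'<S. scale ((\<alpha> gchoose s) * (\<beta> gchoose s'))
        (Y a (int s - ((-1 - l + int t) + 1)) (Y b (int s' - ((n - int t) + 1)) c)))"
    using res_Y_res_Y_nat by blast
  from choice[OF this] obtain P where P: "\<forall>t. \<forall>S\<ge>P t. res_Y (binom_quot \<alpha> ((-1 - l + int t) + 1)) a (res_Y (binom_quot \<beta> ((n - int t) + 1)) b c) =
      (\<Sum>s<S. \<Sum>s'<S. scale ((\<alpha> gchoose s) * (\<beta> gchoose s'))
        (Y a (int s - ((-1 - l + int t) + 1)) (Y b (int s' - ((n - int t) + 1)) c)))"
    ..
  have "\<forall>t. \<exists>S0. \<forall>S\<ge>S0. res_Y (binom_quot \<beta> ((n - l + int t) + 1)) b (res_Y (binom_quot \<alpha> ((-1 - int t) + 1)) a c) =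
      (\<Sum>s'<S. \<Sum>s<S. scale ((\<beta> gchoose s') * (\<alpha> gchoose s))
        (Y b (int s' - ((n - l + int t) + 1)) (Y a (int s - ((-1 - int t) + 1)) c)))"
    using res_Y_res_Y_nat by blast
  from choice[OF this] obtain Q where Q: "\<forall>t. \<forall>S\<ge>Q t. res_Y (binom_quot \<beta> ((n - l + int t) + 1)) b (res_Y (binom_quot \<alpha> ((-1 - int t) + 1)) a c) =
      (\<Sum>s'<S. \<Sum>s<S. scale ((\<beta> gchoose s') * (\<alpha> gchoose s))
        (Y b (int s' - ((n - l + int t) + 1)) (Y a (int s - ((-1 - int t) + 1)) c)))"
    ..
  have "\<forall>k. \<exists>U. \<forall>E\<ge>U. Y (Y a (l + int k) b) E c = 0" using truncation by blast
  from choice[OF this] obtain R where R: "\<forall>k. \<forall>E\<ge>R k. Y (Y a (l + int k) b) E c = 0" ..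
  define U where "U = Max (insert 0 ((\<lambda>k. nat (R k + n + 1)) ` {..<K}))"
  have U: "Y (Y a (l + int k) b) E c = 0" if "k < K" "E \<ge> int U - (n + 1)" for k E
  proof -
    have "nat (R k + n + 1) \<le> U" unfolding U_def using that(1) by (intro Max_ge) auto
    then have "R k \<le> E" using that(2) by linarith
    then show ?thesis using R by blast
  qed
  \<comment> \<open>After the substitution \<open>s \<mapsto> s + i\<close> only
    \<open>S - i\<close> values of \<open>s\<close> remain, and these must still reach
    \<open>U\<close> for every \<open>i < K\<close>; hence the bound \<open>U + K\<close>.\<close>
  define S where "S = max (U + K) (max (Max (insert 0 (P ` {..<T}))) (Max (insert 0 (Q ` {..<T}))))"
  have S: "S \<ge> P t" "S \<ge> Q t" if "t < T" for t
  proof -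
    have "P t \<le> Max (insert 0 (P ` {..<T}))" "Q t \<le> Max (insert 0 (Q ` {..<T}))" using that by (auto intro: Max_ge)
    then show "S \<ge> P t" "S \<ge> Q t" unfolding S_def by linarith+
  qed
  have SU: "S \<ge> U + K" by (simp add: S_def)
  let ?w = "\<lambda>s s'. (\<alpha> gchoose s) * (\<beta> gchoose s')"
  let ?c = "\<lambda>t. (-1) ^ t * (of_int l gchoose t) :: complex"
  let ?u = "\<lambda>s s' t. Y a (int s + l - int t) (Y b ((int s' - n - 1) + int t) c)"
  let ?v = "\<lambda>s s' t. Y b ((int s' - n - 1) + l - int t) (Y a (int s + int t) c)"
  have "(\<Sum>t<T. (-1) ^ t * (of_int l gchoose t) *
      (\<phi> (res_Y (binom_quot \<alpha> ((-1 - l + int t) + 1)) a (res_Y (binom_quot \<beta> ((n - int t) + 1)) b c)) -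
       (-1) powi l * \<phi> (res_Y (binom_quot \<beta> ((n - l + int t) + 1)) b (res_Y (binom_quot \<alpha> ((-1 - int t) + 1)) a c)))) =
    (\<Sum>t<T. ?c t * (\<phi> (\<Sum>s<S. \<Sum>s'<S. scale (?w s s') (?u s s' t)) - (-1) powi l * \<phi> (\<Sum>s<S. \<Sum>s'<S. scale (?w s s') (?v s s' t))))"
  proof (intro sum.cong refl arg_cong2[of _ _ _ _ "(*)"] arg_cong2[of _ _ _ _ "(-)"] arg_cong[of _ _ \<phi>])
    fix t assume t: "t \<in> {..<T}"
    show "res_Y (binom_quot \<alpha> ((-1 - l + int t) + 1)) a (res_Y (binom_quot \<beta> ((n - int t) + 1)) b c) =
        (\<Sum>s<S. \<Sum>s'<S. scale (?w s s') (?u s s' t))"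
      using t by (subst P[rule_format, of _ S]) (auto simp: S algebra_simps)
    show "res_Y (binom_quot \<beta> ((n - l + int t) + 1)) b (res_Y (binom_quot \<alpha> ((-1 - int t) + 1)) a c) =
        (\<Sum>s<S. \<Sum>s'<S. scale (?w s s') (?v s s' t))"
      using t by (subst Q[rule_format, of _ S]) (auto simp: S algebra_simps intro: sum.swap)
  qed
  also have "\<dots> = (\<Sum>t<T. \<Sum>s<S. \<Sum>s'<S. ?w s s' * \<phi> (scale (?c t) (?u s s' t - scale ((-1) powi l) (?v s s' t))))"
    unfolding \<phi>.sum \<phi>.scale \<phi>.diff by (simp add: sum_distrib_left sum_subtractf algebra_simps)
  also have "\<dots> = (\<Sum>s<S. \<Sum>s'<S. ?w s s' * \<phi> (\<Sum>t<T. scale (?c t) (?u s s' t - scale ((-1) powi l) (?v s s' t))))"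
    unfolding \<phi>.sum sum_distrib_left
    by (rule trans[OF sum.swap], rule sum.cong[OF refl], rule sum.swap)
  also have "\<dots> = (\<Sum>s<S. \<Sum>s'<S. ?w s s' * \<phi> (\<Sum>i<K. scale (of_int (int s) gchoose i) (Y (Y a (l + int i) b) (int s + (int s' - n - 1) - int i) c)))"
  proof (rule sum.cong[OF refl], rule sum.cong[OF refl])
    fix s s'
    have "(\<Sum>t<T. scale (?c t) (?u s s' t - scale ((-1) powi l) (?v s s' t))) =
        (\<Sum>i<K. scale (of_int (int s) gchoose i) (Y (Y a (l + int i) b) (int s + (int s' - n - 1) - int i) c))"
      by (rule jacobi_nat[symmetric]) (auto intro!: K A B)
    then show "?w s s' * \<phi> (\<Sum>t<T. scale (?c t) (?u s s' t - scale ((-1) powi l) (?v s s' t))) =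
        ?w s s' * \<phi> (\<Sum>i<K. scale (of_int (int s) gchoose i) (Y (Y a (l + int i) b) (int s + (int s' - n - 1) - int i) c))"
      by (rule arg_cong)
  qed
  also have "\<dots> = (\<Sum>i<K. \<Sum>s<S. \<Sum>s'<S. ?w s s' * ((of_nat s gchoose i) * \<phi> (Y (Y a (l + int i) b) (int s + (int s' - n - 1) - int i) c)))"
    unfolding \<phi>.sum \<phi>.scale sum_distrib_left of_int_of_nat_eq
    by (rule trans[OF _ sum.swap], rule sum.cong[OF refl], rule sum.swap)
  also have "\<dots> = (\<Sum>i<K. (\<alpha> gchoose i) * \<phi> (res_Y (binom_quot (\<alpha> + \<beta> - of_nat i) (n + 1)) (Y a (l + int i) b) c))"
  proof (rule sum.cong[OF refl])
    fix i assume "i \<in> {..<K}"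
    then have i: "i < K" by simp
    define F where "F u = \<phi> (Y (Y a (l + int i) b) (int u - (n + 1)) c)" for u
    have F: "F u = 0" if "u \<ge> U" for u using that i by (simp add: F_def U)
    have "(\<Sum>s<S. \<Sum>s'<S. ?w s s' * ((of_nat s gchoose i) * \<phi> (Y (Y a (l + int i) b) (int s + (int s' - n - 1) - int i) c))) =
        (\<Sum>s\<in>{i..<S}. \<Sum>s'<S. ?w s s' * ((of_nat s gchoose i) * \<phi> (Y (Y a (l + int i) b) (int s + (int s' - n - 1) - int i) c)))"
      using gchoose_eq_0[of _ i] by (intro sum.mono_neutral_right) auto
    also have "\<dots> = (\<Sum>s<S - i. \<Sum>s'<S. ?w (s + i) s' * ((of_nat (s + i) gchoose i) * F (s + s')))"
      unfolding F_def
      by (rule sum.reindex_bij_witness[of _ "\<lambda>s. s + i" "\<lambda>s. s - i"]) (auto simp: algebra_simps)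
    also have "\<dots> = (\<alpha> gchoose i) * (\<Sum>s<S - i. \<Sum>s'<S. (\<alpha> - of_nat i gchoose s) * (\<beta> gchoose s') * F (s + s'))"
    proof -
      have "(\<alpha> gchoose (s + i)) * (of_nat (s + i) gchoose i) = (\<alpha> gchoose i) * (\<alpha> - of_nat i gchoose s)" for s
        using gbinomial_trinomial_revision[of i "s + i" \<alpha>] by simp
      then have "?w (s + i) s' * ((of_nat (s + i) gchoose i) * x) = (\<alpha> gchoose i) * ((\<alpha> - of_nat i gchoose s) * (\<beta> gchoose s') * x)" for s s' x
        by (metis (no_types, lifting) mult.assoc mult.left_commute)
      then show ?thesis by (simp only: sum_distrib_left)
    qed
    also have "(\<Sum>s<S - i. \<Sum>s'<S. (\<alpha> - of_nat i gchoose s) * (\<beta> gchoose s') * F (s + s')) =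
        (\<Sum>u<U. (\<alpha> - of_nat i + \<beta> gchoose u) * F u)"
      by (rule sum_gbinomial_product) (use F SU i in auto)
    also have "\<dots> = \<phi> (res_Y (binom_quot (\<alpha> - of_nat i + \<beta>) (n + 1)) (Y a (l + int i) b) c)"
      by (subst res_Y_nat[of U]) (auto simp: F_def \<phi>.sum \<phi>.scale intro: U[OF i])
    also have "\<alpha> - of_nat i + \<beta> = \<alpha> + \<beta> - of_nat i" by simp
    finally show "(\<Sum>s<S. \<Sum>s'<S. ?w s s' * ((of_nat s gchoose i) * \<phi> (Y (Y a (l + int i) b) (int s + (int s' - n - 1) - int i) c))) =
        (\<alpha> gchoose i) * \<phi> (res_Y (binom_quot (\<alpha> + \<beta> - of_nat i) (n + 1)) (Y a (l + int i) b) c)" .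
  qed
  finally show ?thesis ..
qed

text \<open>The degree bounds are required for every \<open>w\<close>, as they are applied to
  \<open>w\<close> a residue of the other operator on \<open>c\<close>; locality and truncation
  supply the rest.\<close>

theorem three_point_iterateI:
  assumes \<phi>: "functional \<phi>"
    and d1: "\<And>i w. i > d1 \<Longrightarrow> \<phi> (res_Y (binom_quot \<alpha> (i + 1)) a w) = 0"
    and d2: "\<And>j w. j > d2 \<Longrightarrow> \<phi> (res_Y (binom_quot \<beta> (j + 1)) b w) = 0"
  shows "\<exists>N lo. (\<forall>E\<ge>int N. Y a E b = 0) \<and> three_point_iterate
    (\<lambda>i j. \<phi> (res_Y (binom_quot \<alpha> (i + 1)) a (res_Y (binom_quot \<beta> (j + 1)) b c)))
    (\<lambda>i j. \<phi> (res_Y (binom_quot \<beta> (j + 1)) b (res_Y (binom_quot \<alpha> (i + 1)) a c))) N d1 d2 lo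
    (\<lambda>\<gamma> E n. \<phi> (res_Y (binom_quot \<gamma> (n + 1)) (Y a E b) c)) \<alpha> \<beta>"
proof -
  interpret \<phi>: Vector_Spaces.linear scale "(*) :: complex \<Rightarrow> complex \<Rightarrow> complex" \<phi> by (rule \<phi>)
  obtain N0 A B where N0: "\<forall>E\<ge>N0. Y a E b = 0" and A: "\<forall>E\<ge>A. Y a E c = 0" and B: "\<forall>E\<ge>B. Y b E c = 0"
    using truncation by meson
  define N where "N = nat N0"
  have N: "Y a E b = 0" if "E \<ge> int N" for E
  proof -
    have "N0 \<le> E" using that unfolding N_def by linarith
    then show ?thesis using N0 by blast
  qed
  define lo where "lo = min (- A) (- B) - 1"
  have "three_point_iterate
    (\<lambda>i j. \<phi> (res_Y (binom_quot \<alpha> (i + 1)) a (res_Y (binom_quot \<beta> (j + 1)) b c)))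
    (\<lambda>i j. \<phi> (res_Y (binom_quot \<beta> (j + 1)) b (res_Y (binom_quot \<alpha> (i + 1)) a c))) N d1 d2 lo
    (\<lambda>\<gamma> E n. \<phi> (res_Y (binom_quot \<gamma> (n + 1)) (Y a E b) c)) \<alpha> \<beta>"
  proof
    fix i j :: int and \<gamma> E n l
    show "i > d1 \<Longrightarrow> \<phi> (res_Y (binom_quot \<alpha> (i + 1)) a (res_Y (binom_quot \<beta> (j + 1)) b c)) = 0" by (rule d1)
    show "j > d2 \<Longrightarrow> \<phi> (res_Y (binom_quot \<beta> (j + 1)) b (res_Y (binom_quot \<alpha> (i + 1)) a c)) = 0" by (rule d2)
    show "\<phi> (res_Y (binom_quot \<alpha> (i + 1)) a (res_Y (binom_quot \<beta> (j + 1)) b c)) = 0" if "j < lo"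
      using B that by (subst (2) res_Y_eq_0) (auto simp: lo_def)
    show "\<phi> (res_Y (binom_quot \<beta> (j + 1)) b (res_Y (binom_quot \<alpha> (i + 1)) a c)) = 0" if "i < lo"
      using A that by (subst (2) res_Y_eq_0) (auto simp: lo_def)
    show "times_diff_power N (\<lambda>i j. \<phi> (res_Y (binom_quot \<alpha> (i + 1)) a (res_Y (binom_quot \<beta> (j + 1)) b c))) i j =
      (-1) ^ N * times_diff_power N (\<lambda>j i. \<phi> (res_Y (binom_quot \<beta> (j + 1)) b (res_Y (binom_quot \<alpha> (i + 1)) a c))) j i"
      by (rule three_point_locality[OF \<phi> N])
    show "\<phi> (res_Y (binom_quot (\<gamma> + 1) (n + 1)) (Y a E b) c) =
        \<phi> (res_Y (binom_quot \<gamma> (n + 1)) (Y a E b) c) + \<phi> (res_Y (binom_quot \<gamma> (n - 1 + 1)) (Y a E b) c)"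
      by (simp add: res_Y_pascal \<phi>.add)
    show "E \<ge> int N \<Longrightarrow> \<phi> (res_Y (binom_quot \<gamma> (n + 1)) (Y a E b) c) = 0" by (simp add: N)
    show "\<exists>K0. \<forall>K\<ge>K0. (\<Sum>k<K. (\<alpha> gchoose k) * \<phi> (res_Y (binom_quot (\<alpha> + \<beta> - of_nat k) (n + 1)) (Y a (l + int k) b) c)) =
      (\<Sum>t<K. (-1) ^ t * (of_int l gchoose t) *
        (\<phi> (res_Y (binom_quot \<alpha> ((-1 - l + int t) + 1)) a (res_Y (binom_quot \<beta> ((n - int t) + 1)) b c)) -
         (-1) powi l * \<phi> (res_Y (binom_quot \<beta> ((n - l + int t) + 1)) b (res_Y (binom_quot \<alpha> ((-1 - int t) + 1)) a c))))"
    proof (intro exI allI impI three_point_iterate_sum[OF \<phi>])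
      fix K E assume K: "K \<ge> max (nat (int N - l)) (max (nat A) (nat (B + n + 1)))"
      show "E \<ge> l + int K \<Longrightarrow> Y a E b = 0" using K by (intro N) linarith
      have KA: "int K \<ge> A" "int K - n - 1 \<ge> B" using K by linarith+
      show "E \<ge> int K \<Longrightarrow> Y a E c = 0" using KA(1) by (intro A[rule_format]) linarith
      show "E \<ge> int K - n - 1 \<Longrightarrow> Y b E c = 0" using KA(2) by (intro B[rule_format]) linarith
    qed
  qed
  then show ?thesis using N by blast
qed

end

section \<open>The bigrading by weight and eigenspace\<close>

lemma decomposition_of_component:
  "is_direct_sum W \<Longrightarrow> decomposition_of W v f \<Longrightarrow> component W i v = f i"
  unfolding is_direct_sum_def component_def by (metis theI')

lemma component_decomposition:
  assumes "is_direct_sum W"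
  shows "decomposition_of W v (\<lambda>i. component W i v)"
proof -
  obtain f where f: "decomposition_of W v f" using assms unfolding is_direct_sum_def by blast
  then have "(\<lambda>i. component W i v) = f" using decomposition_of_component[OF assms f] by auto
  with f show ?thesis by simp
qed

lemma decomposition_of_single:
  assumes "x \<in> W i" "\<And>j. 0 \<in> W j"
  shows "decomposition_of W x (\<lambda>j. if j = i then x else 0)"
  unfolding decomposition_of_def using assms by (auto intro: finite_subset[of _ "{i}"])

context vertex_operator_algebra
begin

section \<open>Homogeneous components and weights of modes\<close>

lemma decomposition_of_add:
  assumes W: "\<And>i. subspace (W i)" and f: "decomposition_of W v f" and h: "decomposition_of W w h"
  shows "decomposition_of W (v + w) (\<lambda>i. f i + h i)"
proof -
  have "finite {i. f i + h i \<noteq> 0}"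
    by (rule finite_subset[of _ "{i. f i \<noteq> 0} \<union> {i. h i \<noteq> 0}"]) (use f h in \<open>auto simp: decomposition_of_def\<close>)
  then show ?thesis using assms by (auto simp: decomposition_of_def Sum_any.distrib subspace_add)
qed

lemma decomposition_of_scale:
  assumes W: "\<And>i. subspace (W i)" and f: "decomposition_of W v f"
  shows "decomposition_of W (scale c v) (\<lambda>i. scale c (f i))"
proof -
  have fin: "finite {i. f i \<noteq> 0}" using f by (simp add: decomposition_of_def)
  have "Sum_any (\<lambda>i. scale c (f i)) = (\<Sum>i\<in>{i. f i \<noteq> 0}. scale c (f i))"
    by (rule Sum_any.expand_superset[OF fin]) auto
  also have "\<dots> = scale c (\<Sum>i\<in>{i. f i \<noteq> 0}. f i)" by (simp add: scale_sum_right)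
  also have "(\<Sum>i\<in>{i. f i \<noteq> 0}. f i) = v" using f by (simp add: decomposition_of_def Sum_any.expand_set)
  finally show ?thesis
    using f fin unfolding decomposition_of_def
    by (auto simp: subspace_scale[OF W] intro: finite_subset[OF _ fin])
qed

text \<open>Converse of \<open>L0_grading\<close>. If \<open>f\<close> decomposes \<open>v\<close>,
  then the vectors \<open>(i - k) f i\<close> decompose \<open>0\<close>, so uniqueness leaves only
  the component at \<open>k\<close>.\<close>

lemma V_eigen:
  assumes "Y \<omega> 1 v = scale (of_int k) v"
  shows "v \<in> V k"
proof -
  have V0: "0 \<in> V i" for i by (rule subspace_0[OF grading_subspace])
  obtain f where f: "decomposition_of V v f" using grading_direct_sum unfolding is_direct_sum_def by blast
  have fin: "finite {i. f i \<noteq> 0}" and fV: "\<And>i. f i \<in> V i" and v: "v = (\<Sum>i\<in>{i. f i \<noteq> 0}. f i)"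
    using f by (auto simp: decomposition_of_def Sum_any.expand_set)
  have "Y \<omega> 1 v = (\<Sum>i\<in>{i. f i \<noteq> 0}. scale (of_int i) (f i))"
    by (subst v) (simp add: Y_sum_right L0_grading[OF fV])
  then have "(\<Sum>i\<in>{i. f i \<noteq> 0}. scale (of_int i - of_int k) (f i)) = 0"
    using assms v by (simp add: scale_left_diff_distrib sum_subtractf scale_sum_right[symmetric])
  moreover have "Sum_any (\<lambda>i. scale (of_int i - of_int k) (f i)) = (\<Sum>i\<in>{i. f i \<noteq> 0}. scale (of_int i - of_int k) (f i))"
    by (rule Sum_any.expand_superset[OF fin]) auto
  ultimately have "decomposition_of V 0 (\<lambda>i. scale (of_int i - of_int k) (f i))"
    using fV subspace_scale[OF grading_subspace] fin
    unfolding decomposition_of_def by (auto intro: finite_subset[OF _ fin])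
  moreover have "decomposition_of V 0 (\<lambda>i. 0)" by (simp add: decomposition_of_def V0)
  ultimately have "(\<lambda>i. scale (of_int i - of_int k) (f i)) = (\<lambda>i. 0)"
    using grading_direct_sum unfolding is_direct_sum_def by blast
  then have "f i = 0" if "i \<noteq> k" for i using that by (auto dest!: fun_cong[where x = i])
  then have "v = (\<Sum>i\<in>{k}. f i)" unfolding v by (intro sum.mono_neutral_left) auto
  then show ?thesis using fV by simp
qed

lemma commutator: "Y u m (Y v n w) - Y v n (Y u m w) =
    Sum_any (\<lambda>i::nat. scale (of_int m gchoose i) (Y (Y u (int i) v) (m + n - int i) w))"
proof -
  let ?F = "\<lambda>i::nat. scale ((-1) ^ i * (of_int 0 gchoose i)) (Y u (m + 0 - int i) (Y v (n + int i) w)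
           - scale ((-1) powi 0) (Y v (n + 0 - int i) (Y u (m + int i) w)))"
  have "Sum_any ?F = sum ?F {0}"
    by (rule Sum_any.expand_superset) (auto simp: gbinomial_0_left)
  then show ?thesis using jacobi[where m = m and l = 0 and n = n and u = u and v = v and w = w] by simp
qed

lemma L_minus1_commutator: "Y \<omega> 0 (Y v n w) - Y v n (Y \<omega> 0 w) = - scale (of_int n) (Y v (n - 1) w)"
proof -
  have "Sum_any (\<lambda>i::nat. scale (of_int 0 gchoose i) (Y (Y \<omega> (int i) v) (0 + n - int i) w)) =
      (\<Sum>i\<in>{0}. scale (of_int 0 gchoose i) (Y (Y \<omega> (int i) v) (0 + n - int i) w))"
    by (rule Sum_any.expand_superset) (auto simp: gbinomial_0_left)
  then show ?thesis using commutator[of \<omega> 0 v n w] by (simp add: L_minus1_derivative)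
qed

lemma L0_commutator:
  assumes "v \<in> V k"
  shows "Y \<omega> 1 (Y v n w) - Y v n (Y \<omega> 1 w) = scale (of_int (k - n - 1)) (Y v n w)"
proof -
  have "Sum_any (\<lambda>i::nat. scale (of_int 1 gchoose i) (Y (Y \<omega> (int i) v) (1 + n - int i) w)) =
      (\<Sum>i\<in>{0,1}. scale (of_int 1 gchoose i) (Y (Y \<omega> (int i) v) (1 + n - int i) w))"
  proof (rule Sum_any.expand_superset)
    show "{i. scale (of_int 1 gchoose i) (Y (Y \<omega> (int i) v) (1 + n - int i) w) \<noteq> 0} \<subseteq> {0, 1}"
    proof
      fix i assume "i \<in> {i. scale (of_int 1 gchoose i) (Y (Y \<omega> (int i) v) (1 + n - int i) w) \<noteq> 0}"
      then have "\<not> 1 < i" using gchoose_eq_0[of 1 i] by auto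
      then show "i \<in> {0, 1}" by auto
    qed
  qed simp
  also have "\<dots> = Y (Y \<omega> 0 v) (1 + n) w + Y (Y \<omega> 1 v) n w" by simp
  also have "\<dots> = scale (of_int (k - n - 1)) (Y v n w)"
    by (simp add: L_minus1_derivative L0_grading[OF assms] Y_scale_left scale_left_diff_distrib scale_left_distrib)
  finally show ?thesis using commutator[of \<omega> 1 v n w] by simp
qed

text \<open>The weight of a mode is not among the axioms; it comes from the commutator with
  \<open>L(0)\<close> and \<open>V_eigen\<close>.\<close>

lemma mode_weight: "a \<in> V wa \<Longrightarrow> b \<in> V wb \<Longrightarrow> Y a E b \<in> V (wa + wb - E - 1)"
  using L0_commutator[of a wa E b] L0_grading[of b wb]
  by (intro V_eigen) (simp add: Y_scale_right algebra_simps scale_left_diff_distrib scale_left_distrib)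

lemma L_minus1_weight: "u \<in> V k \<Longrightarrow> Y \<omega> 0 u \<in> V (k + 1)"
  using mode_weight[OF omega_degree, of u k 0] by (simp add: add.commute)

end

section \<open>Eigenspaces of the automorphism\<close>

locale voa_automorphism = vertex_operator_algebra scale V Y vac \<omega>
  for scale :: "complex \<Rightarrow> 'v::ab_group_add \<Rightarrow> 'v" and V :: "int \<Rightarrow> 'v set"
    and Y :: "'v \<Rightarrow> int \<Rightarrow> 'v \<Rightarrow> 'v" and vac \<omega> :: 'v +
  fixes g :: "'v \<Rightarrow> 'v" and T :: nat
  assumes g: "automorphism g" and T: "has_order g T"
begin

lemma T_pos: "T > 0" using T by (simp add: has_order_def)

sublocale g: Vector_Spaces.linear scale scale g
  using g by (simp add: automorphism_def)

lemma g_Y: "g (Y u n v) = Y (g u) n (g v)" and g_omega: "g \<omega> = \<omega>"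
  using g by (simp_all add: automorphism_def)

definition "\<zeta> = exp (- 2 * of_real pi * \<i> / of_nat T)"

lemma zeta_power: "\<zeta> ^ k = exp (- 2 * of_real pi * \<i> * of_nat k / of_nat T)"
  unfolding \<zeta>_def exp_of_nat_mult[symmetric] by (simp add: mult_ac)

lemma zeta_power_T: "\<zeta> ^ T = 1"
  using T_pos exp_two_pi_i by (simp add: zeta_power exp_minus mult_ac)

lemma zeta_power_neq_1:
  assumes "0 < k" "k < T"
  shows "\<zeta> ^ k \<noteq> 1"
proof
  assume "\<zeta> ^ k = 1"
  then obtain n :: int where "Im (- 2 * of_real pi * \<i> * of_nat k / of_nat T) = of_int (2 * n) * pi"
    unfolding zeta_power exp_eq_1 by blast
  then have "pi * (- real k) = pi * (of_int n * real T)"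
    using T_pos by (simp add: field_simps)
  then have "- real k = of_int n * real T" by (simp only: mult_cancel_left) simp
  then have "of_int (- int k) = (of_int (n * int T) :: real)" by simp
  then have "- int k = n * int T" by (simp only: of_int_eq_iff)
  then have "int T dvd int k" by (metis dvd_minus_iff dvd_triv_right)
  then show False using assms by (auto dest!: zdvd_imp_le)
qed

lemma zeta_power_mod: "\<zeta> ^ (k mod T) = \<zeta> ^ k"
proof -
  have "\<zeta> ^ k = \<zeta> ^ (T * (k div T) + k mod T)" by simp
  also have "\<dots> = \<zeta> ^ (k mod T)" unfolding power_add power_mult zeta_power_T by simp
  finally show ?thesis ..
qed

lemma sum_zeta_power:
  assumes "k < T"
  shows "(\<Sum>j<T. (\<zeta> ^ k) ^ j) = (if k = 0 then of_nat T else 0)"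
proof (cases "k = 0")
  case False
  have "(\<zeta> ^ k) ^ T = 1" by (simp add: power_mult[symmetric] mult.commute[of k] power_mult[of \<zeta> T] zeta_power_T)
  then show ?thesis using geometric_sum[of "\<zeta> ^ k" T] zeta_power_neq_1[of k] assms False by simp
qed simp

lemma eigenspace_iff: "v \<in> eigenspace g T r \<longleftrightarrow> g v = scale (\<zeta> ^ r) v"
  by (simp add: eigenspace_def \<zeta>_def)

definition bihom :: "int \<Rightarrow> nat \<Rightarrow> 'v \<Rightarrow> bool" where
  "bihom wt r v \<longleftrightarrow> r < T \<and> v \<in> V wt \<and> v \<in> eigenspace g T r"

lemma bihom_mode:
  assumes "bihom wa r a" "bihom wb s b"
  shows "bihom (wa + wb - E - 1) ((r + s) mod T) (Y a E b)"
  using assms mode_weight[of a wa b wb E] T_pos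
  by (auto simp: bihom_def eigenspace_iff g_Y Y_scale_left Y_scale_right zeta_power_mod power_add mult.commute)

lemma bihom_L_minus1: "bihom wt r u \<Longrightarrow> bihom (wt + 1) r (Y \<omega> 0 u)"
  using L_minus1_weight by (auto simp: bihom_def eigenspace_iff g_Y g_omega Y_scale_right)

text \<open>Fixing \<open>\<omega>\<close>, \<open>g\<close> commutes with
  \<open>L(0)\<close>.\<close>

lemma g_V: "v \<in> V k \<Longrightarrow> g v \<in> V k"
proof (rule V_eigen)
  assume "v \<in> V k"
  have "Y \<omega> 1 (g v) = g (Y \<omega> 1 v)" by (simp add: g_Y g_omega)
  then show "Y \<omega> 1 (g v) = scale (of_int k) (g v)" using L0_grading[OF \<open>v \<in> V k\<close>] by (simp add: g.scale)
qed

lemma bigrading_subspace: "subspace (bigrading g T x)"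
proof -
  have "subspace (eigenspace g T r)" for r
    by (auto simp: subspace_def eigenspace_iff g.add g.scale scale_right_distrib mult.commute)
  then show ?thesis
    by (cases x) (auto simp: bigrading_def subspace_inter grading_subspace)
qed

text \<open>The average over the cyclic group generated by \<open>g\<close> against a character;
  \<open>T - r\<close> stands for \<open>- r\<close>, since \<open>\<zeta>^T = 1\<close>.\<close>

definition proj :: "nat \<Rightarrow> 'v \<Rightarrow> 'v" where
  "proj r v = scale (1 / of_nat T) (\<Sum>j<T. scale (\<zeta> ^ ((T - r) * j)) ((g ^^ j) v))"

lemma gpow_linear: "Vector_Spaces.linear scale scale (g ^^ j)"
proof (induction j)
  case 0
  then show ?case by (simp add: linear_id[unfolded id_def] id_def)
next
  case (Suc j)
  interpret j: Vector_Spaces.linear scale scale "g ^^ j" by (rule Suc)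
  show ?case by unfold_locales (simp_all add: j.add g.add j.scale g.scale)
qed

lemma proj_sum: "proj r (\<Sum>i\<in>A. f i) = (\<Sum>i\<in>A. proj r (f i))"
proof -
  have "(g ^^ j) (\<Sum>i\<in>A. f i) = (\<Sum>i\<in>A. (g ^^ j) (f i))" for j
    by (rule module_hom.sum[OF module_hom_of_linear[OF gpow_linear]])
  then have "proj r (\<Sum>i\<in>A. f i) = (\<Sum>j<T. \<Sum>i\<in>A. scale (1 / of_nat T) (scale (\<zeta> ^ ((T - r) * j)) ((g ^^ j) (f i))))"
    unfolding proj_def by (simp only: scale_sum_right)
  also have "\<dots> = (\<Sum>i\<in>A. \<Sum>j<T. scale (1 / of_nat T) (scale (\<zeta> ^ ((T - r) * j)) ((g ^^ j) (f i))))"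
    by (rule sum.swap)
  finally show ?thesis by (simp only: proj_def scale_sum_right)
qed

lemma gpow_eigen: "v \<in> eigenspace g T s \<Longrightarrow> (g ^^ j) v = scale (\<zeta> ^ (s * j)) v"
  by (induction j) (auto simp: eigenspace_iff g.scale power_add mult_ac)

lemma proj_eigen:
  assumes "v \<in> eigenspace g T s" "r < T" "s < T"
  shows "proj r v = (if r = s then v else 0)"
proof -
  have z: "\<zeta> ^ ((T - r) * j) * \<zeta> ^ (s * j) = (\<zeta> ^ ((T - r + s) mod T)) ^ j" for j
    by (simp add: zeta_power_mod power_add[symmetric] power_mult[symmetric] algebra_simps)
  have "proj r v = scale (1 / of_nat T) (scale (\<Sum>j<T. (\<zeta> ^ ((T - r + s) mod T)) ^ j) v)"
    unfolding proj_def by (simp add: gpow_eigen[OF assms(1)] z[symmetric] scale_sum_left)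
  moreover have "(T - r + s) mod T = 0 \<longleftrightarrow> r = s"
  proof -
    have "(T - r + s) mod T = (if s < r then T - r + s else s - r)"
      using assms(2,3) by (auto simp: mod_if not_less)
    then show ?thesis using assms(2) by auto
  qed
  ultimately show ?thesis using T_pos by (simp add: sum_zeta_power)
qed

lemma gpow_V: "v \<in> V k \<Longrightarrow> (g ^^ j) v \<in> V k"
  by (induction j) (auto simp: g_V)

lemma proj_V: "v \<in> V k \<Longrightarrow> proj r v \<in> V k"
  unfolding proj_def by (intro subspace_scale subspace_sum grading_subspace gpow_V)

lemma proj_eigenspace:
  assumes "r < T"
  shows "proj r v \<in> eigenspace g T r"
proof -
  define F where "F j = scale (\<zeta> ^ ((T - r) * j)) ((g ^^ j) v)" for j
  have gF: "g (F j) = scale (\<zeta> ^ r) (F (Suc j))" for j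
  proof -
    have "\<zeta> ^ r * \<zeta> ^ ((T - r) * Suc j) = \<zeta> ^ T * \<zeta> ^ ((T - r) * j)"
      using assms by (simp add: power_add[symmetric])
    then show ?thesis by (simp add: F_def g.scale zeta_power_T)
  qed
  have "g ^^ T = id" using T by (simp add: has_order_def)
  moreover have "\<zeta> ^ ((T - r) * T) = 1" by (simp add: mult.commute[of _ T] power_mult zeta_power_T)
  ultimately have FT: "F T = F 0" by (simp add: F_def)
  have "g (\<Sum>j<T. F j) = scale (\<zeta> ^ r) (\<Sum>j<T. F (Suc j))"
    by (simp add: g.sum gF scale_sum_right)
  also have "(\<Sum>j<T. F (Suc j)) = (\<Sum>j<T. F j)"
    using sum.lessThan_Suc_shift[of F T] FT by (simp add: add.commute)
  finally have "g (\<Sum>j<T. F j) = scale (\<zeta> ^ r) (\<Sum>j<T. F j)" .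
  moreover have "proj r v = scale (1 / of_nat T) (\<Sum>j<T. F j)" by (simp add: proj_def F_def)
  ultimately show ?thesis by (simp add: eigenspace_iff g.scale mult.commute)
qed

lemma sum_proj: "(\<Sum>r<T. proj r v) = v"
proof -
  have inner: "(\<Sum>r<T. \<zeta> ^ ((T - r) * j)) = (if j = 0 then of_nat T else 0)" if "j < T" for j
  proof -
    have "(\<Sum>r<T. \<zeta> ^ ((T - r) * j)) = (\<Sum>r<T. (\<zeta> ^ j) ^ Suc r)"
      by (rule sum.reindex_bij_witness[of _ "\<lambda>r. T - Suc r" "\<lambda>r. T - Suc r"])
        (auto simp: power_mult[symmetric] mult.commute[of j] Suc_diff_Suc simp del: power_Suc)
    also have "\<dots> = \<zeta> ^ j * (\<Sum>r<T. (\<zeta> ^ j) ^ r)" by (simp add: sum_distrib_left)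
    finally show ?thesis using sum_zeta_power[OF that] by simp
  qed
  have "(\<Sum>r<T. proj r v) = scale (1 / of_nat T) (\<Sum>j<T. scale (\<Sum>r<T. \<zeta> ^ ((T - r) * j)) ((g ^^ j) v))"
    unfolding proj_def scale_sum_right[symmetric] scale_sum_left by (subst sum.swap) (rule refl)
  also have "(\<Sum>j<T. scale (\<Sum>r<T. \<zeta> ^ ((T - r) * j)) ((g ^^ j) v)) = (\<Sum>j<T. if j = 0 then scale (of_nat T) v else 0)"
    by (intro sum.cong refl) (auto simp: inner)
  finally show ?thesis using T_pos by simp
qed


lemma proj_zero [simp]: "proj r 0 = 0"
  using proj_sum[of r "\<lambda>_. 0" "{}"] by simp

lemma bigrading_0: "0 \<in> bigrading g T x"
  by (rule subspace_0[OF bigrading_subspace])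

lemma bigrading_decomposition:
  "decomposition_of (bigrading g T) v (\<lambda>(k, r). if r < T then proj r (component V k v) else 0)"
proof -
  let ?f = "\<lambda>(k, r). if r < T then proj r (component V k v) else 0"
  have d: "decomposition_of V v (\<lambda>k. component V k v)"
    by (rule component_decomposition[OF grading_direct_sum])
  define K where "K = {k. component V k v \<noteq> 0}"
  have K: "finite K" "v = (\<Sum>k\<in>K. component V k v)" "\<And>k. component V k v \<in> V k"
    using d by (auto simp: decomposition_of_def K_def Sum_any.expand_set)
  have sub: "{x. ?f x \<noteq> 0} \<subseteq> K \<times> {..<T}" by (auto simp: K_def split: if_splits)
  have fin: "finite (K \<times> {..<T})" using K(1) by simp
  have "Sum_any ?f = sum ?f (K \<times> {..<T})" by (rule Sum_any.expand_superset[OF fin sub])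
  also have "\<dots> = (\<Sum>k\<in>K. \<Sum>r<T. proj r (component V k v))"
    unfolding sum.cartesian_product by (intro sum.cong) auto
  also have "\<dots> = v" by (simp add: sum_proj K(2)[symmetric])
  finally have "v = Sum_any ?f" ..
  moreover have "?f x \<in> bigrading g T x" for x
    using K(3) by (cases x) (auto simp: bigrading_def proj_V proj_eigenspace)
  ultimately show ?thesis unfolding decomposition_of_def using finite_subset[OF sub fin] by blast
qed

text \<open>Summing over \<open>r\<close> gives a decomposition by weight, which is unique;
  \<open>proj r\<close> then isolates the eigenspace part.\<close>

lemma bigrading_unique:
  assumes f: "decomposition_of (bigrading g T) v f"
  shows "f = (\<lambda>(k, r). if r < T then proj r (component V k v) else 0)"
proof -
  define K where "K = fst ` {x. f x \<noteq> 0}"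
  have fin: "finite {x. f x \<noteq> 0}" and fW: "\<And>x. f x \<in> bigrading g T x" and v: "v = Sum_any f"
    using f by (auto simp: decomposition_of_def)
  have K: "finite K" using fin by (simp add: K_def)
  have f0: "f (k, r) = 0" if "\<not> r < T" for k r using fW[of "(k, r)"] that by (simp add: bigrading_def)
  have fV: "f (k, r) \<in> V k" "f (k, r) \<in> eigenspace g T r" if "r < T" for k r
    using fW[of "(k, r)"] that by (auto simp: bigrading_def)
  have sub: "{x. f x \<noteq> 0} \<subseteq> K \<times> {..<T}"
    using f0 by (force simp: K_def image_iff)
  define h where "h k = (\<Sum>r<T. f (k, r))" for k
  have hsub: "{k. h k \<noteq> 0} \<subseteq> K"
  proof
    fix k assume "k \<in> {k. h k \<noteq> 0}"
    then obtain r where "f (k, r) \<noteq> 0" by (auto simp: h_def elim: sum.not_neutral_contains_not_neutral)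
    then show "k \<in> K" unfolding K_def by force
  qed
  have "v = sum f (K \<times> {..<T})" unfolding v by (rule Sum_any.expand_superset) (use K sub in auto)
  also have "\<dots> = (\<Sum>k\<in>K. h k)" unfolding h_def sum.cartesian_product by (intro sum.cong) auto
  also have "\<dots> = Sum_any h" by (rule Sum_any.expand_superset[symmetric]) (use K hsub in auto)
  finally have "decomposition_of V v h"
    unfolding decomposition_of_def h_def
    using fV finite_subset[OF hsub K] by (auto simp: h_def intro!: subspace_sum[OF grading_subspace])
  then have comp: "component V k v = h k" for k
    by (rule decomposition_of_component[OF grading_direct_sum])
  show ?thesis
  proof
    fix x :: "int \<times> nat"
    obtain k r where x: "x = (k, r)" by (cases x)
    have "proj r (h k) = f (k, r)" if "r < T"
    proof -
      have "proj r (h k) = (\<Sum>s<T. if r = s then f (k, s) else 0)"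
        unfolding h_def proj_sum using that fV by (intro sum.cong refl proj_eigen) auto
      then show ?thesis using that by simp
    qed
    then show "f x = (case x of (k, r) \<Rightarrow> if r < T then proj r (component V k v) else 0)"
      using f0 by (simp add: x comp)
  qed
qed

lemma bigrading_direct_sum: "is_direct_sum (bigrading g T)"
  unfolding is_direct_sum_def using bigrading_decomposition bigrading_unique by blast

section \<open>Linear extension from bihomogeneous vectors\<close>

abbreviation "bcomp x u \<equiv> component (bigrading g T) x u"

lemma bcomp_add: "bcomp x (u + w) = bcomp x u + bcomp x w"
  by (rule decomposition_of_component[OF bigrading_direct_sum])
    (intro decomposition_of_add bigrading_subspace component_decomposition bigrading_direct_sum)

lemma bcomp_scale: "bcomp x (scale c u) = scale c (bcomp x u)"
  by (rule decomposition_of_component[OF bigrading_direct_sum])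
    (intro decomposition_of_scale bigrading_subspace component_decomposition bigrading_direct_sum)

lemma bcomp_finite: "finite {x. bcomp x u \<noteq> 0}" and bcomp_mem: "bcomp x u \<in> bigrading g T x"
  and bcomp_sum: "u = (\<Sum>x\<in>{x. bcomp x u \<noteq> 0}. bcomp x u)"
  using component_decomposition[OF bigrading_direct_sum, of u]
  by (auto simp: decomposition_of_def Sum_any.expand_set simp del: split_paired_All)

lemma bcomp_bihom:
  assumes "bihom wt r u"
  shows "bcomp x u = (if x = (wt, r) then u else 0)"
  by (rule decomposition_of_component[OF bigrading_direct_sum])
    (rule decomposition_of_single, use assms bigrading_0 in \<open>auto simp: bihom_def bigrading_def\<close>)

lemma linear_ext_eq_sum:
  assumes "\<And>k r. F k r 0 = 0" "finite A" "{x. bcomp x u \<noteq> 0} \<subseteq> A"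
  shows "linear_ext g T F u = (\<Sum>(k, r)\<in>A. F k r (bcomp (k, r) u))"
  unfolding linear_ext_def
  by (rule Sum_any.expand_superset) (use assms in auto)

lemma linear_ext_bihom:
  assumes "\<And>k r. F k r 0 = 0" "bihom wt r u"
  shows "linear_ext g T F u = F wt r u"
  by (subst linear_ext_eq_sum[of _ "{(wt, r)}"]) (auto simp: assms bcomp_bihom[OF assms(2)])

lemma linear_ext_linear:
  assumes "\<And>k r. Vector_Spaces.linear scale scale (F k r)"
  shows "Vector_Spaces.linear scale scale (linear_ext g T F)"
proof
  have F0: "F k r 0 = 0" for k r by (rule module_hom.zero[OF module_hom_of_linear[OF assms]])
  have Fadd: "F k r (u + w) = F k r u + F k r w" for k r u w
    by (rule module_hom.add[OF module_hom_of_linear[OF assms]])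
  have Fscale: "F k r (scale c u) = scale c (F k r u)" for k r c u
    by (rule module_hom.scale[OF module_hom_of_linear[OF assms]])
  fix u w c
  let ?A = "{x. bcomp x u \<noteq> 0} \<union> {x. bcomp x w \<noteq> 0}"
  have A: "finite ?A" by (simp add: bcomp_finite)
  have "linear_ext g T F z = (\<Sum>(k, r)\<in>?A. F k r (bcomp (k, r) z))" if "z \<in> {u, w, u + w, scale c u}" for z
    using that by (intro linear_ext_eq_sum F0 A) (auto simp: bcomp_add bcomp_scale)
  then show "linear_ext g T F (u + w) = linear_ext g T F u + linear_ext g T F w"
    and "linear_ext g T F (scale c u) = scale c (linear_ext g T F u)"
    by (simp_all add: bcomp_add bcomp_scale Fadd Fscale sum.distrib scale_sum_right case_prod_unfold)
qed

lemma bihom_induct: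
  assumes "subspace {u. P u}" "\<And>wt r u. bihom wt r u \<Longrightarrow> P u"
  shows "P u"
proof -
  have "P (bcomp x u)" if "bcomp x u \<noteq> 0" for x
    using that bcomp_mem[of x u] by (cases x) (auto simp: bigrading_def bihom_def intro!: assms(2) split: if_splits)
  then have "(\<Sum>x\<in>{x. bcomp x u \<noteq> 0}. bcomp x u) \<in> {u. P u}"
    by (intro subspace_sum[OF assms(1)]) auto
  then show ?thesis using bcomp_sum[of u] by simp
qed

lemma linear_sum_scale:
  assumes "\<And>i. i \<in> A \<Longrightarrow> Vector_Spaces.linear scale scale (f i)"
  shows "Vector_Spaces.linear scale scale (\<lambda>u. \<Sum>i\<in>A. scale (c i) (f i u))"
proof
  fix u w d
  show "(\<Sum>i\<in>A. scale (c i) (f i (u + w))) = (\<Sum>i\<in>A. scale (c i) (f i u)) + (\<Sum>i\<in>A. scale (c i) (f i w))"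
    unfolding sum.distrib[symmetric] scale_right_distrib[symmetric]
    by (intro sum.cong refl arg_cong[of _ _ "scale _"]) (rule module_hom.add[OF module_hom_of_linear[OF assms]])
  show "(\<Sum>i\<in>A. scale (c i) (f i (scale d u))) = scale d (\<Sum>i\<in>A. scale (c i) (f i u))"
    unfolding scale_sum_right scale_left_commute[of d]
    by (intro sum.cong refl arg_cong[of _ _ "scale _"]) (rule module_hom.scale[OF module_hom_of_linear[OF assms]])
qed

lemma linear_if_zero:
  assumes "Vector_Spaces.linear scale scale f"
  shows "Vector_Spaces.linear scale scale (\<lambda>u. if P then f u else 0)"
proof (cases P)
  case False
  then show ?thesis by unfold_locales simp_all
qed (simp add: assms)

lemma star_hom_linear_left: "Vector_Spaces.linear scale scale (\<lambda>u. star_hom T n m p wt r u v)"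
  unfolding star_hom_def Let_def
  by (intro linear_if_zero linear_sum_scale res_Y_linear_left)

lemma star_hom_linear_right: "Vector_Spaces.linear scale scale (star_hom T n m p wt r u)"
  unfolding star_hom_def[abs_def] Let_def
  by (intro linear_if_zero linear_sum_scale res_Y_linear_right)

lemma circ_hom_linear_left: "Vector_Spaces.linear scale scale (\<lambda>u. circ_hom T n m wt r u v)"
  unfolding circ_hom_def Let_def by (rule res_Y_linear_left)

lemma star_linear_left: "Vector_Spaces.linear scale scale (\<lambda>u. star g T n m p u v)"
  unfolding star_def by (intro linear_ext_linear star_hom_linear_left)

lemma circ_linear_left: "Vector_Spaces.linear scale scale (\<lambda>u. circ g T n m u v)"
  unfolding circ_def by (intro linear_ext_linear circ_hom_linear_left)

lemmas star_hom_zero_left [simp] = module_hom.zero[OF module_hom_of_linear[OF star_hom_linear_left]]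
  and circ_hom_zero_left [simp] = module_hom.zero[OF module_hom_of_linear[OF circ_hom_linear_left]]

text \<open>The set of nonzero components depends on \<open>u\<close> alone, so the product is a
  fixed finite sum of maps linear in \<open>v\<close>.\<close>

lemma star_linear_right: "Vector_Spaces.linear scale scale (star g T n m p u)"
proof -
  have "star g T n m p u v = (\<Sum>x\<in>{x. bcomp x u \<noteq> 0}. scale 1 (case x of (k, r) \<Rightarrow> star_hom T n m p k r (bcomp (k, r) u) v))" for v
    unfolding star_def by (subst linear_ext_eq_sum) (auto simp: bcomp_finite)
  then have "star g T n m p u = (\<lambda>v. \<Sum>x\<in>{x. bcomp x u \<noteq> 0}. scale 1 (case x of (k, r) \<Rightarrow> star_hom T n m p k r (bcomp (k, r) u) v))"
    by (rule ext)
  then show ?thesis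
    by (simp only:) (intro linear_sum_scale, auto simp: case_prod_unfold intro: star_hom_linear_right)
qed

lemmas star_add_left = module_hom.add[OF module_hom_of_linear[OF star_linear_left]]
  and star_scale_left = module_hom.scale[OF module_hom_of_linear[OF star_linear_left]]
  and star_zero_left = module_hom.zero[OF module_hom_of_linear[OF star_linear_left]]
  and star_sum_left = module_hom.sum[OF module_hom_of_linear[OF star_linear_left]]
  and star_add_right = module_hom.add[OF module_hom_of_linear[OF star_linear_right]]
  and star_scale_right = module_hom.scale[OF module_hom_of_linear[OF star_linear_right]]
  and star_zero_right = module_hom.zero[OF module_hom_of_linear[OF star_linear_right]]
  and star_sum_right = module_hom.sum[OF module_hom_of_linear[OF star_linear_right]]
  and circ_add_left = module_hom.add[OF module_hom_of_linear[OF circ_linear_left]]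
  and circ_scale_left = module_hom.scale[OF module_hom_of_linear[OF circ_linear_left]]
  and circ_zero_left = module_hom.zero[OF module_hom_of_linear[OF circ_linear_left]]

lemma star_bihom: "bihom wt r u \<Longrightarrow> star g T n m p u v = star_hom T n m p wt r u v"
  unfolding star_def by (rule linear_ext_bihom) auto

lemma circ_bihom: "bihom wt r u \<Longrightarrow> circ g T n m u v = circ_hom T n m wt r u v"
  unfolding circ_def by (rule linear_ext_bihom) auto

end

section \<open>Functionals vanishing on \<open>O'\<close>\<close>

lemma gbinom_int_absorption: "of_int j * gbinom_int (\<gamma> + 1) j = (\<gamma> + 1) * gbinom_int \<gamma> (j - 1)"
proof (cases "j \<le> 0")
  case True
  then show ?thesis by (cases "j = 0") auto
next
  case False
  then have "j = int (Suc (nat (j - 1)))" by simp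
  then obtain i where "j = int (Suc i)" ..
  then show ?thesis using Suc_times_gbinomial[of i \<gamma>] by (simp add: gbinom_int_def nat_add_distrib)
qed

text \<open>Coefficients in the derivative of \<open>(1 + x)^(\<gamma> + 1) x^(-k)\<close>.\<close>

lemma gbinom_int_derivative:
  "of_int (j - k) * gbinom_int (\<gamma> + 1) j = (\<gamma> + 1 - of_int k) * gbinom_int \<gamma> (j - 1) - of_int k * gbinom_int \<gamma> j"
  using gbinom_int_absorption[of j \<gamma>] gbinom_int_pascal[of \<gamma> j] by (simp add: algebra_simps)

lemma binom_inf_absorption: "of_int i * binom_inf (i - 1) (e - 1) = of_int e * binom_inf i e"
proof (cases "i < e")
  case False
  then have "of_int i - of_nat (nat (i - e)) = (of_int e :: complex)" by simp
  then have "of_int e * gbinom_int (of_int i) (i - e) = of_int i * gbinom_int (of_int i - 1) (i - e)"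
    using gbinomial_absorb_comp[of "of_int i :: complex" "nat (i - e)"] False by (simp add: gbinom_int_def)
  then show ?thesis by (simp add: binom_inf_def)
qed (simp add: binom_inf_eq_0)

text \<open>The operator \<open>(1 + x) d/dx - \<alpha>\<close> is \<open>z d/dz - \<alpha>\<close>,
  which is diagonal on powers of \<open>z\<close>.\<close>

lemma coeff_inf_derivative:
  assumes "eventually_0 F"
  shows "coeff_inf (\<lambda>i. (of_int i - \<alpha>) * F i + of_int (i + 1) * F (i + 1)) e = (of_int e - \<alpha>) * coeff_inf F e"
proof -
  obtain J where J: "\<And>i. i > J \<Longrightarrow> F i = 0" using assms by (auto simp: eventually_0_def)
  have "coeff_inf (\<lambda>i. (of_int i - \<alpha>) * F i + of_int (i + 1) * F (i + 1)) e =
      (\<Sum>i\<in>{e..J}. binom_inf i e * ((of_int i - \<alpha>) * F i + of_int (i + 1) * F (i + 1)))"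
    by (rule coeff_inf_atMost) (simp add: J)
  also have "\<dots> = (\<Sum>i\<in>{e..J}. binom_inf i e * ((of_int i - \<alpha>) * F i)) + (\<Sum>i\<in>{e..J}. binom_inf i e * (of_int (i + 1) * F (i + 1)))"
    by (simp add: sum.distrib distrib_left)
  also have "(\<Sum>i\<in>{e..J}. binom_inf i e * (of_int (i + 1) * F (i + 1))) = (\<Sum>i\<in>{e + 1..J + 1}. binom_inf (i - 1) e * (of_int i * F i))"
    using sum_shift_int[of "\<lambda>i. binom_inf i e * (of_int (i + 1) * F (i + 1))" "e + 1" "J + 1"] by simp
  also have "\<dots> = (\<Sum>i\<in>{e..J}. binom_inf (i - 1) e * (of_int i * F i))"
    by (rule sum.mono_neutral_cong) (auto simp: J binom_inf_eq_0)
  also have "(\<Sum>i\<in>{e..J}. binom_inf i e * ((of_int i - \<alpha>) * F i)) + (\<Sum>i\<in>{e..J}. binom_inf (i - 1) e * (of_int i * F i)) =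
      (\<Sum>i\<in>{e..J}. (of_int e - \<alpha>) * (binom_inf i e * F i))"
    unfolding sum.distrib[symmetric]
  proof (intro sum.cong refl)
    fix i
    have "of_int i * (binom_inf i e + binom_inf (i - 1) e) = of_int e * binom_inf i e"
      using binom_inf_pascal[of "i - 1" e] binom_inf_absorption[of i e] by simp
    then show "binom_inf i e * ((of_int i - \<alpha>) * F i) + binom_inf (i - 1) e * (of_int i * F i) = (of_int e - \<alpha>) * (binom_inf i e * F i)"
      by algebra
  qed
  also have "\<dots> = (of_int e - \<alpha>) * coeff_inf F e"
    using coeff_inf_atMost[of J F e] J by (simp add: sum_distrib_left)
  finally show ?thesis .
qed

lemma coeff_inf_diff:
  assumes "eventually_0 F" "eventually_0 G"
  shows "coeff_inf (\<lambda>i. c * F i - G i) e = c * coeff_inf F e - coeff_inf G e"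
  using coeff_inf_lincomb[of "{True, False}" "\<lambda>b. if b then F else G" "\<lambda>b. if b then c else -1" e] assms
  by simp

lemma eventually_0_derivative:
  assumes "eventually_0 F"
  shows "eventually_0 (\<lambda>i. (of_int i - \<gamma>) * F i + of_int (i + 1) * F (i + 1))"
proof -
  obtain J where "\<And>i. i > J \<Longrightarrow> F i = 0" using assms by (auto simp: eventually_0_def)
  then have "\<forall>i>J. (of_int i - \<gamma>) * F i + of_int (i + 1) * F (i + 1) = 0" by simp
  then show ?thesis unfolding eventually_0_def by blast
qed

context vertex_operator_algebra
begin

section \<open>\<open>L(-1)\<close> and \<open>L(0)\<close> inside residues\<close>

lemma res_Y_binom_superset:
  assumes "finite A" "\<And>E. E \<notin> A \<Longrightarrow> gbinom_int \<gamma> (E + k) = 0 \<or> Y u E v = 0"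
  shows "res_Y (binom_quot \<gamma> k) u v = (\<Sum>E\<in>A. scale (gbinom_int \<gamma> (E + k)) (Y u E v))"
  using res_Y_superset[of A "binom_quot \<gamma> k" u v] assms by (simp add: binom_quot_nth)

text \<open>Integration by parts, as \<open>Y(L(-1)u,x)\<close> is the derivative of
  \<open>Y(u,x)\<close>.\<close>

lemma res_Y_L_minus1:
  "res_Y (binom_quot (\<gamma> + 1) k) (Y \<omega> 0 u) v =
    scale (of_int k) (res_Y (binom_quot \<gamma> (k + 1)) u v) - scale (\<gamma> + 1 - of_int k) (res_Y (binom_quot \<gamma> k) u v)"
proof -
  obtain N where N: "\<And>E. E \<ge> N \<Longrightarrow> Y u E v = 0" using truncation by blast
  let ?S = "{-k-1..N - 1}"
  have "res_Y (binom_quot (\<gamma> + 1) k) (Y \<omega> 0 u) v = (\<Sum>E\<in>{-k..N}. scale (gbinom_int (\<gamma> + 1) (E + k)) (Y (Y \<omega> 0 u) E v))"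
    by (rule res_Y_binom_superset) (auto simp: L_minus1_derivative N)
  also have "\<dots> = (\<Sum>E\<in>?S. scale (gbinom_int (\<gamma> + 1) (E + 1 + k)) (- scale (of_int (E + 1)) (Y u E v)))"
    by (rule sum.reindex_bij_witness[of _ "\<lambda>E. E + 1" "\<lambda>E. E - 1"]) (auto simp: L_minus1_derivative)
  also have "\<dots> = (\<Sum>E\<in>?S. scale (of_int k) (scale (gbinom_int \<gamma> (E + (k + 1))) (Y u E v)) -
      scale (\<gamma> + 1 - of_int k) (scale (gbinom_int \<gamma> (E + k)) (Y u E v)))"
  proof (intro sum.cong refl)
    fix E
    have "of_int (E + 1) * gbinom_int (\<gamma> + 1) (E + 1 + k) = (\<gamma> + 1 - of_int k) * gbinom_int \<gamma> (E + k) - of_int k * gbinom_int \<gamma> (E + (k + 1))"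
      using gbinom_int_derivative[of "E + 1 + k" k \<gamma>] by (simp add: algebra_simps)
    then have eq: "- (gbinom_int (\<gamma> + 1) (E + 1 + k) * of_int (E + 1)) =
        of_int k * gbinom_int \<gamma> (E + (k + 1)) - (\<gamma> + 1 - of_int k) * gbinom_int \<gamma> (E + k)"
      by (simp add: mult.commute)
    have "scale (gbinom_int (\<gamma> + 1) (E + 1 + k)) (- scale (of_int (E + 1)) (Y u E v)) =
        scale (- (gbinom_int (\<gamma> + 1) (E + 1 + k) * of_int (E + 1))) (Y u E v)" by simp
    also have "\<dots> = scale (of_int k) (scale (gbinom_int \<gamma> (E + (k + 1))) (Y u E v)) -
        scale (\<gamma> + 1 - of_int k) (scale (gbinom_int \<gamma> (E + k)) (Y u E v))"
      by (subst eq) (simp only: scale_left_diff_distrib scale_scale)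
    finally show "scale (gbinom_int (\<gamma> + 1) (E + 1 + k)) (- scale (of_int (E + 1)) (Y u E v)) = \<dots>" .
  qed
  also have "\<dots> = scale (of_int k) (\<Sum>E\<in>?S. scale (gbinom_int \<gamma> (E + (k + 1))) (Y u E v)) -
      scale (\<gamma> + 1 - of_int k) (\<Sum>E\<in>?S. scale (gbinom_int \<gamma> (E + k)) (Y u E v))"
    by (simp only: sum_subtractf scale_sum_right)
  also have "(\<Sum>E\<in>?S. scale (gbinom_int \<gamma> (E + (k + 1))) (Y u E v)) = res_Y (binom_quot \<gamma> (k + 1)) u v"
    by (rule res_Y_binom_superset[symmetric]) (auto simp: N not_le)
  also have "(\<Sum>E\<in>?S. scale (gbinom_int \<gamma> (E + k)) (Y u E v)) = res_Y (binom_quot \<gamma> k) u v"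
    by (rule res_Y_binom_superset[symmetric]) (auto simp: N not_le)
  finally show ?thesis .
qed

text \<open>The commutator of \<open>L(-1) + L(0)\<close> with \<open>Y(a,x)\<close> is
  \<open>(1 + x) d/dx + wt\<close>; the derivative is then integrated by parts.\<close>

lemma res_Y_L_right:
  assumes a: "a \<in> V wt"
  shows "res_Y (binom_quot \<gamma> k) a (Y \<omega> 0 y + Y \<omega> 1 y) =
    (Y \<omega> 0 (res_Y (binom_quot \<gamma> k) a y) + Y \<omega> 1 (res_Y (binom_quot \<gamma> k) a y)) +
    (scale (\<gamma> + 1 - of_int k - of_int wt) (res_Y (binom_quot \<gamma> k) a y) - scale (of_int k) (res_Y (binom_quot \<gamma> (k + 1)) a y))"
proof -
  obtain N1 N2 N3 where N: "\<forall>E\<ge>N1. Y a E y = 0" "\<forall>E\<ge>N2. Y a E (Y \<omega> 0 y) = 0" "\<forall>E\<ge>N3. Y a E (Y \<omega> 1 y) = 0"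
    using truncation by meson
  define N where "N = max N1 (max N2 N3)"
  have N': "E \<ge> N \<Longrightarrow> Y a E y = 0" "E \<ge> N \<Longrightarrow> Y a E (Y \<omega> 0 y) = 0" "E \<ge> N \<Longrightarrow> Y a E (Y \<omega> 1 y) = 0" for E
    using N by (auto simp: N_def)
  let ?S = "{-k-1..N}"
  have res: "res_Y (binom_quot \<gamma> j) a z = (\<Sum>E\<in>?S. scale (gbinom_int \<gamma> (E + j)) (Y a E z))"
    if "z \<in> {y, Y \<omega> 0 y, Y \<omega> 1 y}" "j \<in> {k, k + 1}" for z j
    using that by (intro res_Y_binom_superset) (auto simp: N' not_le)
  have d0: "Y a E (Y \<omega> 0 y) = Y \<omega> 0 (Y a E y) + scale (of_int E) (Y a (E - 1) y)" for E
    using L_minus1_commutator[of a E y] by (simp add: algebra_simps)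
  have d1: "Y a E (Y \<omega> 1 y) = Y \<omega> 1 (Y a E y) - scale (of_int (wt - E - 1)) (Y a E y)" for E
    using L0_commutator[OF a, of E y] by (simp add: algebra_simps)
  have shift: "(\<Sum>E\<in>?S. scale (gbinom_int \<gamma> (E + k)) (scale (of_int E) (Y a (E - 1) y))) =
      (\<Sum>E\<in>?S. scale (gbinom_int \<gamma> (E + (k + 1)) * of_int (E + 1)) (Y a E y))"
  proof -
    have "(\<Sum>E\<in>?S. scale (gbinom_int \<gamma> (E + k)) (scale (of_int E) (Y a (E - 1) y))) =
        (\<Sum>E\<in>{-k-2..N-1}. scale (gbinom_int \<gamma> (E + (k + 1)) * of_int (E + 1)) (Y a E y))"
      by (rule sum.reindex_bij_witness[of _ "\<lambda>E. E + 1" "\<lambda>E. E - 1"]) auto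
    also have "\<dots> = (\<Sum>E\<in>?S. scale (gbinom_int \<gamma> (E + (k + 1)) * of_int (E + 1)) (Y a E y))"
      by (rule sum.mono_neutral_cong) (auto simp: N')
    finally show ?thesis .
  qed
  have "res_Y (binom_quot \<gamma> k) a (Y \<omega> 0 y + Y \<omega> 1 y) =
      (\<Sum>E\<in>?S. scale (gbinom_int \<gamma> (E + k)) (Y \<omega> 0 (Y a E y) + scale (of_int E) (Y a (E - 1) y))) +
      (\<Sum>E\<in>?S. scale (gbinom_int \<gamma> (E + k)) (Y \<omega> 1 (Y a E y) - scale (of_int (wt - E - 1)) (Y a E y)))"
    unfolding res_Y_add_right by (subst (1 2) res) (auto simp: d0 d1)
  also have "\<dots> = (Y \<omega> 0 (res_Y (binom_quot \<gamma> k) a y) + Y \<omega> 1 (res_Y (binom_quot \<gamma> k) a y)) +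
      ((\<Sum>E\<in>?S. scale (gbinom_int \<gamma> (E + k)) (scale (of_int E) (Y a (E - 1) y))) -
       (\<Sum>E\<in>?S. scale (gbinom_int \<gamma> (E + k)) (scale (of_int (wt - E - 1)) (Y a E y))))"
    by (subst (1 2) res) (auto simp: Y_sum_right Y_scale_right scale_right_distrib scale_right_diff_distrib
        sum.distrib sum_subtractf simp del: scale_scale of_int_diff)
  also have "(\<Sum>E\<in>?S. scale (gbinom_int \<gamma> (E + k)) (scale (of_int E) (Y a (E - 1) y))) -
       (\<Sum>E\<in>?S. scale (gbinom_int \<gamma> (E + k)) (scale (of_int (wt - E - 1)) (Y a E y))) =
      (\<Sum>E\<in>?S. scale (gbinom_int \<gamma> (E + (k + 1)) * of_int (E + 1) - gbinom_int \<gamma> (E + k) * of_int (wt - E - 1)) (Y a E y))"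
    unfolding shift by (simp only: scale_scale sum_subtractf[symmetric] scale_left_diff_distrib)
  also have "\<dots> = (\<Sum>E\<in>?S. scale ((\<gamma> + 1 - of_int k - of_int wt) * gbinom_int \<gamma> (E + k) - of_int k * gbinom_int \<gamma> (E + (k + 1))) (Y a E y))"
  proof (intro sum.cong refl arg_cong2[of _ _ _ _ scale])
    fix E
    show "gbinom_int \<gamma> (E + (k + 1)) * of_int (E + 1) - gbinom_int \<gamma> (E + k) * of_int (wt - E - 1) =
        (\<gamma> + 1 - of_int k - of_int wt) * gbinom_int \<gamma> (E + k) - of_int k * gbinom_int \<gamma> (E + (k + 1))"
      using gbinom_int_derivative[of "E + 1 + k" k \<gamma>] gbinom_int_pascal[of \<gamma> "E + 1 + k"]
      by (simp add: algebra_simps)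
  qed
  also have "\<dots> = scale (\<gamma> + 1 - of_int k - of_int wt) (res_Y (binom_quot \<gamma> k) a y) - scale (of_int k) (res_Y (binom_quot \<gamma> (k + 1)) a y)"
    by (subst (1 2) res) (auto simp only: insert_iff simp_thms scale_left_diff_distrib sum_subtractf scale_sum_right scale_scale)
  finally show ?thesis .
qed

end

context voa_automorphism
begin

section \<open>Exponents of the products and carries modulo \<open>T\<close>\<close>

text \<open>\<open>lam m r + r / T\<close> and \<open>mu n r - r / T\<close> are the least elements of \<open>r / T + \<int>\<close> above \<open>m\<close> and of
  \<open>- r / T + \<int>\<close> above \<open>n\<close>. In the defining residues \<open>twist_exp\<close> is the exponent of \<open>1 + x\<close>,
  and \<open>u *_{g,m,p}^n v\<close> is the coefficient of \<open>z^star_exp\<close> at \<open>z = \<infinity>\<close>.\<close>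

definition lam :: "real \<Rightarrow> nat \<Rightarrow> int" where "lam m r = \<lfloor>m\<rfloor> + delta (fbar T m) r"
definition mu :: "real \<Rightarrow> nat \<Rightarrow> int" where "mu n r = \<lfloor>n\<rfloor> + delta (fbar T n) (T - r)"
definition twist_exp :: "real \<Rightarrow> int \<Rightarrow> nat \<Rightarrow> complex" where
  "twist_exp m wt r = of_int (wt + lam m r - 1) + of_nat r / of_nat T"
definition star_exp :: "real \<Rightarrow> real \<Rightarrow> real \<Rightarrow> nat \<Rightarrow> int" where
  "star_exp n m p r = lam m r + mu n r - \<lfloor>p\<rfloor> - 1"
definition degree_ok :: "real \<Rightarrow> real \<Rightarrow> nat \<Rightarrow> bool" where
  "degree_ok n p r \<longleftrightarrow> (int (fbar T p) - int (fbar T n)) mod int T = int r mod int T"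

lemma circ_hom_eq: "circ_hom T n m wt r u v = res_Y (binom_quot (twist_exp m wt r) (lam m r + mu n r + 1)) u v"
  by (simp add: circ_hom_def Let_def twist_exp_def lam_def mu_def algebra_simps)

lemma star_hom_eq:
  assumes "degree_ok n p r"
  shows "star_hom T n m p wt r u v = (\<Sum>q\<le>nat \<lfloor>p\<rfloor>. scale (binom_inf (star_exp n m p r + int q) (star_exp n m p r))
    (res_Y (binom_quot (twist_exp m wt r) (star_exp n m p r + int q + 1)) u v))"
proof -
  have "(-1) ^ q * (of_int (\<lfloor>m\<rfloor> + \<lfloor>n\<rfloor> - \<lfloor>p\<rfloor> - 1 + delta (fbar T m) r + delta (fbar T n) (T - r) + int q) gchoose q) =
      binom_inf (star_exp n m p r + int q) (star_exp n m p r)" for q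
    unfolding binom_inf_int by (simp add: star_exp_def lam_def mu_def algebra_simps)
  moreover have "binom_quot (of_int (wt + \<lfloor>m\<rfloor> + delta (fbar T m) r - 1) + of_nat r / of_nat T)
      (\<lfloor>m\<rfloor> + \<lfloor>n\<rfloor> - \<lfloor>p\<rfloor> + delta (fbar T m) r + delta (fbar T n) (T - r) + int q) =
      binom_quot (twist_exp m wt r) (star_exp n m p r + int q + 1)" for q
    by (simp add: twist_exp_def star_exp_def lam_def mu_def algebra_simps)
  ultimately show ?thesis
    using assms unfolding star_hom_def Let_def degree_ok_def by simp
qed

lemma star_hom_eq_0: "\<not> degree_ok n p r \<Longrightarrow> star_hom T n m p wt r u v = 0"
  by (simp add: star_hom_def Let_def degree_ok_def)

lemma star_eq_0: "bihom wt r u \<Longrightarrow> \<not> degree_ok n' p r \<Longrightarrow> star g T n' m' p u v = 0"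
  by (simp add: star_bihom star_hom_eq_0)

lemma fbar_less: "fbar T n < T"
proof -
  have "real T * frac n < real T" using T_pos frac_lt_1[of n] by simp
  then have "\<lfloor>real T * frac n\<rfloor> < int T" by (simp add: floor_less_iff)
  then show ?thesis using T_pos by (simp add: fbar_def nat_less_iff)
qed

lemma fracN_eq:
  assumes "n \<in> fracN T"
  shows "n = of_int \<lfloor>n\<rfloor> + real (fbar T n) / real T" and "\<lfloor>n\<rfloor> \<ge> 0"
proof -
  obtain k where k: "n = real k / real T" using assms by (auto simp: fracN_def)
  have "n = real (k div T) + real (k mod T) / real T"
    using T_pos by (simp add: k field_simps flip: of_nat_mult of_nat_add)
  moreover have fl: "\<lfloor>n\<rfloor> = int (k div T)" by (simp add: k floor_divide_of_nat_eq)
  ultimately have "frac n = real (k mod T) / real T" by (simp add: frac_def)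
  then have "fbar T n = k mod T" using T_pos by (simp add: fbar_def)
  then show "n = of_int \<lfloor>n\<rfloor> + real (fbar T n) / real T"
    using \<open>n = real (k div T) + _\<close> fl by simp
  show "\<lfloor>n\<rfloor> \<ge> 0" using fl by simp
qed


text \<open>\<open>delta (fbar T n) (T - r)\<close> is the carry in the addition of \<open>r\<close>
  and \<open>fbar T n\<close> modulo \<open>T\<close>, and the degree condition says that the sum
  reduces to \<open>fbar T p\<close>.\<close>

lemma degree_ok_cases:
  assumes "degree_ok n p r" "r < T"
  shows "fbar T n \<le> fbar T p \<and> r + fbar T n = fbar T p \<and> delta (fbar T n) (T - r) = 0 \<or>
    fbar T p < fbar T n \<and> r + fbar T n = fbar T p + T \<and> delta (fbar T n) (T - r) = 1"
proof -
  have lt: "fbar T n < T" "fbar T p < T" by (rule fbar_less)+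
  have r: "(int (fbar T p) - int (fbar T n)) mod int T = int r"
    using assms by (simp add: degree_ok_def)
  show ?thesis
  proof (cases "fbar T n \<le> fbar T p")
    case True
    then have "int (fbar T p) - int (fbar T n) = int r" using r lt by (simp add: mod_pos_pos_trivial)
    then show ?thesis using True lt by (auto simp: delta_def)
  next
    case False
    have "(int (fbar T p) - int (fbar T n)) mod int T = (int (fbar T p) - int (fbar T n) + int T) mod int T"
      by simp
    also have "\<dots> = int (fbar T p) - int (fbar T n) + int T"
      using False lt by (intro mod_pos_pos_trivial) auto
    finally show ?thesis using r False by (auto simp: delta_def)
  qed
qed

lemma degree_ok_iff_dvd: "degree_ok n p r \<longleftrightarrow> int T dvd (int (fbar T p) - int (fbar T n) - int r)"
  by (simp add: degree_ok_def mod_eq_dvd_iff)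

lemma degree_ok_trans_iff:
  assumes "degree_ok n p r"
  shows "degree_ok p q s \<longleftrightarrow> degree_ok n q ((r + s) mod T)"
proof -
  have "int T dvd (int (r + s) - int ((r + s) mod T))"
    by (metis dvd_minus_mod of_nat_diff of_nat_dvd_iff mod_less_eq_dividend)
  then have "int T dvd ((int (fbar T p) - int (fbar T n) - int r) + (int (r + s) - int ((r + s) mod T)))"
    using assms by (simp only: degree_ok_iff_dvd dvd_add)
  then have "int T dvd (int (fbar T q) - int (fbar T p) - int s) \<longleftrightarrow>
      int T dvd ((int (fbar T q) - int (fbar T p) - int s) +
        ((int (fbar T p) - int (fbar T n) - int r) + (int (r + s) - int ((r + s) mod T))))"
    by (simp only: dvd_add_left_iff)
  then show ?thesis unfolding degree_ok_iff_dvd by (simp add: algebra_simps)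
qed

lemma mod_div_T_cases:
  assumes "r < T" "s < T"
  shows "r + s < T \<and> (r + s) mod T = r + s \<and> (r + s) div T = 0 \<or>
    T \<le> r + s \<and> (r + s) mod T = r + s - T \<and> (r + s) div T = 1"
proof (cases "r + s < T")
  case False
  then have "(r + s) mod T = r + s - T" using assms by (simp add: mod_if)
  moreover have "(r + s) div T = 1" using False assms T_pos by (simp add: div_if)
  ultimately show ?thesis using False by simp
qed simp

text \<open>\<open>mu n r - r / T\<close> is the largest element of \<open>- r / T + \<int>\<close>
  not above \<open>n\<close>. After subtracting \<open>(r + s) / T\<close> the right side is at most
  \<open>n\<close>, the left side exceeds \<open>n - 1\<close>, and they differ by an
  integer.\<close>

lemma mu_compose_ge:
  assumes "degree_ok n p r" "r < T" "s < T"
  shows "mu n r + mu p s - \<lfloor>p\<rfloor> \<ge> mu n ((r + s) mod T) + int ((r + s) div T)"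
  using degree_ok_cases[OF assms(1,2)] mod_div_T_cases[OF assms(2,3)] fbar_less[of n] fbar_less[of p] assms(2,3)
  by (auto simp: mu_def delta_def)

text \<open>The degree condition gives \<open>mu n r - r / T = \<lfloor>n\<rfloor> + (fbar T n -
  fbar T p) / T\<close>. Two such equations telescope in \<open>p\<close>, leaving the carry of
  \<open>r + s\<close>.\<close>

lemma mu_compose_eq:
  assumes "degree_ok n p r" "degree_ok p q s" "r < T" "s < T"
  shows "mu n r + mu p s - \<lfloor>p\<rfloor> = mu n ((r + s) mod T) + int ((r + s) div T)"
  using degree_ok_cases[OF assms(1,3)] degree_ok_cases[OF assms(2,4)] mod_div_T_cases[OF assms(3,4)]
    fbar_less[of n] fbar_less[of p] fbar_less[of q] assms(3,4)
  by (auto simp: mu_def delta_def)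

text \<open>\<open>lam p r + r / T\<close> is the least element of \<open>r / T + \<int>\<close>
  above \<open>p\<close>; decreasing the right side by one and adding \<open>r / T\<close> gives an
  element not above \<open>p\<close>. In its uses \<open>lam p r - lam m r\<close> is the available
  power of \<open>z1\<close>, and the right side less \<open>lam m r\<close> the required
  one.\<close>

lemma lam_mu_ge:
  assumes "degree_ok n p ((r + s) mod T)" "r < T" "s < T"
  shows "lam p r \<ge> mu n s - mu n ((r + s) mod T) + \<lfloor>p\<rfloor> - int ((r + s) div T) + 1"
proof -
  have "(r + s) mod T < T" using T_pos by simp
  from degree_ok_cases[OF assms(1) this] mod_div_T_cases[OF assms(2,3)] fbar_less[of n] fbar_less[of p]
  show ?thesis using assms(2,3) by (auto simp: mu_def lam_def delta_def)
qed

lemma degree_shift: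
  assumes "degree_ok n p r" "r < T" "n \<in> fracN T" "p \<in> fracN T"
  shows "of_int (mu n r) - of_nat r / of_nat T - of_int \<lfloor>p\<rfloor> = (of_real (n - p) :: complex)"
proof -
  have "real_of_int (mu n r) - real r / real T - real_of_int \<lfloor>p\<rfloor> = n - p"
    using degree_ok_cases[OF assms(1,2)]
  proof
    assume "fbar T n \<le> fbar T p \<and> r + fbar T n = fbar T p \<and> delta (fbar T n) (T - r) = 0"
    then have r: "real r = real (fbar T p) - real (fbar T n)" and "mu n r = \<lfloor>n\<rfloor>"
      by (auto simp: mu_def)
    then show ?thesis
      using fracN_eq(1)[OF assms(3)] fracN_eq(1)[OF assms(4)] by (simp add: r diff_divide_distrib)
  next
    assume "fbar T p < fbar T n \<and> r + fbar T n = fbar T p + T \<and> delta (fbar T n) (T - r) = 1"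
    then have "real r + real (fbar T n) = real (fbar T p) + real T" and mu: "mu n r = \<lfloor>n\<rfloor> + 1"
      by (auto simp: mu_def simp flip: of_nat_add)
    then have r: "real r = real (fbar T p) - real (fbar T n) + real T" by simp
    show ?thesis
      using fracN_eq(1)[OF assms(3)] fracN_eq(1)[OF assms(4)] T_pos
      by (simp add: r mu diff_divide_distrib add_divide_distrib)
  qed
  then have "complex_of_real (real_of_int (mu n r) - real r / real T - real_of_int \<lfloor>p\<rfloor>) = of_real (n - p)" by simp
  then show ?thesis by simp
qed

lemma twist_exp_Suc: "twist_exp m (wt + 1) r = twist_exp m wt r + 1"
  by (simp add: twist_exp_def)

text \<open>The eigenvalue of \<open>z d/dz - twist_exp\<close> on the power of \<open>z\<close>
  that the product picks.\<close>

lemma star_exp_minus_twist_exp: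
  assumes "degree_ok n p r" "r < T" "n \<in> fracN T" "p \<in> fracN T"
  shows "of_int (star_exp n m p r) - twist_exp m wt r = of_real (n - p) - of_int wt"
  using degree_shift[OF assms] by (simp add: star_exp_def twist_exp_def algebra_simps)

section \<open>Elements of \<open>O'\<close>\<close>

lemma Oprime_eq_span:
  "Oprime g T n m = span ({circ g T n m u v | u v. True} \<union> {L (-1) u + L 0 u + scale (of_real (m - n)) u | u. True})"
  unfolding Oprime_def Lspace_def span_Un ..

lemma Oprime_subspace: "subspace (Oprime g T n m)"
  unfolding Oprime_eq_span by (rule subspace_span)

lemma circ_in_Oprime: "circ g T n m u v \<in> Oprime g T n m"
  unfolding Oprime_eq_span by (rule span_base) blast

lemma L_in_Oprime: "Y \<omega> 0 u + Y \<omega> 1 u + scale (of_real (m - n)) u \<in> Oprime g T n m"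
proof -
  have "L (-1) u + L 0 u + scale (of_real (m - n)) u \<in> Oprime g T n m"
    unfolding Oprime_eq_span by (rule span_base) blast
  then show ?thesis by (simp add: L_def)
qed

lemma Oprime_induct:
  assumes x: "x \<in> Oprime g T n m" and P: "subspace {x. P x}"
    and "\<And>u v. P (circ g T n m u v)"
    and "\<And>u. P (Y \<omega> 0 u + Y \<omega> 1 u + scale (of_real (m - n)) u)"
  shows "P x"
  using x unfolding Oprime_eq_span
proof (rule span_induct[OF _ P])
  fix y assume "y \<in> {circ g T n m u v | u v. True} \<union> {L (-1) u + L 0 u + scale (of_real (m - n)) u | u. True}"
  then show "P y" using assms(3,4) by (auto simp: L_def)
qed

text \<open>Replacing \<open>u\<close> by \<open>L(-1)u\<close> differentiates \<open>Y(u,x)\<close>, which raises the pole order by one.\<close>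

lemma res_Y_in_Oprime:
  assumes "n \<in> fracN T" "m \<in> fracN T" "bihom wt r u" "k \<ge> lam m r + mu n r + 1"
  shows "res_Y (binom_quot (twist_exp m wt r) k) u v \<in> Oprime g T n m"
proof -
  \<comment> \<open>The induction on the pole order divides by it, so it must not vanish.\<close>
  have pos: "lam m r + mu n r + 1 > 0"
    using fracN_eq(2)[OF assms(1)] fracN_eq(2)[OF assms(2)] by (simp add: lam_def mu_def delta_def)
  have "res_Y (binom_quot (twist_exp m wt r) (lam m r + mu n r + 1 + int j)) u v \<in> Oprime g T n m"
    if "bihom wt r u" for j wt u
    using that
  proof (induction j arbitrary: wt u)
    case 0
    then show ?case using circ_in_Oprime[of n m u v] by (simp add: circ_bihom circ_hom_eq)
  next
    case (Suc j)
    let ?k = "lam m r + mu n r + 1 + int j"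
    let ?\<gamma> = "twist_exp m wt r"
    have "res_Y (binom_quot (?\<gamma> + 1) ?k) (Y \<omega> 0 u) v + scale (?\<gamma> + 1 - of_int ?k) (res_Y (binom_quot ?\<gamma> ?k) u v) \<in> Oprime g T n m"
      using Suc.IH[OF bihom_L_minus1[OF Suc.prems]] Suc.IH[OF Suc.prems]
      by (intro subspace_add subspace_scale Oprime_subspace) (simp_all add: twist_exp_Suc)
    then have "scale (of_int ?k) (res_Y (binom_quot ?\<gamma> (?k + 1)) u v) \<in> Oprime g T n m"
      unfolding res_Y_L_minus1 by simp
    then have "scale (1 / of_int ?k) (scale (of_int ?k) (res_Y (binom_quot ?\<gamma> (?k + 1)) u v)) \<in> Oprime g T n m"
      by (rule subspace_scale[OF Oprime_subspace])
    moreover have "1 / of_int ?k * of_int ?k = (1 :: complex)"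
    proof -
      have "(of_int ?k :: complex) \<noteq> 0" unfolding of_int_eq_0_iff using pos by linarith
      then show ?thesis by simp
    qed
    ultimately have "res_Y (binom_quot ?\<gamma> (?k + 1)) u v \<in> Oprime g T n m"
      by (simp only: scale_scale scale_one)
    then show ?case by (simp add: algebra_simps)
  qed
  from this[OF assms(3), of "nat (k - (lam m r + mu n r + 1))"] show ?thesis using assms(4) by simp
qed


section \<open>One functional vanishing on \<open>O'\<close>\<close>

context
  fixes \<phi> :: "'v \<Rightarrow> complex" and n m :: real
  assumes \<phi>: "functional \<phi>" and kills: "\<And>x. x \<in> Oprime g T n m \<Longrightarrow> \<phi> x = 0"
    and n: "n \<in> fracN T" and m: "m \<in> fracN T"
begin

lemmas \<phi>_add = module_hom.add[OF module_hom_of_linear[OF \<phi>]]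
  and \<phi>_scale = module_hom.scale[OF module_hom_of_linear[OF \<phi>]]
  and \<phi>_sum = module_hom.sum[OF module_hom_of_linear[OF \<phi>]]
  and \<phi>_zero = module_hom.zero[OF module_hom_of_linear[OF \<phi>]]
  and \<phi>_diff = module_hom.diff[OF module_hom_of_linear[OF \<phi>]]

abbreviation "coeff_fun \<gamma> u v \<equiv> \<lambda>i. \<phi> (res_Y (binom_quot \<gamma> (i + 1)) u v)"

lemma coeff_fun_high: "bihom wt r u \<Longrightarrow> i > lam m r + mu n r - 1 \<Longrightarrow> coeff_fun (twist_exp m wt r) u v i = 0"
  by (rule kills) (rule res_Y_in_Oprime[OF n m], auto)

text \<open>Raising the exponent of \<open>1 + x\<close> by one multiplies by \<open>z\<close>,
  which only relabels the coefficients at infinity.\<close>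

lemma coeff_fun_shift:
  assumes "bihom wt r u"
  shows "eventually_0 (coeff_fun (twist_exp m wt r + of_nat s) u v)"
    and "coeff_inf (coeff_fun (twist_exp m wt r + of_nat s) u v) (e + int s) = coeff_inf (coeff_fun (twist_exp m wt r) u v) e"
proof -
  have "eventually_0 (coeff_fun (twist_exp m wt r + of_nat s) u v) \<and>
      coeff_inf (coeff_fun (twist_exp m wt r + of_nat s) u v) (e + int s) = coeff_inf (coeff_fun (twist_exp m wt r) u v) e"
  proof (induction s)
    case 0
    show ?case using coeff_fun_high[OF assms] unfolding eventually_0_def by auto
  next
    case (Suc s)
    have "coeff_fun (twist_exp m wt r + of_nat (Suc s)) u v = (\<lambda>i. coeff_fun (twist_exp m wt r + of_nat s) u v i + coeff_fun (twist_exp m wt r + of_nat s) u v (i - 1))"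
      using res_Y_pascal[of "twist_exp m wt r + of_nat s"] by (auto simp: \<phi>_add algebra_simps)
    then show ?case
      using Suc coeff_inf_times_z[of "coeff_fun (twist_exp m wt r + of_nat s) u v" "e + int s"]
        eventually_0_times_z[of "coeff_fun (twist_exp m wt r + of_nat s) u v"] by (simp add: algebra_simps)
  qed
  then show "eventually_0 (coeff_fun (twist_exp m wt r + of_nat s) u v)"
    "coeff_inf (coeff_fun (twist_exp m wt r + of_nat s) u v) (e + int s) = coeff_inf (coeff_fun (twist_exp m wt r) u v) e" by blast+
qed

lemma coeff_fun_eventually_0: "bihom wt r u \<Longrightarrow> eventually_0 (coeff_fun (twist_exp m wt r) u v)"
  using coeff_fun_shift(1)[of wt r u 0] by simp

text \<open>The cut-off in the product matches the degree bound: \<open>star_exp n m p r +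
  \<lfloor>p\<rfloor> = lam m r + mu n r - 1\<close> is the last degree left by
  \<open>coeff_fun_high\<close>.\<close>

lemma phi_star:
  assumes "bihom wt r u" "degree_ok n p r" "p \<in> fracN T"
  shows "\<phi> (star g T n m p u v) = coeff_inf (coeff_fun (twist_exp m wt r) u v) (star_exp n m p r)"
proof -
  have "coeff_inf (coeff_fun (twist_exp m wt r) u v) (star_exp n m p r) =
      (\<Sum>q\<le>nat \<lfloor>p\<rfloor>. binom_inf (star_exp n m p r + int q) (star_exp n m p r) * coeff_fun (twist_exp m wt r) u v (star_exp n m p r + int q))"
    by (rule coeff_inf_eq_sum_nat, rule coeff_fun_high[OF assms(1)]) (use fracN_eq(2)[OF assms(3)] in \<open>simp add: star_exp_def\<close>)
  then show ?thesis by (simp add: star_bihom[OF assms(1)] star_hom_eq[OF assms(2)] \<phi>_sum \<phi>_scale)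
qed

lemma phi_L: "\<phi> (Y \<omega> 0 x) + \<phi> (Y \<omega> 1 x) = of_real (n - m) * \<phi> x"
proof -
  have "\<phi> (Y \<omega> 0 x) + \<phi> (Y \<omega> 1 x) + of_real (m - n) * \<phi> x = 0"
    using kills[OF L_in_Oprime[of x m n]] unfolding \<phi>_add \<phi>_scale .
  then show ?thesis by (simp add: algebra_simps)
qed

text \<open>Moving \<open>L(-1) + L(0)\<close> through \<open>Y(a,x)\<close> leaves an outer
  \<open>L(-1) + L(0)\<close>, which \<open>\<phi>\<close> turns into the scalar
  \<open>n - m\<close>, and the operator \<open>z d/dz - twist_exp\<close>. On the picked
  coefficient its eigenvalue is \<open>n - p - wt\<close>, and everything cancels.\<close>

lemma star_L_right:
  assumes a: "bihom wt r a" and p: "p \<in> fracN T"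
  shows "\<phi> (star g T n m p a (Y \<omega> 0 y + Y \<omega> 1 y + scale (of_real (m - p)) y)) = 0"
proof (cases "degree_ok n p r")
  case False
  then show ?thesis by (simp add: star_eq_0[OF a] \<phi>_zero)
next
  case True
  have r: "r < T" and aV: "a \<in> V wt" using a by (auto simp: bihom_def)
  define F where "F = coeff_fun (twist_exp m wt r) a y"
  have ev: "eventually_0 F" unfolding F_def by (rule coeff_fun_eventually_0[OF a])
  have "coeff_fun (twist_exp m wt r) a (Y \<omega> 0 y + Y \<omega> 1 y + scale (of_real (m - p)) y) i =
      (of_real (n - p) - of_int wt) * F i - ((of_int i - twist_exp m wt r) * F i + of_int (i + 1) * F (i + 1))" for i
  proof -
    have "coeff_fun (twist_exp m wt r) a (Y \<omega> 0 y + Y \<omega> 1 y + scale (of_real (m - p)) y) i =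
        coeff_fun (twist_exp m wt r) a (Y \<omega> 0 y + Y \<omega> 1 y) i + of_real (m - p) * F i"
      unfolding res_Y_add_right[of _ _ "Y \<omega> 0 y + Y \<omega> 1 y"] \<phi>_add res_Y_scale_right \<phi>_scale F_def ..
    also have "coeff_fun (twist_exp m wt r) a (Y \<omega> 0 y + Y \<omega> 1 y) i =
        of_real (n - m) * F i + ((twist_exp m wt r + 1 - of_int (i + 1) - of_int wt) * F i - of_int (i + 1) * F (i + 1))"
      unfolding res_Y_L_right[OF aV] \<phi>_add \<phi>_diff \<phi>_scale phi_L F_def by simp
    finally show ?thesis by (simp add: algebra_simps)
  qed
  then have "\<phi> (star g T n m p a (Y \<omega> 0 y + Y \<omega> 1 y + scale (of_real (m - p)) y)) =
      coeff_inf (\<lambda>i. (of_real (n - p) - of_int wt) * F i - ((of_int i - twist_exp m wt r) * F i + of_int (i + 1) * F (i + 1))) (star_exp n m p r)"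
    by (simp add: phi_star[OF a True p])
  also have "\<dots> = (of_real (n - p) - of_int wt) * coeff_inf F (star_exp n m p r) - (of_int (star_exp n m p r) - twist_exp m wt r) * coeff_inf F (star_exp n m p r)"
    by (subst coeff_inf_diff[OF ev eventually_0_derivative[OF ev]]) (simp only: coeff_inf_derivative[OF ev])
  also have "\<dots> = 0" by (simp add: star_exp_minus_twist_exp[OF True r n p])
  finally show ?thesis .
qed

text \<open>Inserting \<open>L(-1)b\<close> applies \<open>z d/dz - twist_exp\<close>, with
  eigenvalue \<open>n - p - wt\<close> on the picked coefficient, and \<open>L(0)b\<close> adds
  \<open>wt\<close>.\<close>

lemma star_L_left:
  assumes b: "bihom wt r b" and p: "p \<in> fracN T"
  shows "\<phi> (star g T n m p (Y \<omega> 0 b + Y \<omega> 1 b + scale (of_real (p - n)) b) c) = 0"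
proof (cases "degree_ok n p r")
  case False
  then show ?thesis
    using b L0_grading[of b wt]
    by (simp add: star_add_left star_scale_left star_eq_0[OF b] star_eq_0[OF bihom_L_minus1[OF b]] \<phi>_zero bihom_def)
next
  case True
  have r: "r < T" and bV: "b \<in> V wt" using b by (auto simp: bihom_def)
  define F where "F = coeff_fun (twist_exp m wt r) b c"
  have ev: "eventually_0 F" unfolding F_def by (rule coeff_fun_eventually_0[OF b])
  have "coeff_fun (twist_exp m (wt + 1) r) (Y \<omega> 0 b) c i = (of_int i - twist_exp m wt r) * F i + of_int (i + 1) * F (i + 1)" for i
    unfolding twist_exp_Suc res_Y_L_minus1 \<phi>_diff \<phi>_scale F_def by (simp add: algebra_simps)
  then have "\<phi> (star g T n m p (Y \<omega> 0 b) c) = (of_int (star_exp n m p r) - twist_exp m wt r) * coeff_inf F (star_exp n m p r)"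
    by (simp only: phi_star[OF bihom_L_minus1[OF b] True p] coeff_inf_derivative[OF ev])
  moreover have "\<phi> (star g T n m p b c) = coeff_inf F (star_exp n m p r)"
    by (simp add: phi_star[OF b True p] F_def)
  ultimately show ?thesis
    unfolding L0_grading[OF bV] star_add_left star_scale_left \<phi>_add \<phi>_scale
      star_exp_minus_twist_exp[OF True r n p]
    by (simp add: algebra_simps)
qed

text \<open>\<open>\<kappa> - E\<close> is the exponent of \<open>1 + x\<close> belonging to
  \<open>Y a E b\<close> minus the sum of those of \<open>a\<close> and \<open>b\<close>; its last
  term in \<open>\<kappa>\<close> is the carry of \<open>r + s\<close>. Thus \<open>W\<close> uses
  the exponent with which \<open>phi_star\<close> applies to \<open>Y a E b\<close>.\<close>

lemma phi_associativity:
  fixes a b c wa wb r s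
  defines "u \<equiv> (r + s) mod T"
    and "p \<equiv> \<lambda>i j. \<phi> (res_Y (binom_quot (twist_exp m wa r) (i + 1)) a (res_Y (binom_quot (twist_exp m wb s) (j + 1)) b c))"
    and "W \<equiv> \<lambda>E x. coeff_inf (coeff_fun (twist_exp m (wa + wb - E - 1) ((r + s) mod T)) (Y a E b) c) x"
    and "\<kappa> \<equiv> lam m ((r + s) mod T) - lam m r - lam m s - int ((r + s) div T)"
    and "d1 \<equiv> lam m r + mu n r - 1" and "d2 \<equiv> lam m s + mu n s - 1"
  assumes a: "bihom wa r a" and b: "bihom wb s b"
  obtains N where "\<And>E. E \<ge> int N \<Longrightarrow> Y a E b = 0"
    and "\<And>e1. eventually_0 (\<lambda>j. coeff_inf (\<lambda>i. p i j) e1)"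
    and "\<And>e1 e2 \<mu> Q. \<mu> \<ge> d2 - e1 - e2 \<Longrightarrow> int Q \<ge> d1 - e1 \<Longrightarrow>
      coeff_inf (\<lambda>j. coeff_inf (\<lambda>i. p i j) e1) e2 = (\<Sum>q\<le>Q. binom_inf (e1 + \<mu> + int q) (e1 + \<mu>) *
        (\<Sum>E\<in>{-(e1 + \<mu> + int q + 1)..int N - 1}. gbinom_int (twist_exp m wa r + of_int \<mu>) (E + (e1 + \<mu> + int q + 1)) *
          W E (e1 + e2 + 1 + \<kappa>)))"
    and "\<And>x \<mu> K. \<mu> \<ge> d2 - x + \<kappa> + 1 \<Longrightarrow> K > d1 + \<mu> + 1 \<Longrightarrow>
      (\<Sum>E\<in>{-K..int N - 1}. gbinom_int (twist_exp m wa r + of_int \<mu>) (E + K) * W E x) = 0"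
proof -
  have "\<exists>N lo. (\<forall>E\<ge>int N. Y a E b = 0) \<and> three_point_iterate p
    (\<lambda>i j. \<phi> (res_Y (binom_quot (twist_exp m wb s) (j + 1)) b (res_Y (binom_quot (twist_exp m wa r) (i + 1)) a c))) N d1 d2 lo
    (\<lambda>\<gamma> E. coeff_fun \<gamma> (Y a E b) c) (twist_exp m wa r) (twist_exp m wb s)"
    unfolding p_def d1_def d2_def
    by (rule three_point_iterateI[OF \<phi>]) (rule coeff_fun_high[OF a] coeff_fun_high[OF b], assumption)+
  then obtain N lo where N: "\<And>E. E \<ge> int N \<Longrightarrow> Y a E b = 0" and tp: "three_point_iterate p
    (\<lambda>i j. \<phi> (res_Y (binom_quot (twist_exp m wb s) (j + 1)) b (res_Y (binom_quot (twist_exp m wa r) (i + 1)) a c))) N d1 d2 lo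
    (\<lambda>\<gamma> E. coeff_fun \<gamma> (Y a E b) c) (twist_exp m wa r) (twist_exp m wb s)" by blast
  interpret tp: three_point_iterate p
    "\<lambda>i j. \<phi> (res_Y (binom_quot (twist_exp m wb s) (j + 1)) b (res_Y (binom_quot (twist_exp m wa r) (i + 1)) a c))" N d1 d2 lo
    "\<lambda>\<gamma> E. coeff_fun \<gamma> (Y a E b) c" "twist_exp m wa r" "twist_exp m wb s" by (rule tp)
  \<comment> \<open>\<open>\<kappa>\<close> may lie below \<open>int N\<close>, while
    \<open>associativity\<close> needs \<open>\<nu> \<ge> int N\<close>. The surplus
    \<open>s'\<close> multiplies by \<open>z2^s'\<close>, which \<open>coeff_fun_shift\<close>
    undoes.\<close>
  define s' where "s' = nat (int N - \<kappa>)"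
  define \<nu> where "\<nu> = \<kappa> + int s'"
  have \<nu>: "\<nu> \<ge> int N" unfolding \<nu>_def s'_def by linarith
  have exps: "twist_exp m wa r + twist_exp m wb s + of_int (\<nu> - E) = twist_exp m (wa + wb - E - 1) ((r + s) mod T) + of_nat s'" for E
  proof -
    have "of_nat r + of_nat s = (of_nat T * of_nat ((r + s) div T) + of_nat ((r + s) mod T) :: complex)"
      by (simp flip: of_nat_add of_nat_mult)
    then have "of_nat r / of_nat T + of_nat s / of_nat T = (of_nat ((r + s) div T) + of_nat ((r + s) mod T) / of_nat T :: complex)"
      using T_pos by (simp add: add_divide_distrib[symmetric]) (simp add: add_divide_distrib)
    then show ?thesis by (simp add: twist_exp_def \<nu>_def \<kappa>_def algebra_simps)
  qed
  note bh = bihom_mode[OF a b]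
  have ev: "eventually_0 (coeff_fun (twist_exp m wa r + twist_exp m wb s + of_int (\<nu> - E)) (Y a E b) c)" for E
    unfolding exps by (rule coeff_fun_shift(1)[OF bh])
  have W: "coeff_inf (coeff_fun (twist_exp m wa r + twist_exp m wb s + of_int (\<nu> - E)) (Y a E b) c) (x + int s') = W E x" for E x
    unfolding exps W_def by (rule coeff_fun_shift(2)[OF bh])
  show ?thesis
  proof
    show "\<And>E. E \<ge> int N \<Longrightarrow> Y a E b = 0" by (rule N)
    show "\<And>e1. eventually_0 (\<lambda>j. coeff_inf (\<lambda>i. p i j) e1)" by (rule tp.eventually_0_coeff_inf_p)
    fix e1 e2 \<mu> and Q :: nat
    assume \<mu>: "\<mu> \<ge> d2 - e1 - e2" and Q: "int Q \<ge> d1 - e1"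
    have eq: "e1 + e2 + \<nu> + 1 = (e1 + e2 + 1 + \<kappa>) + int s'" by (simp add: \<nu>_def)
    show "coeff_inf (\<lambda>j. coeff_inf (\<lambda>i. p i j) e1) e2 = (\<Sum>q\<le>Q. binom_inf (e1 + \<mu> + int q) (e1 + \<mu>) *
        (\<Sum>E\<in>{-(e1 + \<mu> + int q + 1)..int N - 1}. gbinom_int (twist_exp m wa r + of_int \<mu>) (E + (e1 + \<mu> + int q + 1)) *
          W E (e1 + e2 + 1 + \<kappa>)))"
      using tp.associativity[OF \<nu> ev \<mu> Q] unfolding eq W .
  next
    fix x \<mu> K assume \<mu>: "\<mu> \<ge> d2 - x + \<kappa> + 1" and K: "K > d1 + \<mu> + 1"
    have "\<mu> \<ge> d2 - (x + int s') + \<nu> + 1" using \<mu> by (simp add: \<nu>_def)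
    from tp.iterate_modes_eq_0[OF \<nu> ev this K]
    show "(\<Sum>E\<in>{-K..int N - 1}. gbinom_int (twist_exp m wa r + of_int \<mu>) (E + K) * W E x) = 0"
      unfolding W .
  qed
qed

lemmas phi_simps = \<phi>_add \<phi>_scale \<phi>_zero \<phi>_diff star_add_left star_scale_left star_zero_left
  star_add_right star_scale_right star_zero_right circ_add_left circ_scale_left circ_zero_left

text \<open>The coefficient of \<open>z1^star_exp\<close> in the three-point function has degree
  below \<open>lam m s + mu p s\<close> in \<open>x2\<close>: \<open>mu_compose_ge\<close> puts the
  coefficients of the iterates beyond the bound in \<open>coeff_fun_high\<close>, and
  \<open>coeff_inf_all_0_imp\<close> returns to powers of \<open>x2\<close>. The first vanishing
  degree is the circle product.\<close>

lemma phi_star_res_Y_high: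
  assumes a: "bihom wa r a" and b: "bihom wb s b" and ok: "degree_ok n p r" and p: "p \<in> fracN T"
    and j: "j \<ge> lam m s + mu p s"
  shows "\<phi> (star g T n m p a (res_Y (binom_quot (twist_exp m wb s) (j + 1)) b c)) = 0"
proof -
  have rs: "r < T" "s < T" using a b by (auto simp: bihom_def)
  obtain N where ev: "\<And>e1. eventually_0 (\<lambda>j. coeff_inf (\<lambda>i. \<phi> (res_Y (binom_quot (twist_exp m wa r) (i + 1)) a (res_Y (binom_quot (twist_exp m wb s) (j + 1)) b c))) e1)"
    and assoc: "\<And>e1 e2 \<mu> Q. \<mu> \<ge> (lam m s + mu n s - 1) - e1 - e2 \<Longrightarrow> int Q \<ge> (lam m r + mu n r - 1) - e1 \<Longrightarrow>
      coeff_inf (\<lambda>j. coeff_inf (\<lambda>i. \<phi> (res_Y (binom_quot (twist_exp m wa r) (i + 1)) a (res_Y (binom_quot (twist_exp m wb s) (j + 1)) b c))) e1) e2 =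
      (\<Sum>q\<le>Q. binom_inf (e1 + \<mu> + int q) (e1 + \<mu>) *
        (\<Sum>E\<in>{-(e1 + \<mu> + int q + 1)..int N - 1}. gbinom_int (twist_exp m wa r + of_int \<mu>) (E + (e1 + \<mu> + int q + 1)) *
          coeff_inf (coeff_fun (twist_exp m (wa + wb - E - 1) ((r + s) mod T)) (Y a E b) c)
            (e1 + e2 + 1 + (lam m ((r + s) mod T) - lam m r - lam m s - int ((r + s) div T)))))"
    using phi_associativity[OF a b, of c thesis] by blast
  define e1 where "e1 = star_exp n m p r"
  let ?f = "\<lambda>j. coeff_inf (\<lambda>i. \<phi> (res_Y (binom_quot (twist_exp m wa r) (i + 1)) a (res_Y (binom_quot (twist_exp m wb s) (j + 1)) b c))) e1"
  have "?f j = 0"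
  proof (rule coeff_inf_all_0_imp[OF ev _ j])
    fix e2 assume e2: "e2 \<ge> lam m s + mu p s"
    have "coeff_inf (coeff_fun (twist_exp m (wa + wb - E - 1) ((r + s) mod T)) (Y a E b) c)
            (e1 + e2 + 1 + (lam m ((r + s) mod T) - lam m r - lam m s - int ((r + s) div T))) = 0" for E
    proof (rule coeff_inf_0, rule coeff_fun_high[OF bihom_mode[OF a b]])
      fix i assume "i \<ge> e1 + e2 + 1 + (lam m ((r + s) mod T) - lam m r - lam m s - int ((r + s) div T))"
      then show "i > lam m ((r + s) mod T) + mu n ((r + s) mod T) - 1"
        using mu_compose_ge[OF ok rs] e2 by (simp add: e1_def star_exp_def)
    qed
    \<comment> \<open>All iterate terms vanish, so any admissible \<open>\<mu>\<close> and
      \<open>Q\<close> would do; the least ones are taken.\<close>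
    then show "coeff_inf ?f e2 = 0"
      by (subst assoc[of e1 e2 "(lam m s + mu n s - 1) - e1 - e2" "nat ((lam m r + mu n r - 1) - e1)"]) auto
  qed
  then show ?thesis by (simp add: phi_star[OF a ok p] e1_def)
qed

lemma phi_star_Oprime:
  assumes p: "p \<in> fracN T" and y: "y \<in> Oprime g T p m"
  shows "\<phi> (star g T n m p a y) = 0"
proof (rule bihom_induct[where u = a])
  show "subspace {a. \<phi> (star g T n m p a y) = 0}" by (simp add: subspace_def phi_simps)
next
  fix wa r a assume a: "bihom wa r a"
  show "\<phi> (star g T n m p a y) = 0"
    using y
  proof (rule Oprime_induct)
    show "subspace {y. \<phi> (star g T n m p a y) = 0}" by (simp add: subspace_def phi_simps)
    show "\<phi> (star g T n m p a (Y \<omega> 0 u + Y \<omega> 1 u + scale (of_real (m - p)) u)) = 0" for u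
      by (rule star_L_right[OF a p])
    show "\<phi> (star g T n m p a (circ g T p m b c)) = 0" for b c
    proof (rule bihom_induct[where u = b])
      show "subspace {b. \<phi> (star g T n m p a (circ g T p m b c)) = 0}" by (simp add: subspace_def phi_simps)
    next
      fix wb s b assume b: "bihom wb s b"
      show "\<phi> (star g T n m p a (circ g T p m b c)) = 0"
      proof (cases "degree_ok n p r")
        case True
        from phi_star_res_Y_high[OF a b True p, of "lam m s + mu p s" c] show ?thesis
          by (simp add: circ_bihom[OF b] circ_hom_eq)
      qed (simp add: star_eq_0[OF a] \<phi>_zero)
    qed
  qed
qed

text \<open>A circle product with lower index \<open>p\<close> carries the exponent for
  \<open>p\<close>, whereas \<open>\<phi>\<close> controls the exponent for \<open>m\<close>. The
  quotient is \<open>z1^(lam p r - lam m r)\<close>, the power with which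
  \<open>iterate_modes_eq_0\<close> is used.\<close>

lemma phi_Oprime_star:
  assumes p: "p \<in> fracN T" and y: "y \<in> Oprime g T n p"
  shows "\<phi> (star g T n m p y c) = 0"
  using y
proof (rule Oprime_induct)
  show "subspace {y. \<phi> (star g T n m p y c) = 0}" by (simp add: subspace_def phi_simps)
  show "\<phi> (star g T n m p (Y \<omega> 0 b + Y \<omega> 1 b + scale (of_real (p - n)) b) c) = 0" for b
  proof (rule bihom_induct[where u = b])
    define D where "D b = Y \<omega> 0 b + Y \<omega> 1 b + scale (of_real (p - n)) b" for b
    have "D (x + y) = D x + D y" "D (scale c x) = scale c (D x)" "D 0 = 0" for x y c
      by (simp_all add: D_def Y_add_right Y_scale_right scale_right_distrib mult.commute)
    then show "subspace {b. \<phi> (star g T n m p (Y \<omega> 0 b + Y \<omega> 1 b + scale (of_real (p - n)) b) c) = 0}"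
      unfolding D_def[symmetric] by (simp add: subspace_def phi_simps)
  qed (rule star_L_left[OF _ p])
  show "\<phi> (star g T n m p (circ g T n p a b) c) = 0" for a b
  proof (rule bihom_induct[where u = a])
    show "subspace {a. \<phi> (star g T n m p (circ g T n p a b) c) = 0}" by (simp add: subspace_def phi_simps)
  next
    fix wa r a assume a: "bihom wa r a"
    show "\<phi> (star g T n m p (circ g T n p a b) c) = 0"
    proof (rule bihom_induct[where u = b])
      show "subspace {b. \<phi> (star g T n m p (circ g T n p a b) c) = 0}"
        by (simp add: subspace_def phi_simps circ_bihom[OF a] circ_hom_eq res_Y_add_right res_Y_scale_right)
    next
      fix wb s b assume b: "bihom wb s b"
      have rs: "r < T" "s < T" using a b by (auto simp: bihom_def)
      obtain N where N: "\<And>E. E \<ge> int N \<Longrightarrow> Y a E b = 0"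
        and zero: "\<And>x \<mu> K. \<mu> \<ge> (lam m s + mu n s - 1) - x + (lam m ((r + s) mod T) - lam m r - lam m s - int ((r + s) div T)) + 1 \<Longrightarrow>
          K > (lam m r + mu n r - 1) + \<mu> + 1 \<Longrightarrow>
          (\<Sum>E\<in>{-K..int N - 1}. gbinom_int (twist_exp m wa r + of_int \<mu>) (E + K) *
            coeff_inf (coeff_fun (twist_exp m (wa + wb - E - 1) ((r + s) mod T)) (Y a E b) c) x) = 0"
        using phi_associativity[OF a b, of c thesis] by blast
      \<comment> \<open>The pole order of the circle product; it exceeds by exactly one the quantity
        \<open>d1 + \<mu> + 1\<close> for \<open>\<mu> = lam p r - lam m r\<close>.\<close>
      define K where "K = lam p r + mu n r + 1"
      have twist_exp: "twist_exp p wa r = twist_exp m wa r + of_int (lam p r - lam m r)" by (simp add: twist_exp_def)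
      have "\<phi> (star g T n m p (circ g T n p a b) c) =
          (\<Sum>E\<in>{-K..int N - 1}. gbinom_int (twist_exp p wa r) (E + K) * \<phi> (star g T n m p (Y a E b) c))"
        unfolding circ_bihom[OF a] circ_hom_eq K_def[symmetric]
        by (subst res_Y_range[OF N]) (simp_all add: star_sum_left star_scale_left \<phi>_sum \<phi>_scale)
      also have "\<dots> = 0"
      proof (cases "degree_ok n p ((r + s) mod T)")
        case True
        show ?thesis
          unfolding phi_star[OF bihom_mode[OF a b] True p] twist_exp
          using lam_mu_ge[OF True rs] by (intro zero) (simp_all add: star_exp_def K_def)
      qed (simp add: star_eq_0[OF bihom_mode[OF a b]] \<phi>_zero)
      finally show "\<phi> (star g T n m p (circ g T n p a b) c) = 0" .
    qed
  qed
qed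

text \<open>Both sides are one coefficient of a three-point function, on the right in |z1| > |z2|,
  on the left through the iterate. The lower index \<open>p1\<close> of the inner product
  contributes the power \<open>\<mu>\<close> in \<open>associativity\<close>. If a degree condition
  fails, both sides vanish, by \<open>degree_ok_trans_iff\<close> in the case of
  \<open>b\<close>.\<close>

lemma phi_star_star_bihom:
  assumes a: "bihom wa r a" and b: "bihom wb s b" and p1: "p1 \<in> fracN T" and p2: "p2 \<in> fracN T"
  shows "\<phi> (star g T n m p1 (star g T n p1 p2 a b) c) = \<phi> (star g T n m p2 a (star g T p2 m p1 b c))"
proof (cases "degree_ok n p2 r")
  case False
  then show ?thesis by (simp add: star_eq_0[OF a] star_zero_left)
next
  case ok2: True
  have rs: "r < T" "s < T" using a b by (auto simp: bihom_def)
  let ?u = "(r + s) mod T"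
  note bh = bihom_mode[OF a b]
  obtain N where N: "\<And>E. E \<ge> int N \<Longrightarrow> Y a E b = 0"
    and assoc: "\<And>e1 e2 \<mu> Q. \<mu> \<ge> (lam m s + mu n s - 1) - e1 - e2 \<Longrightarrow> int Q \<ge> (lam m r + mu n r - 1) - e1 \<Longrightarrow>
      coeff_inf (\<lambda>j. coeff_inf (\<lambda>i. \<phi> (res_Y (binom_quot (twist_exp m wa r) (i + 1)) a (res_Y (binom_quot (twist_exp m wb s) (j + 1)) b c))) e1) e2 =
      (\<Sum>q\<le>Q. binom_inf (e1 + \<mu> + int q) (e1 + \<mu>) *
        (\<Sum>E\<in>{-(e1 + \<mu> + int q + 1)..int N - 1}. gbinom_int (twist_exp m wa r + of_int \<mu>) (E + (e1 + \<mu> + int q + 1)) *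
          coeff_inf (coeff_fun (twist_exp m (wa + wb - E - 1) ?u) (Y a E b) c)
            (e1 + e2 + 1 + (lam m ?u - lam m r - lam m s - int ((r + s) div T)))))"
    using phi_associativity[OF a b, of c thesis] by blast
  define \<mu> where "\<mu> = lam p1 r - lam m r"
  define e1 where "e1 = star_exp n m p2 r"
  have twist_exp: "twist_exp p1 wa r = twist_exp m wa r + of_int \<mu>" by (simp add: twist_exp_def \<mu>_def)
  have e': "star_exp n p1 p2 r = e1 + \<mu>" by (simp add: star_exp_def \<mu>_def e1_def)
  have left: "\<phi> (star g T n m p1 (star g T n p1 p2 a b) c) =
      (\<Sum>q\<le>nat \<lfloor>p2\<rfloor>. binom_inf (e1 + \<mu> + int q) (e1 + \<mu>) *
        (\<Sum>E\<in>{-(e1 + \<mu> + int q + 1)..int N - 1}. gbinom_int (twist_exp m wa r + of_int \<mu>) (E + (e1 + \<mu> + int q + 1)) *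
          \<phi> (star g T n m p1 (Y a E b) c)))"
  proof -
    have "res_Y (binom_quot \<gamma> k) a b = (\<Sum>E\<in>{-k..int N - 1}. scale (gbinom_int \<gamma> (E + k)) (Y a E b))" for \<gamma> k
      by (rule res_Y_range) (rule N)
    then show ?thesis
      unfolding star_bihom[OF a] star_hom_eq[OF ok2] twist_exp e'
      by (simp only: star_sum_left star_scale_left \<phi>_sum \<phi>_scale)
  qed
  show ?thesis
  proof (cases "degree_ok p2 p1 s")
    case False
    then have "\<not> degree_ok n p1 ?u" using degree_ok_trans_iff[OF ok2] by blast
    then show ?thesis
      unfolding left using False by (simp add: star_eq_0[OF bh] star_eq_0[OF b] star_zero_right \<phi>_zero)
  next
    case ok1: True
    then have ok: "degree_ok n p1 ?u" using degree_ok_trans_iff[OF ok2] by blast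
    define e2 where "e2 = star_exp p2 m p1 s"
    have mu: "mu n r + mu p2 s - \<lfloor>p2\<rfloor> = mu n ?u + int ((r + s) div T)" by (rule mu_compose_eq[OF ok2 ok1 rs])
    \<comment> \<open>The carry in \<open>mu\<close> cancels the one in \<open>\<kappa>\<close>, so
      both sides pick the same power of \<open>z2\<close>.\<close>
    have x: "star_exp n m p1 ?u = e1 + e2 + 1 + (lam m ?u - lam m r - lam m s - int ((r + s) div T))"
      using mu by (simp add: star_exp_def e1_def e2_def)
    let ?f = "\<lambda>j. \<phi> (star g T n m p2 a (res_Y (binom_quot (twist_exp m wb s) (j + 1)) b c))"
    have "\<phi> (star g T n m p2 a (star g T p2 m p1 b c)) = (\<Sum>q\<le>nat \<lfloor>p1\<rfloor>. binom_inf (e2 + int q) e2 * ?f (e2 + int q))"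
      unfolding star_bihom[OF b] star_hom_eq[OF ok1] e2_def[symmetric]
      by (simp add: star_sum_right star_scale_right \<phi>_sum \<phi>_scale)
    \<comment> \<open>The sum may stop at \<open>\<lfloor>p1\<rfloor>\<close>, since
      \<open>e2 + \<lfloor>p1\<rfloor> = lam m s + mu p2 s - 1\<close> is the last degree left by
      \<open>phi_star_res_Y_high\<close>.\<close>
    also have "\<dots> = coeff_inf ?f e2"
      by (rule coeff_inf_eq_sum_nat[symmetric], rule phi_star_res_Y_high[OF a b ok2 p2])
        (use fracN_eq(2)[OF p1] in \<open>simp add: e2_def star_exp_def\<close>)
    also have "\<dots> = (\<Sum>q\<le>nat \<lfloor>p2\<rfloor>. binom_inf (e1 + \<mu> + int q) (e1 + \<mu>) *
        (\<Sum>E\<in>{-(e1 + \<mu> + int q + 1)..int N - 1}. gbinom_int (twist_exp m wa r + of_int \<mu>) (E + (e1 + \<mu> + int q + 1)) *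
          coeff_inf (coeff_fun (twist_exp m (wa + wb - E - 1) ?u) (Y a E b) c) (star_exp n m p1 ?u)))"
      unfolding phi_star[OF a ok2 p2] e1_def[symmetric] x
    proof (rule assoc)
      show "\<mu> \<ge> (lam m s + mu n s - 1) - e1 - e2"
        using lam_mu_ge[OF ok rs] mu by (simp add: \<mu>_def e1_def e2_def star_exp_def)
      \<comment> \<open>Equality holds: the cut-off of the inner product is the least admissible
        \<open>Q\<close>.\<close>
      show "int (nat \<lfloor>p2\<rfloor>) \<ge> (lam m r + mu n r - 1) - e1"
        using fracN_eq(2)[OF p2] by (simp add: e1_def star_exp_def)
    qed
    also have "\<dots> = \<phi> (star g T n m p1 (star g T n p1 p2 a b) c)"
      unfolding left phi_star[OF bh ok p1] ..
    finally show ?thesis ..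
  qed
qed

lemma phi_star_star:
  assumes p1: "p1 \<in> fracN T" and p2: "p2 \<in> fracN T"
  shows "\<phi> (star g T n m p1 (star g T n p1 p2 a b) c) = \<phi> (star g T n m p2 a (star g T p2 m p1 b c))"
proof (rule bihom_induct[where u = a])
  show "subspace {a. \<phi> (star g T n m p1 (star g T n p1 p2 a b) c) = \<phi> (star g T n m p2 a (star g T p2 m p1 b c))}"
    by (simp add: subspace_def phi_simps)
next
  fix wa r a assume a: "bihom wa r a"
  show "\<phi> (star g T n m p1 (star g T n p1 p2 a b) c) = \<phi> (star g T n m p2 a (star g T p2 m p1 b c))"
  proof (rule bihom_induct[where u = b])
    show "subspace {b. \<phi> (star g T n m p1 (star g T n p1 p2 a b) c) = \<phi> (star g T n m p2 a (star g T p2 m p1 b c))}"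
      by (simp add: subspace_def phi_simps)
  qed (rule phi_star_star_bihom[OF a _ p1 p2])
qed

end

section \<open>Closure properties of \<open>O'\<close> and the inclusions of \<open>O''\<close> and
  \<open>O'''\<close>\<close>

lemma in_OprimeI_functional:
  assumes "\<And>\<phi>. functional \<phi> \<Longrightarrow> (\<And>x. x \<in> Oprime g T n m \<Longrightarrow> \<phi> x = 0) \<Longrightarrow> \<phi> v = 0"
  shows "v \<in> Oprime g T n m"
  using functional_separates[OF Oprime_subspace, of v n m] assms by blast

lemma star_Oprime:
  assumes "n \<in> fracN T" "m \<in> fracN T" "p \<in> fracN T" "y \<in> Oprime g T p m"
  shows "star g T n m p a y \<in> Oprime g T n m"
  by (rule in_OprimeI_functional) (rule phi_star_Oprime[OF _ _ assms], auto)

lemma Oprime_star: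
  assumes "n \<in> fracN T" "m \<in> fracN T" "p \<in> fracN T" "y \<in> Oprime g T n p"
  shows "star g T n m p y c \<in> Oprime g T n m"
  by (rule in_OprimeI_functional) (rule phi_Oprime_star[OF _ _ assms], auto)

lemma star_associative:
  assumes "n \<in> fracN T" "m \<in> fracN T" "p1 \<in> fracN T" "p2 \<in> fracN T"
  shows "star g T n m p1 (star g T n p1 p2 a b) c - star g T n m p2 a (star g T p2 m p1 b c) \<in> Oprime g T n m"
proof (rule in_OprimeI_functional)
  fix \<phi> assume \<phi>: "functional \<phi>" and kills: "\<And>x. x \<in> Oprime g T n m \<Longrightarrow> \<phi> x = 0"
  show "\<phi> (star g T n m p1 (star g T n p1 p2 a b) c - star g T n m p2 a (star g T p2 m p1 b c)) = 0"
    using phi_star_star[OF \<phi> kills assms] module_hom.diff[OF module_hom_of_linear[OF \<phi>]] by simp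
qed

lemma star_span_Oprime:
  assumes "\<And>a b. a \<in> A \<Longrightarrow> b \<in> B \<Longrightarrow> star g T n m p a b \<in> Oprime g T n m"
  shows "star_span g T n m p A B \<subseteq> Oprime g T n m"
  unfolding star_span_def using assms by (intro span_minimal Oprime_subspace) auto

lemma Odprime_subset:
  assumes "n \<in> fracN T" "m \<in> fracN T"
  shows "Odprime g T n m \<subseteq> Oprime g T n m"
  unfolding Odprime_def
  by (intro span_minimal Oprime_subspace) (auto intro!: star_Oprime star_associative assms)

lemma Otprime_subset:
  assumes "n \<in> fracN T" "m \<in> fracN T"
  shows "Otprime g T n m \<subseteq> Oprime g T n m"
  unfolding Otprime_def
proof (intro span_minimal Oprime_subspace UN_least star_span_Oprime)
  fix p1 p2 a b
  assume p: "p1 \<in> fracN T" "p2 \<in> fracN T" and a: "a \<in> star_span g T n p1 p2 UNIV (Oprime g T p2 p1)"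
  have "star_span g T n p1 p2 UNIV (Oprime g T p2 p1) \<subseteq> Oprime g T n p1"
    by (rule star_span_Oprime) (rule star_Oprime[OF assms(1) p])
  then show "star g T n m p1 a b \<in> Oprime g T n m"
    using a by (intro Oprime_star assms p) blast
qed

lemma Ofull_eq_Oprime:
  assumes "n \<in> fracN T" "m \<in> fracN T"
  shows "Ofull g T n m = Oprime g T n m"
proof
  show "Ofull g T n m \<subseteq> Oprime g T n m"
    unfolding Ofull_def using Odprime_subset[OF assms] Otprime_subset[OF assms]
    by (auto intro!: subspace_add Oprime_subspace)
  have "0 \<in> Odprime g T n m" "0 \<in> Otprime g T n m"
    unfolding Odprime_def Otprime_def by (rule span_zero)+
  then show "Oprime g T n m \<subseteq> Ofull g T n m"
    unfolding Ofull_def by force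
qed

end

theorem theorem1p1:
  fixes scale :: "complex \<Rightarrow> 'v::ab_group_add \<Rightarrow> 'v"
    and V :: "int \<Rightarrow> 'v set"
    and Y :: "'v \<Rightarrow> int \<Rightarrow> 'v \<Rightarrow> 'v"
    and vac \<omega> :: 'v
    and g :: "'v \<Rightarrow> 'v"
    and T :: nat
    and n m :: real
  assumes "vertex_operator_algebra scale V Y vac \<omega>"
    and "vertex_operator_algebra.automorphism scale Y vac \<omega> g"
    and "has_order g T"
    and "n \<in> fracN T" and "m \<in> fracN T"
  shows "vertex_operator_algebra.Ofull scale V Y \<omega> g T n m =
         vertex_operator_algebra.Oprime scale V Y \<omega> g T n m"
proof -
  interpret voa_automorphism scale V Y vac \<omega> g T
    using assms(1-3) by (intro voa_automorphism.intro voa_automorphism_axioms.intro)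
  show ?thesis by (rule Ofull_eq_Oprime[OF assms(4,5)])
qed

end
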